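(* Let $T$ be a tree of order $n\ge4$ which is not isomorphic to the star $K_{1,n-1}$. Then $$E_{\mathcal{E}}(T)+E_{\mathcal{E}}(T^c)\ge2\Big(\sqrt{13n-35+8\sqrt{n-3}}+\sqrt{4n+1+8\sqrt{n-3}}\Big),$$ with equality if and only if $T\cong T_{n,3}^{0,n-4}$.
   Context: For a connected graph $G$, the eccentricity matrix $\mathcal{E}(G)$ is the matrix indexed by $V(G)$ whose $(u,v)$-entry is $d_G(u,v)$ if $d_G(u,v)=\min\{e_G(u),e_G(v)\}$ and $0$ otherwise, where $d_G$ is the graph distance and $e_G(u)=\max_v d_G(u,v)$. The $\mathcal{E}$-energy $E_{\mathcal{E}}(G)$ is the sum of the absolute values of the eigenvalues of $\mathcal{E}(G)$. $T^c$ is the complement of $T$. $T_{n,3}^{0,n-4}$ is the tree obtained from the path $v_0v_1v_2v_3$ by attaching $n-4$ pendant vertices to $v_2$. *)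

theory Defs
  imports
    "Graph_Theory.Graph_Theory"
    "Jordan_Normal_Form.Char_Poly"
begin

text \<open>
  A finite simple graph is a \<^const>\<open>pair_graph\<close>: a finite loop-free symmetric digraph, each edge
  being represented by its two arcs. Distances are lengths of shortest walks; they are only
  meaningful between vertices of the same component.
\<close>

definition graph_dist :: "'a pair_pre_digraph \<Rightarrow> 'a \<Rightarrow> 'a \<Rightarrow> nat" where
  "graph_dist G u v = (LEAST k. \<exists>p. pre_digraph.awalk (with_proj G) u p v \<and> length p = k)"

lemma graph_dist_eq_mu:
  assumes "pair_wf_digraph G" and "reachable (with_proj G) u v"
  shows "ereal (real (graph_dist G u v)) = wf_digraph.\<mu> (with_proj G) (\<lambda>_. 1) u v"
proof -
  interpret pair_wf_digraph G by fact
  let ?P = "\<lambda>k. \<exists>p. awalk u p v \<and> length p = k"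
  have cost: "awalk_cost (\<lambda>_. 1) p = real (length p)" for p
    by (induction p) auto
  obtain p where "awalk u p v"
    using assms(2) reachable_awalk by auto
  then have "?P (length p)" by blast
  then have "?P (LEAST k. ?P k)" by (rule LeastI)
  then obtain q where q: "awalk u q v" "length q = (LEAST k. ?P k)" by blast
  have le: "(LEAST k. ?P k) \<le> length r" if "awalk u r v" for r
    using that by (intro Least_le) blast
  show ?thesis
    unfolding \<mu>_def graph_dist_def cost
    by (rule sym, rule antisym)
      (use q le in \<open>auto intro!: INF_lower2[of q] INF_greatest\<close>)
qed

definition eccentricity :: "'a pair_pre_digraph \<Rightarrow> 'a \<Rightarrow> nat" where
  "eccentricity G u = Max (graph_dist G u ` pverts G)"

definition ecc_entry :: "'a pair_pre_digraph \<Rightarrow> 'a \<Rightarrow> 'a \<Rightarrow> nat" where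
  "ecc_entry G u v =
     (if graph_dist G u v = min (eccentricity G u) (eccentricity G v) then graph_dist G u v else 0)"

text \<open>The eccentricity matrix with rows and columns ordered by an enumeration of the vertices.\<close>

definition ecc_matrix :: "'a pair_pre_digraph \<Rightarrow> 'a list \<Rightarrow> complex mat" where
  "ecc_matrix G vs = mat (length vs) (length vs) (\<lambda>(i, j). of_nat (ecc_entry G (vs ! i) (vs ! j)))"

text \<open>Eigenvalues are counted with algebraic multiplicity.\<close>

definition mat_energy :: "complex mat \<Rightarrow> real" where
  "mat_energy A = (\<Sum>x | eigenvalue A x. real (order x (char_poly A)) * cmod x)"

definition ecc_energy :: "'a pair_pre_digraph \<Rightarrow> real" where
  "ecc_energy G = mat_energy (ecc_matrix G (SOME vs. distinct vs \<and> set vs = pverts G))"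

text \<open>The choice of the enumeration is immaterial:\<close>

lemma ecc_energy_eq:
  assumes "distinct vs" and "set vs = pverts G"
  shows "ecc_energy G = mat_energy (ecc_matrix G vs)"
proof -
  define ws where "ws = (SOME vs. distinct vs \<and> set vs = pverts G)"
  have "distinct ws \<and> set ws = pverts G"
    unfolding ws_def by (rule someI[of _ vs]) (use assms in simp)
  then have ws: "distinct ws" "set ws = pverts G" by auto
  define n where "n = length vs"
  have len: "length ws = n"
    using assms ws distinct_card n_def by metis
  have "\<forall>i<n. \<exists>j<n. ws ! i = vs ! j"
    using assms ws len n_def by (metis in_set_conv_nth nth_mem)
  then obtain f where f: "\<And>i. i < n \<Longrightarrow> f i < n" "\<And>i. i < n \<Longrightarrow> ws ! i = vs ! f i"
    by metis
  have inj: "f i = f j \<longleftrightarrow> i = j" if "i < n" "j < n" for i j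
    using that f ws(1) len by (metis nth_eq_iff_index_eq)
  let ?A = "ecc_matrix G ws" and ?B = "ecc_matrix G vs"
  define P :: "complex mat" where "P = mat n n (\<lambda>(i, j). if f i = j then 1 else 0)"
  define Q :: "complex mat" where "Q = mat n n (\<lambda>(i, j). if i = f j then 1 else 0)"
  have carr: "?A \<in> carrier_mat n n" "?B \<in> carrier_mat n n" "P \<in> carrier_mat n n" "Q \<in> carrier_mat n n"
    using len by (auto simp: ecc_matrix_def P_def Q_def n_def)
  have PQ: "P * Q = 1\<^sub>m n"
    by (rule eq_matI)
      (use f inj in \<open>auto simp: P_def Q_def scalar_prod_def if_distrib[of "\<lambda>x. x * _"]
         cong: if_cong\<close>)
  have QP: "Q * P = 1\<^sub>m n"
    using mat_mult_left_right_inverse[OF carr(3,4) PQ] .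
  have PB: "P * ?B = mat n n (\<lambda>(i, j). ?B $$ (f i, j))"
    by (rule eq_matI)
      (use f carr in \<open>auto simp: P_def scalar_prod_def if_distrib[of "\<lambda>x. x * _"] cong: if_cong\<close>)
  have "P * ?B * Q = ?A"
    unfolding PB
    by (rule eq_matI)
      (use f len carr in \<open>auto simp: Q_def scalar_prod_def if_distrib[of "\<lambda>x. _ * x"]
         ecc_matrix_def n_def[symmetric] cong: if_cong\<close>)
  then have "similar_mat ?A ?B"
    by (intro similar_matI[of _ _ P Q n]) (use carr PQ QP in simp_all)
  then have "char_poly ?A = char_poly ?B"
    by (rule char_poly_similar)
  moreover from this have "eigenvalue ?A = eigenvalue ?B"
    using carr by (simp add: eigenvalue_root_char_poly fun_eq_iff)
  ultimately show ?thesis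
    unfolding ecc_energy_def mat_energy_def ws_def[symmetric] by simp
qed

text \<open>
  The predicate \<^const>\<open>Digraph_Component.tree\<close> is unsuitable for symmetric digraphs, because going
  back and forth along one edge is a \<^const>\<open>pre_digraph.cycle\<close> of length two. Cycles of a simple
  graph have length at least three.
\<close>

definition graph_tree :: "'a pair_pre_digraph \<Rightarrow> bool" where
  "graph_tree G \<longleftrightarrow> pair_graph G \<and> Digraph_Component.connected (with_proj G) \<and>
     \<not> (\<exists>p. pre_digraph.cycle (with_proj G) p \<and> 3 \<le> length p)"

definition graph_compl :: "'a pair_pre_digraph \<Rightarrow> 'a pair_pre_digraph" where
  "graph_compl G = \<lparr> pverts = pverts G,
     parcs = {(u, v). u \<in> pverts G \<and> v \<in> pverts G \<and> u \<noteq> v \<and> (u, v) \<notin> parcs G} \<rparr>"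

text \<open>
  The tree $T_{n,3}^{0,n-4}$ (for $n \ge 4$): the path $0,1,2,3$, whose vertex $i$ is $v_i$, and
  the pendant vertices $4,\dots,n-1$ attached to $2$.
\<close>

definition pendant_path_tree :: "nat \<Rightarrow> nat pair_pre_digraph" where
  "pendant_path_tree n = \<lparr> pverts = {0..<n},
     parcs = {(0, 1), (1, 0), (1, 2), (2, 1), (2, 3), (3, 2)} \<union> {2} \<times> {4..<n} \<union> {4..<n} \<times> {2} \<rparr>"

end

theory Submission
  imports Defs
begin

text \<open>
  Let \<open>d\<close> be the diameter of \<open>T\<close>, with diametral ends \<open>p\<close> and \<open>q\<close>.

  If \<open>d = 3\<close> then \<open>T\<close> is a double star with \<open>a + b = n - 2\<close> leaves at its two centres, and both
  eccentricity matrices are blow-ups of a weighted path on four vertices. Their energies are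
  explicit, and their sum is an increasing function of \<open>a b \<ge> n - 3\<close>, where equality means
  \<open>a = 1\<close> or \<open>b = 1\<close>.

  If \<open>d \<ge> 4\<close> the inequality is strict. The energy of \<open>T\<close> is at least twice the nuclear norm of the
  two rows \<open>p\<close> and \<open>q\<close>, restricted to the other columns; all but three of these columns have squared norm
  at least \<open>16\<close>. The eccentricity matrix of the complement is twice the adjacency matrix of \<open>T\<close>, whose
  energy is bounded below by Hoelder's inequality from its second and fourth spectral moments. The
  fourth moment is small because a tree has few closed walks of length four. At \<open>n = 5\<close> the
  resulting bound is about half a percent above the claimed one, so cruder estimates do not suffice.
\<close>

section \<open>The spectral theorem for real symmetric matrices\<close>

text \<open>The energy is dual to the operator norm: pairing the matrix with any symmetric test
  matrix of norm at most \<open>1\<close> bounds it from below. For diameter at least four the test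
  matrix carries the polar factor of the two rows in its off-diagonal blocks. The columns
  \<open>p\<close> and \<open>q\<close> are cut off to keep the row and column indices disjoint, so
  that each singular value counts twice. Rows \<open>p\<close> and \<open>q\<close> are chosen
  because, by the four-point condition, every eccentricity is attained at \<open>p\<close> or
  \<open>q\<close>; their entries are thus known from \<open>d v p\<close> and \<open>d v q\<close>
  alone.

  The energy weights distinct eigenvalues by algebraic multiplicity. An orthonormal eigenbasis turns
  it into a sum over an index, and turns power sums of eigenvalues into sums over matrix entries.

  Diameter three is separate because in a double star every vertex is adjacent to one of the two
  centres. This puts the centres at distance three in the complement, while at larger diameter all
  complement distances are at most two.\<close>

lemma symmetric_mat_entries:
  assumes "A \<in> carrier_mat n n" "transpose_mat A = A" "i < n" "j < n"
  shows "A $$ (i, j) = A $$ (j, i)"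
proof -
  have "transpose_mat A $$ (j, i) = A $$ (i, j)" using assms(1,3,4) by auto
  then show ?thesis using assms(2) by simp
qed

text \<open>A complex eigenvector \<open>x\<close> exists because the characteristic polynomial
  splits. Symmetry makes the form \<open>q1\<close> real, hence \<open>e0\<close> is real; then the
  real and imaginary parts of \<open>x\<close> both satisfy the eigenvalue equation, and one of them
  is nonzero.\<close>

lemma real_symmetric_unit_eigenvector:
  fixes A :: "real mat"
  assumes A: "A \<in> carrier_mat n n" and sym: "transpose_mat A = A" and n: "n > 0"
  obtains v e where "v \<in> carrier_vec n" "v \<bullet> v = 1" "A *\<^sub>v v = e \<cdot>\<^sub>v v"
proof -
  let ?C = "map_mat complex_of_real A"
  have C: "?C \<in> carrier_mat n n" using A by simp
  obtain as where as: "char_poly ?C = (\<Prod>a\<leftarrow>as. [:- a, 1:])" "length as = n"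
    using char_poly_factorized[OF C] by blast
  obtain e0 bs where ebs: "as = e0 # bs" using n as(2) by (cases as) auto
  have "poly (char_poly ?C) e0 = 0" unfolding as(1) ebs by simp
  then have "eigenvalue ?C e0" using eigenvalue_root_char_poly[OF C] by simp
  then obtain x where x: "x \<in> carrier_vec n" "x \<noteq> 0\<^sub>v n" "?C *\<^sub>v x = e0 \<cdot>\<^sub>v x"
    unfolding eigenvalue_def eigenvector_def using C by auto
  have ent: "(\<Sum>j<n. of_real (A $$ (i, j)) * x $ j) = e0 * x $ i" if "i < n" for i
  proof -
    have "(?C *\<^sub>v x) $ i = e0 * x $ i" using x that by simp
    moreover have "(?C *\<^sub>v x) $ i = (\<Sum>j<n. of_real (A $$ (i, j)) * x $ j)"
      using that C A x(1) by (simp add: scalar_prod_def atLeast0LessThan)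
    ultimately show ?thesis by simp
  qed
  define N where "N = (\<Sum>i<n. (cmod (x $ i))\<^sup>2)"
  obtain i0 where "i0 < n" "x $ i0 \<noteq> 0"
    using x(1,2) by (metis carrier_vecD eq_vecI index_zero_vec)
  then have "N > 0" unfolding N_def
    by (intro sum_pos2[of "{..<n}" i0]) auto
  have q1: "(\<Sum>i<n. \<Sum>j<n. cnj (x $ i) * of_real (A $$ (i, j)) * x $ j) = e0 * of_real N"
  proof -
    have "(\<Sum>i<n. \<Sum>j<n. cnj (x $ i) * of_real (A $$ (i, j)) * x $ j) = (\<Sum>i<n. cnj (x $ i) * (e0 * x $ i))"
      by (intro sum.cong refl) (simp add: ent[symmetric] sum_distrib_left mult.assoc)
    also have "\<dots> = e0 * of_real N"
      unfolding N_def of_real_sum sum_distrib_left complex_norm_square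
      by (simp add: algebra_simps)
    finally show ?thesis .
  qed
  have "cnj (e0 * of_real N) = e0 * of_real N"
  proof -
    have "cnj (e0 * of_real N) = (\<Sum>i<n. \<Sum>j<n. cnj (x $ j) * of_real (A $$ (i, j)) * x $ i)"
      by (simp add: q1[symmetric] algebra_simps)
    also have "\<dots> = (\<Sum>j<n. \<Sum>i<n. cnj (x $ j) * of_real (A $$ (j, i)) * x $ i)"
      by (subst sum.swap, intro sum.cong refl) (simp add: symmetric_mat_entries[OF A sym])
    finally show ?thesis using q1 by simp
  qed
  then have e0: "cnj e0 = e0" using \<open>N > 0\<close> by simp
  define e where "e = Re e0"
  have e0e: "e0 = of_real e" unfolding e_def using e0 by (simp add: complex_eq_iff)
  define y where "y = vec n (\<lambda>i. Re (x $ i))"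
  define z where "z = vec n (\<lambda>i. Im (x $ i))"
  have y: "y \<in> carrier_vec n" "A *\<^sub>v y = e \<cdot>\<^sub>v y"
  proof -
    show "y \<in> carrier_vec n" by (simp add: y_def)
    show "A *\<^sub>v y = e \<cdot>\<^sub>v y"
    proof (rule eq_vecI)
      fix i assume "i < dim_vec (e \<cdot>\<^sub>v y)"
      then have i: "i < n" by (simp add: y_def)
      have "Re (\<Sum>j<n. of_real (A $$ (i, j)) * x $ j) = Re (e0 * x $ i)" using ent[OF i] by simp
      then show "(A *\<^sub>v y) $ i = (e \<cdot>\<^sub>v y) $ i"
        using i A by (simp add: y_def e0e scalar_prod_def atLeast0LessThan)
    qed (use A in \<open>simp add: y_def\<close>)
  qed
  have z: "z \<in> carrier_vec n" "A *\<^sub>v z = e \<cdot>\<^sub>v z"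
  proof -
    show "z \<in> carrier_vec n" by (simp add: z_def)
    show "A *\<^sub>v z = e \<cdot>\<^sub>v z"
    proof (rule eq_vecI)
      fix i assume "i < dim_vec (e \<cdot>\<^sub>v z)"
      then have i: "i < n" by (simp add: z_def)
      have "Im (\<Sum>j<n. of_real (A $$ (i, j)) * x $ j) = Im (e0 * x $ i)" using ent[OF i] by simp
      then show "(A *\<^sub>v z) $ i = (e \<cdot>\<^sub>v z) $ i"
        using i A by (simp add: z_def e0e scalar_prod_def atLeast0LessThan)
    qed (use A in \<open>simp add: z_def\<close>)
  qed
  note goal = that
  have norm: thesis if w: "w \<in> carrier_vec n" "A *\<^sub>v w = e \<cdot>\<^sub>v w" "w \<bullet> w > 0" for w
  proof -
    let ?s = "1 / sqrt (w \<bullet> w)"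
    have "(?s \<cdot>\<^sub>v w) \<bullet> (?s \<cdot>\<^sub>v w) = 1"
      using w by (simp add: real_sqrt_mult[symmetric] field_simps)
    moreover have "A *\<^sub>v (?s \<cdot>\<^sub>v w) = e \<cdot>\<^sub>v (?s \<cdot>\<^sub>v w)"
      using w A by (simp add: mult_mat_vec smult_smult_assoc mult.commute)
    ultimately show thesis using goal[of "?s \<cdot>\<^sub>v w" e] w by simp
  qed
  have "y \<bullet> y + z \<bullet> z = N"
    unfolding N_def y_def z_def cmod_power2
    by (simp add: scalar_prod_def atLeast0LessThan power2_eq_square sum.distrib)
  then have "y \<bullet> y > 0 \<or> z \<bullet> z > 0" using \<open>N > 0\<close> by linarith
  then show thesis using norm y z by blast
qed

text \<open>The reflection in the hyperplane orthogonal to \<open>w\<close>, which is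
  \<open>v\<close> minus the first unit vector, exchanges these two vectors of equal length.\<close>

lemma householder_reflection:
  fixes v :: "real vec"
  assumes v: "v \<in> carrier_vec n" "v \<bullet> v = 1" and n: "n > 0"
  obtains Q where "Q \<in> carrier_mat n n" "transpose_mat Q = Q" "Q * Q = 1\<^sub>m n" "col Q 0 = v"
proof -
  define w where "w i = v $ i - (if i = 0 then 1 else 0)" for i
  define W where "W = (\<Sum>i<n. w i * w i)"
  \<comment> \<open>If \<open>v\<close> is the first unit vector, then \<open>W = 0\<close> and
    division by zero gives \<open>c = 0\<close>, so that \<open>Q\<close> is the identity as
    desired.\<close>
  define c where "c = 2 / W"
  define Q where "Q = mat n n (\<lambda>(i, j). (if i = j then 1 else 0) - c * w i * w j)"
  have vv: "(\<Sum>i<n. v $ i * v $ i) = 1"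
    using v by (simp add: scalar_prod_def atLeast0LessThan)
  have "W = (\<Sum>i<n. v $ i * v $ i) - 2 * (\<Sum>i<n. (if i = 0 then v $ i else 0)) + (\<Sum>i<n. (if i = 0 then 1 else 0))"
    unfolding W_def w_def sum_distrib_left sum_subtractf[symmetric] sum.distrib[symmetric]
    by (intro sum.cong) (auto simp: algebra_simps)
  then have Ww: "W = - 2 * w 0" using n vv by (simp add: w_def)
  have c2: "c * (c * W) = 2 * c" by (simp add: c_def)
  have Q: "Q \<in> carrier_mat n n" by (simp add: Q_def)
  moreover have "transpose_mat Q = Q" by (rule eq_matI) (auto simp: Q_def)
  moreover have "Q * Q = 1\<^sub>m n"
  proof (rule eq_matI)
    fix i j assume "i < dim_row (1\<^sub>m n :: real mat)" "j < dim_col (1\<^sub>m n :: real mat)"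
    then have ij: "i < n" "j < n" by auto
    have "(Q * Q) $$ (i, j) = (\<Sum>k<n. ((if i = k then 1 else 0) - c * w i * w k) * ((if k = j then 1 else 0) - c * w k * w j))"
      using ij by (simp add: Q_def scalar_prod_def atLeast0LessThan)
    also have "\<dots> = (\<Sum>k<n. (if k = i then (if i = j then 1 else 0) - c * w i * w j else 0) - (if k = j then c * w i * w j else 0) + c * c * w i * w j * (w k * w k))"
      by (intro sum.cong) (auto simp: algebra_simps)
    also have "\<dots> = (if i = j then 1 else 0) - 2 * c * w i * w j + c * (c * W) * w i * w j"
      unfolding sum.distrib sum_subtractf W_def sum_distrib_left[symmetric] using ij
      by (simp add: algebra_simps)
    finally show "(Q * Q) $$ (i, j) = 1\<^sub>m n $$ (i, j)" using ij c2 by simp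
  qed (auto simp: Q_def)
  moreover have "col Q 0 = v"
  proof (rule eq_vecI)
    fix i assume "i < dim_vec v"
    then have i: "i < n" using v by simp
    show "col Q 0 $ i = v $ i"
    proof (cases "W = 0")
      case True
      then have "w i = 0" using i unfolding W_def
        by (subst (asm) sum_nonneg_eq_0_iff) auto
      then show ?thesis using i n by (auto simp: Q_def w_def split: if_splits)
    next
      case False
      then have "c * w 0 = -1" using Ww by (simp add: c_def field_simps)
      then have "c * w i * w 0 = - w i" by (metis mult.assoc mult.commute mult_minus1)
      then show ?thesis using i n by (auto simp: Q_def w_def split: if_splits)
    qed
  qed (use v in \<open>auto simp: Q_def\<close>)
  ultimately show thesis using that by blast
qed

text \<open>Deflation: conjugating by a reflection that moves the first unit vector to an
  eigenvector clears the first column except for the eigenvalue. Symmetry clears the first row too,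
  and the induction applies to the remaining block.\<close>

lemma real_spectral_theorem:
  fixes A :: "real mat"
  assumes "A \<in> carrier_mat n n" "transpose_mat A = A"
  shows "\<exists>U D. U \<in> carrier_mat n n \<and> D \<in> carrier_mat n n \<and> transpose_mat U * U = 1\<^sub>m n \<and>
    diagonal_mat D \<and> A = U * D * transpose_mat U"
  using assms
proof (induction n arbitrary: A)
  case 0
  show ?case
    by (rule exI[of _ "1\<^sub>m 0"], rule exI[of _ "1\<^sub>m 0"]) (use 0 in \<open>auto simp: diagonal_mat_def intro!: eq_matI\<close>)
next
  case (Suc n)
  note A = Suc.prems(1) and sym = Suc.prems(2)
  obtain v e where v: "v \<in> carrier_vec (Suc n)" "v \<bullet> v = 1" "A *\<^sub>v v = e \<cdot>\<^sub>v v"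
    using real_symmetric_unit_eigenvector[OF A sym] by blast
  obtain Q where Q: "Q \<in> carrier_mat (Suc n) (Suc n)" "transpose_mat Q = Q" "Q * Q = 1\<^sub>m (Suc n)" "col Q 0 = v"
    using householder_reflection[OF v(1,2)] by blast
  define B where "B = Q * A * Q"
  have B: "B \<in> carrier_mat (Suc n) (Suc n)" using A Q by (simp add: B_def)
  have Bsym: "transpose_mat B = B"
    unfolding B_def using A Q sym
    by (simp add: transpose_mult[of _ "Suc n" "Suc n" _ "Suc n"] assoc_mult_mat[of _ "Suc n" "Suc n" _ "Suc n" _ "Suc n"])
  have AQ: "A = Q * B * Q"
  proof -
    have "Q * B * Q = (Q * Q) * A * (Q * Q)"
      unfolding B_def using A Q(1)
      by (simp add: assoc_mult_mat[of _ "Suc n" "Suc n" _ "Suc n" _ "Suc n"])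
    then show ?thesis using Q(3) A by simp
  qed
  have colB: "col B 0 = e \<cdot>\<^sub>v unit_vec (Suc n) 0"
  proof -
    have "col B 0 = (Q * A) *\<^sub>v v" unfolding B_def using Q A
      by (subst col_mult2[of _ "Suc n" "Suc n" _ "Suc n"]) auto
    also have "\<dots> = Q *\<^sub>v (e \<cdot>\<^sub>v v)" using Q A v by (simp add: assoc_mult_mat_vec[of _ "Suc n" "Suc n" _ "Suc n"])
    also have "\<dots> = e \<cdot>\<^sub>v (Q *\<^sub>v col Q 0)" using Q v by (simp add: mult_mat_vec)
    also have "Q *\<^sub>v col Q 0 = col (Q * Q) 0"
      using Q by (subst col_mult2[of _ "Suc n" "Suc n" _ "Suc n"]) auto
    finally show ?thesis using Q(3) by simp
  qed
  have B0: "B $$ (i, 0) = (if i = 0 then e else 0)" if "i < Suc n" for i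
    using arg_cong[OF colB, of "\<lambda>x. x $ i"] that B by (auto simp: unit_vec_def)
  define B' where "B' = mat n n (\<lambda>(i, j). B $$ (Suc i, Suc j))"
  have B': "B' \<in> carrier_mat n n" by (simp add: B'_def)
  have "transpose_mat B' = B'"
    by (rule eq_matI) (auto simp: B'_def symmetric_mat_entries[OF B Bsym])
  then obtain U D where UD: "U \<in> carrier_mat n n" "D \<in> carrier_mat n n" "transpose_mat U * U = 1\<^sub>m n"
    "diagonal_mat D" "B' = U * D * transpose_mat U"
    using Suc.IH[OF B'] by blast
  define E where "E = mat 1 1 (\<lambda>_::nat \<times> nat. e)"
  define V where "V = four_block_mat (1\<^sub>m 1) (0\<^sub>m 1 n) (0\<^sub>m n 1) U"
  define VT where "VT = four_block_mat (1\<^sub>m 1) (0\<^sub>m 1 n) (0\<^sub>m n 1) (transpose_mat U)"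
  define F where "F = four_block_mat E (0\<^sub>m 1 n) (0\<^sub>m n 1) D"
  note defs = V_def VT_def F_def E_def
  have VT: "transpose_mat V = VT"
    unfolding defs using UD by (subst transpose_four_block_mat[of _ 1 1 _ n _ n]) auto
  have car: "V \<in> carrier_mat (Suc n) (Suc n)" "F \<in> carrier_mat (Suc n) (Suc n)" "VT \<in> carrier_mat (Suc n) (Suc n)"
    unfolding defs using UD by (auto intro!: carrier_matI)
  have BB: "B = four_block_mat E (0\<^sub>m 1 n) (0\<^sub>m n 1) B'"
    unfolding defs
  proof (rule eq_matI)
    fix i j assume "i < dim_row (four_block_mat (mat 1 1 (\<lambda>_::nat \<times> nat. e)) (0\<^sub>m 1 n) (0\<^sub>m n 1) B')" "j < dim_col (four_block_mat (mat 1 1 (\<lambda>_::nat \<times> nat. e)) (0\<^sub>m 1 n) (0\<^sub>m n 1) B')"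
    then have ij: "i < Suc n" "j < Suc n" using B' by auto
    show "B $$ (i, j) = four_block_mat (mat 1 1 (\<lambda>_::nat \<times> nat. e)) (0\<^sub>m 1 n) (0\<^sub>m n 1) B' $$ (i, j)"
      using ij B' B0[of i] B0[of j] symmetric_mat_entries[OF B Bsym, of i j]
      by (cases i; cases j) (auto simp: B'_def)
  qed (use B B' in auto)
  have VF: "V * F * VT = B"
    unfolding BB defs using UD
    by (simp add: mult_four_block_mat[of _ 1 1 _ n _ n _ _ 1 _ n])
  have VV: "VT * V = 1\<^sub>m (Suc n)"
    unfolding defs using UD by (simp add: mult_four_block_mat[of _ 1 1 _ n _ n _ _ 1 _ n] four_block_one_mat)
  have "diagonal_mat F"
    using UD unfolding diagonal_mat_def defs by (auto simp: less_Suc_eq_0_disj) metis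
  moreover have "A = (Q * V) * F * transpose_mat (Q * V)"
    unfolding AQ VF[symmetric] using car Q
    by (simp add: transpose_mult[of _ "Suc n" "Suc n" _ "Suc n"] VT assoc_mult_mat[of _ "Suc n" "Suc n" _ "Suc n" _ "Suc n"])
  moreover have "transpose_mat (Q * V) * (Q * V) = 1\<^sub>m (Suc n)"
  proof -
    have "Q * (Q * V) = V" using Q(1,3) car by (metis assoc_mult_mat left_mult_one_mat)
    then show ?thesis
      using VV car Q by (simp add: transpose_mult[of _ "Suc n" "Suc n" _ "Suc n"] VT assoc_mult_mat[of _ "Suc n" "Suc n" _ "Suc n" _ "Suc n"])
  qed
  ultimately show ?case using car Q
    by (intro exI[of _ "Q * V"] exI[of _ F]) auto
qed

section \<open>Energy estimates\<close>

lemma mat_energy_linear_factors: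
  assumes A: "A \<in> carrier_mat n n" and as: "char_poly A = (\<Prod>a\<leftarrow>as. [:- a, 1:])"
  shows "mat_energy A = (\<Sum>a\<leftarrow>as. cmod a)"
proof -
  have ord: "order x (\<Prod>a\<leftarrow>bs. [:- a, 1:]) = count_list bs x" for x :: complex and bs
  proof (induction bs)
    case Nil
    show ?case by (simp add: order_1_eq_0)
  next
    case (Cons b bs)
    have "(\<Prod>a\<leftarrow>bs. [:- a, 1:]) \<noteq> 0" by (auto simp: prod_list_zero_iff)
    then have "[:- b, 1:] * (\<Prod>a\<leftarrow>bs. [:- a, 1:]) \<noteq> 0"
      by (metis mult_eq_0_iff pCons_eq_0_iff zero_neq_one)
    then have "order x ([:- b, 1:] * (\<Prod>a\<leftarrow>bs. [:- a, 1:])) = order x [:- b, 1:] + count_list bs x"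
      unfolding Cons.IH[symmetric] by (rule order_mult)
    moreover have "order x [:- b, 1:] = (if x = b then 1 else 0)"
      using order_power_n_n[of b 1] by (auto intro: order_0I)
    ultimately show ?case by auto
  qed
  have count: "(\<Sum>x\<in>X. real (count_list bs x) * f x) = (\<Sum>a\<leftarrow>bs. f a)"
    if "finite X" "set bs \<subseteq> X" for X bs and f :: "complex \<Rightarrow> real"
    using that
  proof (induction bs)
    case (Cons b bs)
    have "(\<Sum>x\<in>X. real (count_list (b # bs) x) * f x) = (\<Sum>x\<in>X. real (count_list bs x) * f x + (if b = x then f x else 0))"
      by (intro sum.cong) (auto simp: algebra_simps)
    then show ?case using Cons by (simp add: sum.distrib)
  qed simp
  have "{x. eigenvalue A x} = set as"
    using eigenvalue_root_char_poly[OF A] by (auto simp: as poly_prod_list prod_list_zero_iff)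
  then show ?thesis
    unfolding mat_energy_def as ord by (simp add: count)
qed

text \<open>The spectral decomposition indexed by vertices instead of matrix positions:
  \<open>u v k\<close> is the coordinate at \<open>v\<close> of the \<open>k\<close>-th eigenvector.
  Since eigenvalues may repeat in the list \<open>l\<close>, no multiplicity has to be determined
  later.\<close>

locale eigen_decomposition =
  fixes V :: "'a set" and K :: "'a \<Rightarrow> 'a \<Rightarrow> real" and N :: nat and l :: "nat \<Rightarrow> real"
    and u :: "'a \<Rightarrow> nat \<Rightarrow> real"
  assumes finV: "finite V"
    and expand: "\<And>v w. v \<in> V \<Longrightarrow> w \<in> V \<Longrightarrow> K v w = (\<Sum>k<N. l k * u v k * u w k)"
    and orth: "\<And>k k'. k < N \<Longrightarrow> k' < N \<Longrightarrow> (\<Sum>v\<in>V. u v k * u v k') = (if k = k' then 1 else 0)"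

lemma ecc_energy_eigen_decomposition:
  fixes G :: "'a pair_pre_digraph"
  defines "K \<equiv> \<lambda>v w. real (ecc_entry G v w)"
  assumes fin: "finite (pverts G)"
    and sym: "\<And>v w. v \<in> pverts G \<Longrightarrow> w \<in> pverts G \<Longrightarrow> K v w = K w v"
  obtains N l u where "eigen_decomposition (pverts G) K N l u" "ecc_energy G = (\<Sum>k<N. \<bar>l k\<bar>)"
proof -
  obtain vs where vs: "distinct vs" "set vs = pverts G"
    using finite_distinct_list[OF fin] by blast
  define n where "n = length vs"
  have bij: "bij_betw ((!) vs) {..<n} (pverts G)"
    unfolding n_def using vs by (intro bij_betw_nth) simp_all
  define idx where "idx = inv_into {..<n} ((!) vs)"
  have idx: "idx (vs ! i) = i" if "i < n" for i
    unfolding idx_def using bij_betw_inv_into_left[OF bij] that by blast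
  have vsidx: "vs ! idx v = v" "idx v < n" if "v \<in> pverts G" for v
    unfolding idx_def using bij_betw_inv_into_right[OF bij that] bij_betwE[OF bij_betw_inv_into[OF bij]] that
    by blast+
  define A where "A = mat n n (\<lambda>(i, j). K (vs ! i) (vs ! j))"
  have A: "A \<in> carrier_mat n n" by (simp add: A_def)
  have vsin: "vs ! i \<in> pverts G" if "i < n" for i
    using that vs(2) nth_mem[of i vs] unfolding n_def by simp
  have "transpose_mat A = A"
  proof (rule eq_matI)
    fix i j assume "i < dim_row A" "j < dim_col A"
    then have ij: "i < n" "j < n" by (auto simp: A_def)
    show "transpose_mat A $$ (i, j) = A $$ (i, j)"
      using ij sym[OF vsin[OF ij(1)] vsin[OF ij(2)]] by (simp add: A_def)
  qed (auto simp: A_def)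
  from real_spectral_theorem[OF A this]
  obtain U D where U: "U \<in> carrier_mat n n" and D: "D \<in> carrier_mat n n"
    and UU: "transpose_mat U * U = 1\<^sub>m n" and diag: "diagonal_mat D" and AD: "A = U * D * transpose_mat U"
    by blast
  define l where "l k = D $$ (k, k)" for k
  define u where "u v k = U $$ (idx v, k)" for v k
  have D': "D $$ (i, j) = (if i = j then l i else 0)" if "i < n" "j < n" for i j
    using that diag D unfolding diagonal_mat_def l_def by auto
  have UD: "(U * D) $$ (i, k) = l k * U $$ (i, k)" if "i < n" "k < n" for i k
  proof -
    have "(U * D) $$ (i, k) = (\<Sum>j<n. U $$ (i, j) * D $$ (j, k))"
      using that U D by (simp add: scalar_prod_def atLeast0LessThan)
    also have "\<dots> = (\<Sum>j<n. if j = k then l k * U $$ (i, k) else 0)"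
      using that by (intro sum.cong) (auto simp: D')
    finally show ?thesis using that by simp
  qed
  have Aent: "A $$ (i, j) = (\<Sum>k<n. l k * U $$ (i, k) * U $$ (j, k))" if "i < n" "j < n" for i j
  proof -
    have "A $$ (i, j) = (\<Sum>k<n. (U * D) $$ (i, k) * U $$ (j, k))"
      unfolding AD using that U D
      by (subst index_mult_mat) (auto simp: scalar_prod_def atLeast0LessThan simp del: assoc_mult_mat)
    then show ?thesis using that by (simp add: UD)
  qed
  have "eigen_decomposition (pverts G) K n l u"
  proof
    fix v w assume "v \<in> pverts G" "w \<in> pverts G"
    then show "K v w = (\<Sum>k<n. l k * u v k * u w k)"
      using Aent[of "idx v" "idx w"] by (simp add: A_def u_def vsidx)
  next
    fix k k' assume k: "k < n" "k' < n"
    have "(\<Sum>v\<in>pverts G. u v k * u v k') = (\<Sum>i<n. U $$ (i, k) * U $$ (i, k'))"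
      by (subst sum.reindex_bij_betw[OF bij, symmetric]) (simp add: u_def idx)
    also have "\<dots> = (transpose_mat U * U) $$ (k, k')"
      using k U by (simp add: scalar_prod_def atLeast0LessThan)
    finally show "(\<Sum>v\<in>pverts G. u v k * u v k') = (if k = k' then 1 else 0)"
      using k by (simp add: UU)
  qed (rule fin)
  moreover have "ecc_energy G = (\<Sum>k<n. \<bar>l k\<bar>)"
  proof -
    let ?h = "map_mat complex_of_real"
    have UU': "U * transpose_mat U = 1\<^sub>m n"
      using mat_mult_left_right_inverse[OF _ U UU] U by simp
    have ecc: "ecc_matrix G vs = ?h A"
      by (rule eq_matI) (auto simp: ecc_matrix_def A_def K_def n_def)
    have "similar_mat (?h A) (?h D)"
    proof (rule similar_matI[of _ _ "?h U" "?h (transpose_mat U)" n])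
      show "?h U * ?h (transpose_mat U) = 1\<^sub>m n"
        by (subst of_real_hom.mat_hom_mult[symmetric, of U n n _ n]) (use U UU' in \<open>auto simp: of_real_hom.mat_hom_one\<close>)
      show "?h (transpose_mat U) * ?h U = 1\<^sub>m n"
        by (subst of_real_hom.mat_hom_mult[symmetric, of _ n n _ n]) (use U UU in \<open>auto simp: of_real_hom.mat_hom_one\<close>)
      show "?h A = ?h U * ?h D * ?h (transpose_mat U)"
        unfolding AD using U D
        by (simp add: of_real_hom.mat_hom_mult[of _ n n _ n] del: assoc_mult_mat)
    qed (use A D U in auto)
    then have "char_poly (?h A) = char_poly (?h D)" by (rule char_poly_similar)
    also have "\<dots> = (\<Prod>a\<leftarrow>diag_mat (?h D). [:- a, 1:])"
      by (rule char_poly_upper_triangular[of _ n]) (use D diag in \<open>auto simp: upper_triangular_def diagonal_mat_def\<close>)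
    finally have "mat_energy (?h A) = (\<Sum>a\<leftarrow>diag_mat (?h D). cmod a)"
      using mat_energy_linear_factors[of "?h A" n] A by simp
    also have "\<dots> = (\<Sum>k<n. \<bar>l k\<bar>)"
      using D by (simp add: diag_mat_def l_def o_def sum_list_sum_nth atLeast0LessThan)
    finally show ?thesis
      using ecc_energy_eq[OF vs] by (simp add: ecc)
  qed
  ultimately show thesis using that by blast
qed

context eigen_decomposition
begin

lemma eigenvector:
  assumes "v \<in> V" "k < N"
  shows "(\<Sum>w\<in>V. K v w * u w k) = l k * u v k"
proof -
  have "(\<Sum>w\<in>V. K v w * u w k) = (\<Sum>w\<in>V. \<Sum>j<N. l j * u v j * (u w j * u w k))"
    using assms by (intro sum.cong refl) (simp add: expand sum_distrib_right mult.assoc)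
  also have "\<dots> = (\<Sum>j<N. l j * u v j * (\<Sum>w\<in>V. u w j * u w k))"
    by (subst sum.swap) (simp add: sum_distrib_left)
  also have "\<dots> = (\<Sum>j<N. if j = k then l k * u v k else 0)"
    using assms by (intro sum.cong refl) (auto simp: orth)
  finally show ?thesis using assms by simp
qed

lemma square_expand:
  assumes "v \<in> V" "w \<in> V"
  shows "(\<Sum>z\<in>V. K v z * K z w) = (\<Sum>k<N. (l k)\<^sup>2 * u v k * u w k)"
proof -
  have "(\<Sum>z\<in>V. K v z * K z w) = (\<Sum>z\<in>V. \<Sum>k<N. l k * u w k * (K v z * u z k))"
    using assms by (intro sum.cong refl) (simp add: expand[of _ w] sum_distrib_left algebra_simps)
  also have "\<dots> = (\<Sum>k<N. l k * u w k * (\<Sum>z\<in>V. K v z * u z k))"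
    by (subst sum.swap) (simp add: sum_distrib_left)
  also have "\<dots> = (\<Sum>k<N. (l k)\<^sup>2 * u v k * u w k)"
    using assms by (intro sum.cong refl) (simp add: eigenvector power2_eq_square algebra_simps)
  finally show ?thesis .
qed

text \<open>Invariance of the Frobenius norm under an orthogonal change of basis. The coefficients
  \<open>c = l\<close> give the second moment, the squares of \<open>l\<close> give the
  fourth.\<close>

lemma sum_square_expansion:
  "(\<Sum>v\<in>V. \<Sum>w\<in>V. (\<Sum>k<N. c k * u v k * u w k)\<^sup>2) = (\<Sum>k<N. (c k)\<^sup>2)"
proof -
  have "(\<Sum>v\<in>V. \<Sum>w\<in>V. (\<Sum>k<N. c k * u v k * u w k)\<^sup>2) =
    (\<Sum>v\<in>V. \<Sum>w\<in>V. \<Sum>k<N. \<Sum>j<N. c k * c j * (u v k * u v j) * (u w k * u w j))"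
    by (intro sum.cong refl) (simp add: power2_eq_square sum_product algebra_simps)
  also have "\<dots> = (\<Sum>v\<in>V. \<Sum>k<N. \<Sum>w\<in>V. \<Sum>j<N. c k * c j * (u v k * u v j) * (u w k * u w j))"
    by (rule sum.cong[OF refl], rule sum.swap)
  also have "\<dots> = (\<Sum>v\<in>V. \<Sum>k<N. \<Sum>j<N. \<Sum>w\<in>V. c k * c j * (u v k * u v j) * (u w k * u w j))"
    by (rule sum.cong[OF refl], rule sum.cong[OF refl], rule sum.swap)
  also have "\<dots> = (\<Sum>k<N. \<Sum>v\<in>V. \<Sum>j<N. c k * c j * (u v k * u v j) * (\<Sum>w\<in>V. u w k * u w j))"
    by (subst sum.swap) (simp add: sum_distrib_left)
  also have "\<dots> = (\<Sum>k<N. \<Sum>j<N. c k * c j * (\<Sum>v\<in>V. u v k * u v j) * (\<Sum>w\<in>V. u w k * u w j))"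
    by (intro sum.cong refl, subst sum.swap) (simp add: sum_distrib_left sum_distrib_right algebra_simps)
  also have "\<dots> = (\<Sum>k<N. \<Sum>j<N. if j = k then (c k)\<^sup>2 else 0)"
    by (intro sum.cong refl) (auto simp: orth power2_eq_square)
  also have "\<dots> = (\<Sum>k<N. (c k)\<^sup>2)"
    by (intro sum.cong refl) simp
  finally show ?thesis .
qed

lemma sum_eigenvalues_power2: "(\<Sum>k<N. (l k)\<^sup>2) = (\<Sum>v\<in>V. \<Sum>w\<in>V. (K v w)\<^sup>2)"
  unfolding sum_square_expansion[symmetric] by (simp add: expand)

lemma sum_eigenvalues_power4:
  "(\<Sum>k<N. (l k)^4) = (\<Sum>v\<in>V. \<Sum>w\<in>V. (\<Sum>z\<in>V. K v z * K z w)\<^sup>2)"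
proof -
  have "(\<Sum>k<N. (l k)^4) = (\<Sum>k<N. ((l k)\<^sup>2)\<^sup>2)" by simp
  also have "\<dots> = (\<Sum>v\<in>V. \<Sum>w\<in>V. (\<Sum>z\<in>V. K v z * K z w)\<^sup>2)"
    unfolding sum_square_expansion[symmetric] by (intro sum.cong refl) (simp add: square_expand)
  finally show ?thesis .
qed

text \<open>Hoelder's inequality, from \<open>3 t\<^sup>2 \<le> 2 c t + t\<^sup>4 / c\<^sup>2\<close> at the optimal \<open>c\<close>.\<close>

lemma energy_ge_holder:
  assumes p2: "(\<Sum>k<N. (l k)\<^sup>2) = p" and p4: "(\<Sum>k<N. (l k)^4) \<le> q" and pos: "p > 0" "q > 0"
  shows "(\<Sum>k<N. \<bar>l k\<bar>) \<ge> sqrt (p ^ 3 / q)"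
proof -
  define c where "c = sqrt (q / p)"
  have c: "c > 0" "c\<^sup>2 = q / p" using pos by (auto simp: c_def)
  have *: "3 * t\<^sup>2 \<le> 2 * c * t + t^4 / c\<^sup>2" if "t \<ge> 0" for t :: real
  proof -
    \<comment> \<open>The polynomial \<open>t^4 - 3 c^2 t^2 + 2 c^3 t\<close> has a double zero at
      \<open>t = c\<close>. The bound is therefore sharp when all nonzero eigenvalues have the same
      absolute value \<open>c\<close>.\<close>
    have "0 \<le> t * ((c - t)\<^sup>2 * (2 * c + t))" using that c by simp
    also have "\<dots> = 2 * c ^ 3 * t - 3 * c\<^sup>2 * t\<^sup>2 + t ^ 4"
      by (simp add: power2_eq_square power3_eq_cube power4_eq_xxxx algebra_simps)
    finally have "3 * t\<^sup>2 * c\<^sup>2 \<le> (2 * c * t) * c\<^sup>2 + t ^ 4"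
      by (simp add: power2_eq_square power3_eq_cube algebra_simps)
    moreover have "c\<^sup>2 > 0" using c(1) by simp
    ultimately show ?thesis by (simp add: field_simps)
  qed
  have "3 * p = (\<Sum>k<N. 3 * \<bar>l k\<bar>\<^sup>2)" by (simp add: p2[symmetric] sum_distrib_left)
  also have "\<dots> \<le> (\<Sum>k<N. 2 * c * \<bar>l k\<bar> + \<bar>l k\<bar>^4 / c\<^sup>2)"
    by (intro sum_mono *) simp
  also have "\<dots> = 2 * c * (\<Sum>k<N. \<bar>l k\<bar>) + (\<Sum>k<N. (l k)^4) / c\<^sup>2"
    by (simp add: sum.distrib sum_distrib_left sum_divide_distrib)
  also have "\<dots> \<le> 2 * c * (\<Sum>k<N. \<bar>l k\<bar>) + q / c\<^sup>2"
    using p4 by (intro add_left_mono divide_right_mono) auto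
  also have "q / c\<^sup>2 = p" using c pos by simp
  finally have "p / c \<le> (\<Sum>k<N. \<bar>l k\<bar>)" using c by (simp add: field_simps)
  moreover have "p / c = sqrt (p ^ 3 / q)"
    by (rule real_sqrt_unique[symmetric]) (use c pos in \<open>auto simp: power_divide power2_eq_square power3_eq_cube field_simps\<close>)
  ultimately show ?thesis by simp
qed

text \<open>
  The sum of the singular values of the two-row matrix with rows \<open>r\<close> and \<open>s\<close> equals
  \<open>t = sqrt (tr G + 2 * sqrt (det G))\<close>, where \<open>G\<close> is the Gram matrix of \<open>r\<close> and \<open>s\<close>. The vectors
  \<open>wp\<close> and \<open>wq\<close> below are the rows of the orthonormal polar factor of that matrix.
\<close>

lemma energy_ge_two_rows:
  fixes p q Y
  defines "X \<equiv> (\<Sum>y\<in>Y. (K p y)\<^sup>2)" and "W \<equiv> (\<Sum>y\<in>Y. (K q y)\<^sup>2)" and "Z \<equiv> (\<Sum>y\<in>Y. K p y * K q y)"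
  assumes pq: "p \<in> V" "q \<in> V" "p \<noteq> q" and Y: "Y \<subseteq> V - {p, q}" and pos: "X * W - Z\<^sup>2 > 0"
  shows "2 * sqrt (X + W + 2 * sqrt (X * W - Z\<^sup>2)) \<le> (\<Sum>k<N. \<bar>l k\<bar>)"
proof -
  define g where "g = sqrt (X * W - Z\<^sup>2)"
  define t where "t = sqrt (X + W + 2 * g)"
  have g: "g > 0" "g\<^sup>2 = X * W - Z\<^sup>2" using pos by (auto simp: g_def)
  have XW: "X \<ge> 0" "W \<ge> 0" by (auto simp: X_def W_def intro: sum_nonneg)
  have t: "t > 0" "t\<^sup>2 = X + W + 2 * g" using g XW by (auto simp: t_def)
  have finY: "finite Y" using Y finV finite_subset by blast
  \<comment> \<open>By Cayley-Hamilton the square root of the Gram matrix \<open>G\<close> is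
    \<open>(G + g I) / t\<close>, with determinant \<open>g\<close>. Its inverse has the rows
    \<open>(W + g, - Z)\<close> and \<open>(- Z, X + g)\<close>, divided by \<open>g * t\<close>;
    applying this inverse to the two rows orthonormalizes them.\<close>
  define wp where "wp y = ((W + g) * K p y + (- Z) * K q y) / (g * t)" for y
  define wq where "wq y = ((- Z) * K p y + (X + g) * K q y) / (g * t)" for y
  have gram: "(\<Sum>y\<in>Y. (a * K p y + b * K q y) * (c * K p y + d * K q y)) = a * c * X + (a * d + b * c) * Z + b * d * W"
    for a b c d
    unfolding X_def W_def Z_def sum_distrib_left sum.distrib[symmetric]
    by (intro sum.cong refl) (simp add: algebra_simps power2_eq_square)
  have gram': "(\<Sum>y\<in>Y. (a * K p y + b * K q y) / (g * t) * ((c * K p y + d * K q y) / e)) =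
    (a * c * X + (a * d + b * c) * Z + b * d * W) / (g * t * e)" for a b c d e
    unfolding gram[symmetric] sum_divide_distrib by (intro sum.cong refl) simp
  have gt0: "g * t * (g * t) = g\<^sup>2 * t\<^sup>2" by (simp add: power2_eq_square)
  have pp: "(\<Sum>y\<in>Y. wp y * wp y) = 1"
  proof -
    have "(W + g) * (W + g) * X + ((W + g) * (- Z) + (- Z) * (W + g)) * Z + (- Z) * (- Z) * W
      = W * (X * W - Z\<^sup>2) + 2 * g * (X * W - Z\<^sup>2) + g\<^sup>2 * X"
      by (simp add: algebra_simps power2_eq_square)
    also have "\<dots> = g\<^sup>2 * t\<^sup>2" unfolding g(2)[symmetric] t(2) by (simp add: algebra_simps)
    finally show ?thesis unfolding wp_def gram' gt0 using g(1) t(1) by simp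
  qed
  have qq: "(\<Sum>y\<in>Y. wq y * wq y) = 1"
  proof -
    have "(- Z) * (- Z) * X + ((- Z) * (X + g) + (X + g) * (- Z)) * Z + (X + g) * (X + g) * W
      = X * (X * W - Z\<^sup>2) + 2 * g * (X * W - Z\<^sup>2) + g\<^sup>2 * W"
      by (simp add: algebra_simps power2_eq_square)
    also have "\<dots> = g\<^sup>2 * t\<^sup>2" unfolding g(2)[symmetric] t(2) by (simp add: algebra_simps)
    finally show ?thesis unfolding wq_def gram' gt0 using g(1) t(1) by simp
  qed
  have pq0: "(\<Sum>y\<in>Y. wp y * wq y) = 0"
  proof -
    have "(W + g) * (- Z) * X + ((W + g) * (X + g) + (- Z) * (- Z)) * Z + (- Z) * (X + g) * W
      = Z * (g\<^sup>2 - (X * W - Z\<^sup>2))"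
      by (simp add: algebra_simps power2_eq_square)
    then show ?thesis unfolding wp_def wq_def gram' using g by simp
  qed
  have wpK: "(\<Sum>y\<in>Y. wp y * K p y) = ((W + g) * X - Z\<^sup>2) / (g * t)"
    using gram'[of "W + g" "- Z" 1 0 1] by (simp add: wp_def power2_eq_square)
  have wqK: "(\<Sum>y\<in>Y. wq y * K q y) = ((X + g) * W - Z\<^sup>2) / (g * t)"
    using gram'[of "- Z" "X + g" 0 1 1] by (simp add: wq_def power2_eq_square algebra_simps)
  \<comment> \<open>The pairing of the two rows with their polar factor is the trace of the square
    root of the Gram matrix, which is \<open>t\<close>.\<close>
  have "t = ((W + g) * X - Z\<^sup>2 + ((X + g) * W - Z\<^sup>2)) / (g * t)"
  proof -
    have "(W + g) * X - Z\<^sup>2 + ((X + g) * W - Z\<^sup>2) = 2 * (X * W - Z\<^sup>2) + g * (X + W)"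
      by (simp add: algebra_simps)
    also have "\<dots> = g * t\<^sup>2" unfolding g(2)[symmetric] t(2) by (simp add: algebra_simps power2_eq_square)
    finally show ?thesis using g(1) t(1) by (simp add: power2_eq_square)
  qed
  also have "\<dots> = (\<Sum>y\<in>Y. wp y * K p y) + (\<Sum>y\<in>Y. wq y * K q y)"
    unfolding wpK wqK by (rule add_divide_distrib)
  also have "\<dots> = (\<Sum>k<N. l k * (u p k * (\<Sum>y\<in>Y. wp y * u y k) + u q k * (\<Sum>y\<in>Y. wq y * u y k)))"
  proof -
    have row: "(\<Sum>y\<in>Y. w y * K x y) = (\<Sum>k<N. l k * (u x k * (\<Sum>y\<in>Y. w y * u y k)))" if "x \<in> V" for x w
    proof -
      have "(\<Sum>y\<in>Y. w y * K x y) = (\<Sum>y\<in>Y. \<Sum>k<N. l k * (u x k * (w y * u y k)))"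
        using that Y by (intro sum.cong refl) (auto simp: expand sum_distrib_left algebra_simps)
      then show ?thesis by (simp add: sum.swap[of _ _ Y] sum_distrib_left)
    qed
    show ?thesis unfolding row[OF pq(1)] row[OF pq(2)]
      by (simp add: sum.distrib[symmetric] algebra_simps)
  qed
  \<comment> \<open>The factor 2 of the result arises here. As \<open>p\<close> and \<open>q\<close>
    lie outside \<open>Y\<close>, the coordinates of a unit eigenvector at \<open>p\<close>,
    \<open>q\<close> and its projections \<open>a\<close>, \<open>b\<close> on \<open>wp\<close>,
    \<open>wq\<close> share squared mass at most \<open>1\<close>, so
    \<open>u p k * a + u q k * b\<close> has absolute value at most one half.\<close>
  also have "\<dots> \<le> (\<Sum>k<N. \<bar>l k\<bar> * (1 / 2))"
  proof (rule sum_mono)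
    fix k assume "k \<in> {..<N}"
    then have k: "k < N" by simp
    define a where "a = (\<Sum>y\<in>Y. wp y * u y k)"
    define b where "b = (\<Sum>y\<in>Y. wq y * u y k)"
    have "0 \<le> (\<Sum>y\<in>Y. (u y k - a * wp y - b * wq y)\<^sup>2)" by (intro sum_nonneg) simp
    also have "\<dots> = (\<Sum>y\<in>Y. (u y k)\<^sup>2 + (a\<^sup>2 * (wp y * wp y) + (b\<^sup>2 * (wq y * wq y) + (2 * a * b * (wp y * wq y)
        + (- 2 * a * (wp y * u y k) + - 2 * b * (wq y * u y k))))))"
      by (intro sum.cong refl) (simp add: power2_eq_square algebra_simps)
    also have "\<dots> = (\<Sum>y\<in>Y. (u y k)\<^sup>2) - a\<^sup>2 - b\<^sup>2"
      unfolding sum.distrib sum_distrib_left[symmetric] pp qq pq0 a_def[symmetric] b_def[symmetric]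
      by (simp add: power2_eq_square)
    finally have bessel: "a\<^sup>2 + b\<^sup>2 \<le> (\<Sum>y\<in>Y. (u y k)\<^sup>2)" by simp
    have "(u p k)\<^sup>2 + (u q k)\<^sup>2 + (\<Sum>y\<in>Y. (u y k)\<^sup>2) = (\<Sum>y\<in>insert p (insert q Y). (u y k)\<^sup>2)"
      using finY pq Y by (subst sum.insert, auto)+
    also have "\<dots> \<le> (\<Sum>v\<in>V. (u v k)\<^sup>2)"
      using pq Y finV by (intro sum_mono2) auto
    also have "\<dots> = 1" using orth[OF k k] by (simp add: power2_eq_square)
    finally have le1: "(u p k)\<^sup>2 + (u q k)\<^sup>2 + a\<^sup>2 + b\<^sup>2 \<le> 1" using bessel by simp
    have "\<bar>u p k * a + u q k * b\<bar> \<le> 1 / 2"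
    proof -
      have "0 \<le> (u p k - a)\<^sup>2 + (u q k - b)\<^sup>2" "0 \<le> (u p k + a)\<^sup>2 + (u q k + b)\<^sup>2" by simp_all
      then have "u p k * a + u q k * b \<le> 1 / 2" "- (u p k * a + u q k * b) \<le> 1 / 2"
        using le1 by (simp_all add: power2_eq_square algebra_simps)
      then show ?thesis by (rule abs_leI)
    qed
    then have "\<bar>l k\<bar> * \<bar>u p k * a + u q k * b\<bar> \<le> \<bar>l k\<bar> * (1 / 2)"
      by (intro mult_left_mono) auto
    then show "l k * (u p k * (\<Sum>y\<in>Y. wp y * u y k) + u q k * (\<Sum>y\<in>Y. wq y * u y k)) \<le> \<bar>l k\<bar> * (1 / 2)"
      unfolding a_def[symmetric] b_def[symmetric] abs_mult[symmetric] by linarith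
  qed
  also have "\<dots> = (\<Sum>k<N. \<bar>l k\<bar>) / 2" by (simp add: sum_divide_distrib)
  finally show ?thesis by (simp add: t_def g_def)
qed

end

text \<open>The path 0-1-2-3 with edge weights 2, 3, 2. The same weights serve for a double star and
  for its complement; only the order of the vertex classes along the path changes.\<close>

definition path_weight :: "nat \<Rightarrow> nat \<Rightarrow> real" where
  "path_weight i j = (if (i, j) \<in> {(0, 1), (1, 0), (2, 3), (3, 2)} then 2
     else if (i, j) \<in> {(1, 2), (2, 1)} then 3 else 0)"

lemma sum_over_four_classes:
  fixes h :: "nat \<Rightarrow> real" and f :: "'a \<Rightarrow> real"
  assumes "finite V" "\<And>v. v \<in> V \<Longrightarrow> c v < (4::nat)"
  shows "(\<Sum>v\<in>V. f v * h (c v)) = (\<Sum>v | v \<in> V \<and> c v = 0. f v) * h 0 + (\<Sum>v | v \<in> V \<and> c v = 1. f v) * h 1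
    + (\<Sum>v | v \<in> V \<and> c v = 2. f v) * h 2 + (\<Sum>v | v \<in> V \<and> c v = 3. f v) * h 3"
proof -
  have "(\<Sum>v\<in>V. f v * h (c v)) = (\<Sum>i<4. \<Sum>v | v \<in> V \<and> c v = i. f v * h (c v))"
    by (rule sum.group[symmetric]) (use assms in auto)
  also have "\<dots> = (\<Sum>i<4. (\<Sum>v | v \<in> V \<and> c v = i. f v) * h i)"
    by (intro sum.cong refl) (simp add: sum_distrib_right)
  finally show ?thesis by (simp add: eval_nat_numeral)
qed

text \<open>
  Every nonzero eigenvalue is a root of \<open>X^4 - P X^2 + Q\<close>. On these roots and at \<open>0\<close> the absolute
  value agrees with an even polynomial of degree four, so the second and fourth moments determine
  the energy without any knowledge of multiplicities.
\<close>

lemma (in eigen_decomposition) energy_path_blowup: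
  fixes c :: "'a \<Rightarrow> nat"
  defines "m \<equiv> \<lambda>i. real (card {v \<in> V. c v = i})"
  defines "P \<equiv> 4 * m 0 * m 1 + 9 * m 1 * m 2 + 4 * m 2 * m 3" and "Q \<equiv> 16 * m 0 * m 1 * m 2 * m 3"
  assumes c: "\<And>v. v \<in> V \<Longrightarrow> c v < 4"
    and K: "\<And>v w. v \<in> V \<Longrightarrow> w \<in> V \<Longrightarrow> K v w = path_weight (c v) (c w)"
    and Q: "Q > 0"
  shows "(\<Sum>k<N. \<bar>l k\<bar>) = 2 * sqrt (P + 2 * sqrt Q)"
proof -
  define g where "g = sqrt Q"
  define t where "t = sqrt (P + 2 * g)"
  have P: "P \<ge> 0" by (simp add: P_def m_def)
  have g: "g > 0" "g\<^sup>2 = Q" using Q by (auto simp: g_def)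
  have t: "t > 0" "t\<^sup>2 = P + 2 * g" using g P by (auto simp: t_def)
  have sumV: "(\<Sum>v\<in>V. h (c v)) = m 0 * h 0 + m 1 * h 1 + m 2 * h 2 + m 3 * h 3" for h :: "nat \<Rightarrow> real"
    using sum_over_four_classes[OF finV c, where f = "\<lambda>_. 1" and h = h] by (simp add: m_def)
  have p2: "(\<Sum>k<N. (l k)\<^sup>2) = 2 * P"
  proof -
    have "(\<Sum>k<N. (l k)\<^sup>2) = (\<Sum>v\<in>V. \<Sum>w\<in>V. (path_weight (c v) (c w))\<^sup>2)"
      unfolding sum_eigenvalues_power2 by (simp add: K)
    also have "\<dots> = (\<Sum>v\<in>V. (m 0 * (path_weight (c v) 0)\<^sup>2 + m 1 * (path_weight (c v) 1)\<^sup>2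
        + m 2 * (path_weight (c v) 2)\<^sup>2 + m 3 * (path_weight (c v) 3)\<^sup>2))"
      by (intro sum.cong refl) (rule sumV)
    also have "\<dots> = 2 * P"
      by (subst sumV) (simp add: path_weight_def P_def algebra_simps)
    finally show ?thesis .
  qed
  have p4: "(\<Sum>k<N. (l k)^4) = 2 * (P\<^sup>2 - 2 * Q)"
  proof -
    define h where "h i j = m 0 * (path_weight i 0 * path_weight 0 j) + m 1 * (path_weight i 1 * path_weight 1 j)
      + m 2 * (path_weight i 2 * path_weight 2 j) + m 3 * (path_weight i 3 * path_weight 3 j)" for i j
    have "(\<Sum>k<N. (l k)^4) = (\<Sum>v\<in>V. \<Sum>w\<in>V. (\<Sum>z\<in>V. path_weight (c v) (c z) * path_weight (c z) (c w))\<^sup>2)"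
      unfolding sum_eigenvalues_power4 by (simp add: K)
    also have "\<dots> = (\<Sum>v\<in>V. \<Sum>w\<in>V. (h (c v) (c w))\<^sup>2)"
      unfolding h_def by (intro sum.cong refl arg_cong[of _ _ "\<lambda>x. x\<^sup>2"]) (rule sumV)
    also have "\<dots> = (\<Sum>v\<in>V. (m 0 * (h (c v) 0)\<^sup>2 + m 1 * (h (c v) 1)\<^sup>2
        + m 2 * (h (c v) 2)\<^sup>2 + m 3 * (h (c v) 3)\<^sup>2))"
      by (intro sum.cong refl) (rule sumV)
    also have "\<dots> = 2 * (P\<^sup>2 - 2 * Q)"
      by (subst sumV) (simp add: h_def path_weight_def P_def Q_def power2_eq_square algebra_simps)
    finally show ?thesis .
  qed
  have eq: "l k = 0 \<or> ((l k)\<^sup>2)\<^sup>2 - P * (l k)\<^sup>2 + Q = 0" if k: "k < N" for k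
  proof (rule disjCI)
    assume bad: "\<not> ((l k)\<^sup>2)\<^sup>2 - P * (l k)\<^sup>2 + Q = 0"
    \<comment> \<open>The class sums of an eigenvector satisfy the quotient system \<open>E\<close>.
      Eliminating \<open>S 0\<close> and \<open>S 3\<close> leaves two linear equations in
      \<open>S 1\<close> and \<open>S 2\<close> whose determinant is the quartic. If it does not
      vanish, both are zero, and a nonzero eigenvalue would force the whole eigenvector to be
      zero.\<close>
    define S where "S i = (\<Sum>v | v \<in> V \<and> c v = i. u v k)" for i
    define F where "F i = S 0 * path_weight i 0 + S 1 * path_weight i 1 + S 2 * path_weight i 2 + S 3 * path_weight i 3" for i
    have ev: "l k * u v k = F (c v)" if v: "v \<in> V" for v
    proof -
      have "l k * u v k = (\<Sum>w\<in>V. u w k * path_weight (c v) (c w))"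
        unfolding eigenvector[OF v k, symmetric] using v by (intro sum.cong refl) (simp add: K)
      then show ?thesis
        using sum_over_four_classes[OF finV c, where f = "\<lambda>w. u w k" and h = "path_weight (c v)"]
        by (simp add: F_def S_def)
    qed
    have lS: "l k * S i = m i * F i" for i
    proof -
      have "l k * S i = (\<Sum>v | v \<in> V \<and> c v = i. F i)"
        unfolding S_def sum_distrib_left by (intro sum.cong refl) (auto simp: ev)
      then show ?thesis by (simp add: m_def)
    qed
    define x where "x = l k"
    have F: "F 0 = 2 * S 1" "F 1 = 2 * S 0 + 3 * S 2" "F 2 = 3 * S 1 + 2 * S 3" "F 3 = 2 * S 2"
      by (simp_all add: F_def path_weight_def)
    have E: "x * S 0 = m 0 * (2 * S 1)" "x * S 1 = m 1 * (2 * S 0 + 3 * S 2)"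
      "x * S 2 = m 2 * (3 * S 1 + 2 * S 3)" "x * S 3 = m 3 * (2 * S 2)"
      unfolding x_def lS F by simp_all
    have E1: "(x\<^sup>2 - 4 * m 0 * m 1) * S 1 = 3 * m 1 * x * S 2"
    proof -
      have "x\<^sup>2 * S 1 = 2 * m 1 * (x * S 0) + 3 * m 1 * x * S 2"
        unfolding power2_eq_square mult.assoc E(2) by (simp add: algebra_simps)
      then show ?thesis unfolding E(1) by (simp add: algebra_simps)
    qed
    have E2: "(x\<^sup>2 - 4 * m 2 * m 3) * S 2 = 3 * m 2 * x * S 1"
    proof -
      have "x\<^sup>2 * S 2 = 2 * m 2 * (x * S 3) + 3 * m 2 * x * S 1"
        unfolding power2_eq_square mult.assoc E(3) by (simp add: algebra_simps)
      then show ?thesis unfolding E(4) by (simp add: algebra_simps)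
    qed
    have poly: "(x\<^sup>2 - 4 * m 0 * m 1) * (x\<^sup>2 - 4 * m 2 * m 3) - 9 * m 1 * m 2 * x\<^sup>2 = (x\<^sup>2)\<^sup>2 - P * x\<^sup>2 + Q"
      by (simp add: P_def Q_def power2_eq_square algebra_simps)
    have "((x\<^sup>2)\<^sup>2 - P * x\<^sup>2 + Q) * S 1 = (x\<^sup>2 - 4 * m 2 * m 3) * ((x\<^sup>2 - 4 * m 0 * m 1) * S 1) - 9 * m 1 * m 2 * x\<^sup>2 * S 1"
      unfolding poly[symmetric] by (simp add: algebra_simps)
    also have "\<dots> = 3 * m 1 * x * ((x\<^sup>2 - 4 * m 2 * m 3) * S 2) - 9 * m 1 * m 2 * x\<^sup>2 * S 1"
      unfolding E1 by (simp add: algebra_simps)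
    also have "\<dots> = 0" unfolding E2 by (simp add: algebra_simps power2_eq_square)
    finally have S1: "S 1 = 0" using bad unfolding x_def by simp
    have "((x\<^sup>2)\<^sup>2 - P * x\<^sup>2 + Q) * S 2 = (x\<^sup>2 - 4 * m 0 * m 1) * ((x\<^sup>2 - 4 * m 2 * m 3) * S 2) - 9 * m 1 * m 2 * x\<^sup>2 * S 2"
      unfolding poly[symmetric] by (simp add: algebra_simps)
    also have "\<dots> = 3 * m 2 * x * ((x\<^sup>2 - 4 * m 0 * m 1) * S 1) - 9 * m 1 * m 2 * x\<^sup>2 * S 2"
      unfolding E2 by (simp add: algebra_simps)
    also have "\<dots> = 0" unfolding E1 by (simp add: algebra_simps power2_eq_square)
    finally have S2: "S 2 = 0" using bad unfolding x_def by simp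
    show "l k = 0"
    proof (rule ccontr)
      assume "l k \<noteq> 0"
      then have "S 0 = 0" "S 3 = 0" using E(1,4) S1 S2 by (auto simp: x_def)
      then have "F i = 0" for i using S1 S2 by (simp add: F_def)
      then have "u v k = 0" if "v \<in> V" for v using ev[OF that] \<open>l k \<noteq> 0\<close> by simp
      then show False using orth[OF k k] by simp
    qed
  qed
  \<comment> \<open>For a root \<open>a\<close> of \<open>a^2 - P a + g^2\<close> one has
    \<open>(a + g)^2 = t^2 a\<close>, so the absolute value is \<open>(a + g) / t\<close>. Writing
    the constant \<open>g\<close> as \<open>(P a - a^2) / g\<close> leaves it unchanged on roots and
    makes the formula vanish at \<open>0\<close>, so the eigenvalue \<open>0\<close> is covered as
    well.\<close>
  have abs_l: "\<bar>l k\<bar> = ((l k)\<^sup>2 + (P * (l k)\<^sup>2 - (l k)^4) / g) / t" if k: "k < N" for k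
  proof (cases "l k = 0")
    case False
    define a where "a = (l k)\<^sup>2"
    have a: "a > 0" "a = \<bar>l k\<bar>\<^sup>2" using False by (auto simp: a_def)
    have "a\<^sup>2 - P * a + g\<^sup>2 = 0" using eq[OF k] False g(2) by (simp add: a_def)
    moreover have "(a + g - t * \<bar>l k\<bar>) * (a + g + t * \<bar>l k\<bar>) = (a + g)\<^sup>2 - t\<^sup>2 * a"
      unfolding a(2) by (simp add: power2_eq_square algebra_simps)
    ultimately have "(a + g - t * \<bar>l k\<bar>) * (a + g + t * \<bar>l k\<bar>) = 0"
      unfolding t(2) by (simp add: power2_eq_square algebra_simps)
    moreover have "a + g + t * \<bar>l k\<bar> > 0" using a g t by (simp add: add_pos_nonneg)
    ultimately have "t * \<bar>l k\<bar> = a + g" by simp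
    moreover have "(P * a - a\<^sup>2) / g = g" using \<open>a\<^sup>2 - P * a + g\<^sup>2 = 0\<close> g by (simp add: field_simps power2_eq_square)
    ultimately have "\<bar>l k\<bar> = (a + (P * a - a\<^sup>2) / g) / t" using t by (simp add: field_simps)
    then show ?thesis by (simp add: a_def)
  qed simp
  have "(\<Sum>k<N. \<bar>l k\<bar>) = (\<Sum>k<N. ((l k)\<^sup>2 + (P * (l k)\<^sup>2 - (l k)^4) / g) / t)"
    by (intro sum.cong refl) (simp add: abs_l)
  also have "\<dots> = ((\<Sum>k<N. (l k)\<^sup>2) + (P * (\<Sum>k<N. (l k)\<^sup>2) - (\<Sum>k<N. (l k)^4)) / g) / t"
    by (simp add: sum_divide_distrib sum.distrib sum_subtractf sum_distrib_left diff_divide_distrib add_divide_distrib)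
  also have "\<dots> = (2 * P + 4 * g\<^sup>2 / g) / t"
    unfolding p2 p4 g(2) by (simp add: power2_eq_square algebra_simps)
  also have "\<dots> = 2 * t\<^sup>2 / t" unfolding t(2) using g(1) by (simp add: power2_eq_square algebra_simps)
  also have "\<dots> = 2 * t" using t(1) by (simp add: power2_eq_square)
  finally show ?thesis by (simp add: t_def g_def)
qed

section \<open>Trees as metric spaces\<close>

text \<open>Trees grown leaf by leaf, each edge entering as two arcs. Acyclicity offers no induction
  by itself; this form lets every metric property be proved by attaching one vertex.\<close>

inductive leaf_tree :: "'a set \<Rightarrow> ('a \<times> 'a) set \<Rightarrow> bool" where
  single: "leaf_tree {v} {}"
| leaf: "leaf_tree V E \<Longrightarrow> w \<in> V \<Longrightarrow> x \<notin> V \<Longrightarrow> leaf_tree (insert x V) (insert (x, w) (insert (w, x) E))"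

lemma leaf_tree_finite: "leaf_tree V E \<Longrightarrow> finite V \<and> finite E \<and> E \<subseteq> V \<times> V \<and> V \<noteq> {}"
  by (induction rule: leaf_tree.induct) auto

text \<open>Needed to exhibit a cycle: an outside vertex adjacent to both ends of such a path closes
  it up.\<close>

lemma leaf_tree_path:
  assumes "leaf_tree V E" "u \<in> V" "v \<in> V"
  shows "\<exists>p. p \<noteq> [] \<and> hd p = u \<and> last p = v \<and> distinct p \<and> set p \<subseteq> V \<and>
    successively (\<lambda>a b. (a, b) \<in> E) p"
  using assms
proof (induction arbitrary: u v rule: leaf_tree.induct)
  case (single a)
  then show ?case by (intro exI[of _ "[a]"]) auto
next
  case (leaf V E w x)
  let ?E = "insert (x, w) (insert (w, x) E)"
  have mono: "successively (\<lambda>a b. (a, b) \<in> E) p \<Longrightarrow> successively (\<lambda>a b. (a, b) \<in> ?E) p" for p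
    by (erule successively_mono) auto
  consider "u = x" "v = x" | "u = x" "v \<in> V" | "u \<in> V" "v = x" | "u \<in> V" "v \<in> V"
    using leaf.prems by auto
  then show ?case
  proof cases
    case 1
    then show ?thesis by (intro exI[of _ "[x]"]) auto
  next
    case 2
    obtain p where p: "p \<noteq> []" "hd p = w" "last p = v" "distinct p" "set p \<subseteq> V" "successively (\<lambda>a b. (a, b) \<in> E) p"
      using leaf.IH[OF leaf.hyps(2) 2(2)] by blast
    then show ?thesis using 2 leaf.hyps mono[OF p(6)]
      by (intro exI[of _ "x # p"]) (auto simp: successively_Cons)
  next
    case 3
    obtain p where p: "p \<noteq> []" "hd p = u" "last p = w" "distinct p" "set p \<subseteq> V" "successively (\<lambda>a b. (a, b) \<in> E) p"
      using leaf.IH[OF 3(1) leaf.hyps(2)] by blast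
    then show ?thesis using 3 leaf.hyps mono[OF p(6)]
      by (intro exI[of _ "p @ [x]"]) (auto simp: successively_append_iff)
  next
    case 4
    then show ?thesis using leaf.IH[OF 4] mono by blast
  qed
qed

lemma (in pair_wf_digraph) awalk_vertex_list:
  assumes "u \<in> pverts G" "successively (\<lambda>a b. (a, b) \<in> parcs G) (u # p)"
  shows "awalk u (zip (u # p) p) (last (u # p)) \<and> pawalk_verts u (zip (u # p) p) = u # p"
  using assms
proof (induction p arbitrary: u)
  case (Cons w p)
  then have "(u, w) \<in> parcs G" by simp
  moreover have "w \<in> pverts G" using calculation by (rule in_arcsD2)
  ultimately show ?case using Cons by (simp add: awalk_Cons_iff)
qed (simp add: awalk_Nil_iff)

lemma (in pair_wf_digraph) awalk_leaves_set:
  assumes "awalk u p v" "u \<in> S" "v \<notin> S"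
  shows "\<exists>a b. (a, b) \<in> parcs G \<and> a \<in> S \<and> b \<notin> S"
  using assms
proof (induction p arbitrary: u)
  case Nil
  then show ?case by (simp add: awalk_Nil_iff)
next
  case (Cons e p)
  then have e: "e \<in> parcs G" "u = fst e" "awalk (snd e) p v" by (simp_all add: awalk_Cons_iff)
  show ?case
  proof (cases "snd e \<in> S")
    case True
    then show ?thesis using Cons.IH[OF e(3)] Cons.prems by blast
  next
    case False
    then show ?thesis using e Cons.prems by (intro exI[of _ "fst e"] exI[of _ "snd e"]) simp
  qed
qed

text \<open>A maximal vertex set inducing a \<^const>\<open>leaf_tree\<close> is everything: a vertex outside it that is
  adjacent to it has only one neighbour in it, since two neighbours would close a cycle.\<close>

lemma graph_tree_imp_leaf_tree:
  assumes "graph_tree G"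
  shows "leaf_tree (pverts G) (parcs G)"
proof -
  have pg: "pair_graph G" and con: "Digraph_Component.connected (with_proj G)"
    and acyc: "\<not> (\<exists>p. pre_digraph.cycle (with_proj G) p \<and> 3 \<le> length p)"
    using assms by (auto simp: graph_tree_def)
  interpret pair_graph G by (rule pg)
  have strong: "strongly_connected (with_proj G)"
    using symmetric_connected_imp_strongly_connected[OF pair_sym_arcs con] .
  define S where "S = {W. W \<subseteq> pverts G \<and> leaf_tree W (parcs G \<inter> W \<times> W)}"
  obtain r where r: "r \<in> pverts G" using strong by (auto simp: strongly_connected_def)
  have "parcs G \<inter> {r} \<times> {r} = {}" using pair_no_loops[of "(r, r)"] by auto
  then have "{r} \<in> S" using r leaf_tree.single[of r] by (simp add: S_def)
  moreover have "finite S" unfolding S_def using pair_finite_verts by simp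
  ultimately obtain W where W: "W \<in> S" and max: "\<And>U. U \<in> S \<Longrightarrow> W \<subseteq> U \<Longrightarrow> U = W"
    using finite_has_maximal[of S] by blast
  have lt: "leaf_tree W (parcs G \<inter> W \<times> W)" and WV: "W \<subseteq> pverts G" using W by (auto simp: S_def)
  have "W = pverts G"
  proof (rule ccontr)
    assume "W \<noteq> pverts G"
    then obtain y where y: "y \<in> pverts G" "y \<notin> W" using WV by auto
    obtain z where z: "z \<in> W" using leaf_tree_finite[OF lt] by auto
    have "z \<rightarrow>\<^sup>*\<^bsub>with_proj G\<^esub> y" using strong z y WV by (auto simp: strongly_connected_def)
    then obtain p where "awalk z p y" using reachable_awalk by blast
    then obtain w x where wx: "(w, x) \<in> parcs G" "w \<in> W" "x \<notin> W"
      using awalk_leaves_set z y by blast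
    have xw: "(x, w) \<in> parcs G" using wx(1) by (rule arcs_symmetric)
    have x: "x \<in> pverts G" using wx(1) by (rule in_arcsD2)
    have uniq: "w' = w" if w': "(x, w') \<in> parcs G" "w' \<in> W" for w'
    proof (rule ccontr)
      assume ne: "w' \<noteq> w"
      obtain p where p: "p \<noteq> []" "hd p = w" "last p = w'" "distinct p" "set p \<subseteq> W"
        "successively (\<lambda>a b. (a, b) \<in> parcs G \<inter> W \<times> W) p"
        using leaf_tree_path[OF lt wx(2) w'(2)] by blast
      have "successively (\<lambda>a b. (a, b) \<in> parcs G) p"
        using p(6) by (rule successively_mono) auto
      then have "successively (\<lambda>a b. (a, b) \<in> parcs G) (x # p @ [x])"
        using p(1-3) xw arcs_symmetric[OF w'(1)] by (auto simp: successively_Cons successively_append_iff)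
      from awalk_vertex_list[OF x this]
      have aw: "awalk x (zip (x # p @ [x]) (p @ [x])) x"
        "pawalk_verts x (zip (x # p @ [x]) (p @ [x])) = x # p @ [x]"
        by auto
      have "x \<notin> set p" using p(5) wx(3) by auto
      then have "cycle (zip (x # p @ [x]) (p @ [x]))"
        unfolding cycle_def using aw p(1,4) by (intro exI[of _ x]) auto
      \<comment> \<open>The cycle has one arc more than \<open>p\<close> has vertices. Since
        \<open>w\<close> and \<open>w'\<close> differ, its length is at least three, so it is not a
        walk back and forth along an edge.\<close>
      moreover have "length p \<ge> 2"
        using p(1-3) ne by (cases p; cases "tl p") auto
      ultimately show False using acyc by (auto dest!: spec[of _ "zip (x # p @ [x]) (p @ [x])"])
    qed
    have "(x, x) \<notin> parcs G" using pair_no_loops[of "(x, x)"] by auto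
    moreover have "(x, b) \<in> parcs G \<longleftrightarrow> b = w" if "b \<in> W" for b using uniq xw that by blast
    moreover have "(b, x) \<in> parcs G \<longleftrightarrow> b = w" if "b \<in> W" for b
      using uniq[OF arcs_symmetric] wx(1) that by blast
    ultimately have "parcs G \<inter> insert x W \<times> insert x W = insert (x, w) (insert (w, x) (parcs G \<inter> W \<times> W))"
      using wx(2) by auto
    then have "insert x W \<in> S"
      using leaf_tree.leaf[OF lt wx(2,3)] x WV by (simp add: S_def)
    then show False using max[of "insert x W"] wx(3) by auto
  qed
  moreover have "parcs G \<inter> pverts G \<times> pverts G = parcs G"
    using in_arcsD1 in_arcsD2 by auto
  ultimately show ?thesis using lt by simp
qed

text \<open>\<open>four_point\<close> is Buneman's condition for tree metrics, \<open>parity\<close>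
  expresses bipartiteness, and \<open>card_arcs\<close> counts every edge twice.\<close>

locale tree_metric =
  fixes V :: "'a set" and d :: "'a \<Rightarrow> 'a \<Rightarrow> nat"
  assumes fin: "finite V"
    and dist_sym: "u \<in> V \<Longrightarrow> v \<in> V \<Longrightarrow> d u v = d v u"
    and dist_zero: "u \<in> V \<Longrightarrow> v \<in> V \<Longrightarrow> d u v = 0 \<longleftrightarrow> u = v"
    and tri: "u \<in> V \<Longrightarrow> v \<in> V \<Longrightarrow> w \<in> V \<Longrightarrow> d u w \<le> d u v + d v w"
    and parity: "u \<in> V \<Longrightarrow> v \<in> V \<Longrightarrow> w \<in> V \<Longrightarrow> even (d u v + d v w + d w u)"
    and four_point: "u \<in> V \<Longrightarrow> v \<in> V \<Longrightarrow> a \<in> V \<Longrightarrow> b \<in> V \<Longrightarrow>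
      d u v + d a b \<le> max (d u a + d v b) (d u b + d v a)"
    and geodesic: "u \<in> V \<Longrightarrow> v \<in> V \<Longrightarrow> d u v = Suc k \<Longrightarrow> \<exists>w\<in>V. d u w = 1 \<and> d w v = k"
    and card_arcs: "card {(u, v). u \<in> V \<and> v \<in> V \<and> d u v = 1} = 2 * (card V - 1)"

lemma leaf_tree_imp_tree_metric:
  assumes "leaf_tree V E"
  shows "\<exists>d. tree_metric V d \<and> E = {(u, v). u \<in> V \<and> v \<in> V \<and> d u v = 1}"
  using assms
proof (induction rule: leaf_tree.induct)
  case (single v)
  show ?case by (rule exI[of _ "\<lambda>_ _. 0"]) (auto intro!: tree_metric.intro)
next
  case (leaf V E w x)
  then obtain d where tm: "tree_metric V d" and E: "E = {(u, v). u \<in> V \<and> v \<in> V \<and> d u v = 1}"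
    by blast
  interpret tree_metric V d by (rule tm)
  note w = leaf.hyps(2) and x = leaf.hyps(3)
  define d' where "d' u v = (if u = x then if v = x then 0 else Suc (d w v) else if v = x then Suc (d u w) else d u v)" for u v
  \<comment> \<open>Every path from the new leaf \<open>x\<close> to another vertex passes through
    \<open>w\<close>. Projecting \<open>x\<close> to \<open>w\<close> thus reduces each metric axiom
    for \<open>d'\<close> to one for \<open>d\<close>, up to a correction of one for each occurrence
    of \<open>x\<close>; only \<open>d' x x\<close> has to be zero instead of two.\<close>
  define \<pi> where "\<pi> u = (if u = x then w else u)" for u
  have \<pi>: "u \<in> insert x V \<Longrightarrow> \<pi> u \<in> V" for u using w by (auto simp: \<pi>_def)
  have ww: "d w w = 0" using dist_zero w by simp
  have d': "d' u v = (if u = x \<and> v = x then 0 else d (\<pi> u) (\<pi> v) + of_bool (u = x) + of_bool (v = x))" for u v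
    by (simp add: d'_def \<pi>_def)
  have even_d': "even (d' u v) \<longleftrightarrow> even (d (\<pi> u) (\<pi> v)) = ((u = x) = (v = x))" for u v
    by (cases "u = x"; cases "v = x") (simp_all add: d' \<pi>_def ww)
  have sym_le: "d (\<pi> u) w \<le> d w (\<pi> u)" "d w (\<pi> u) \<le> d (\<pi> u) w" if "u \<in> insert x V" for u
    using dist_sym[OF w \<pi>[OF that]] by simp_all
  have E': "insert (x, w) (insert (w, x) E) = {(u, v). u \<in> insert x V \<and> v \<in> insert x V \<and> d' u v = 1}"
    using w x by (auto simp: d'_def E dist_zero)
  have "tree_metric (insert x V) d'"
  proof
    show "finite (insert x V)" using fin by simp
  next
    fix u v assume "u \<in> insert x V" "v \<in> insert x V"
    then show "d' u v = d' v u" using dist_sym[OF \<pi> \<pi>] by (auto simp: d')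
  next
    fix u v assume "u \<in> insert x V" "v \<in> insert x V"
    then show "d' u v = 0 \<longleftrightarrow> u = v" by (auto simp: d'_def dist_zero)
  next
    fix u v a assume *: "u \<in> insert x V" "v \<in> insert x V" "a \<in> insert x V"
    note \<pi>' = \<pi>[OF *(1)] \<pi>[OF *(2)] \<pi>[OF *(3)]
    show "d' u a \<le> d' u v + d' v a"
      using tri[OF \<pi>'] ww by (cases "u = x"; cases "v = x"; cases "a = x") (simp_all add: d' \<pi>_def)
    show "even (d' u v + d' v a + d' a u)"
      using parity[OF \<pi>'] by (cases "u = x"; cases "v = x"; cases "a = x"; simp add: even_d'; blast)
  next
    fix u v a b assume *: "u \<in> insert x V" "v \<in> insert x V" "a \<in> insert x V" "b \<in> insert x V"
    note \<pi>' = \<pi>[OF *(1)] \<pi>[OF *(2)] \<pi>[OF *(3)] \<pi>[OF *(4)]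
    show "d' u v + d' a b \<le> max (d' u a + d' v b) (d' u b + d' v a)"
      using four_point[OF \<pi>'] tri[OF \<pi>'(1) w \<pi>'(2)] tri[OF \<pi>'(3) w \<pi>'(4)]
        sym_le[OF *(1)] sym_le[OF *(2)] sym_le[OF *(3)] sym_le[OF *(4)]
      by (cases "u = x"; cases "v = x"; cases "a = x"; cases "b = x"; simp add: d' \<pi>_def ww le_max_iff_disj; arith?)
  next
    fix u v k assume *: "u \<in> insert x V" "v \<in> insert x V" "d' u v = Suc k"
    show "\<exists>z\<in>insert x V. d' u z = 1 \<and> d' z v = k"
    proof (cases "u = x")
      case True
      then show ?thesis using * w x ww by (intro bexI[of _ w]) (auto simp: d'_def split: if_splits)
    next
      case False
      then have u: "u \<in> V" using * by simp
      show ?thesis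
      proof (cases "v = x")
        case True
        show ?thesis
        proof (cases "u = w")
          case True
          moreover have "w \<noteq> x" using w x by auto
          ultimately show ?thesis using *(3) \<open>v = x\<close> ww by (intro bexI[of _ x]) (auto simp: d'_def)
        next
          case False
          then obtain j where j: "d u w = Suc j" using dist_zero[OF u w] by (cases "d u w") auto
          then obtain z where z: "z \<in> V" "d u z = 1" "d z w = j" using geodesic[OF u w] by blast
          then show ?thesis using * \<open>v = x\<close> \<open>u \<noteq> x\<close> x j by (intro bexI[of _ z]) (auto simp: d'_def)
        qed
      next
        case False
        then have v: "v \<in> V" using * by simp
        then obtain z where z: "z \<in> V" "d u z = 1" "d z v = k"
          using geodesic[OF u v] * \<open>u \<noteq> x\<close> False by (auto simp: d'_def)
        then show ?thesis using \<open>u \<noteq> x\<close> False x by (intro bexI[of _ z]) (auto simp: d'_def)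
      qed
    qed
  next
    have "finite E" using leaf_tree_finite[OF leaf.hyps(1)] by simp
    moreover have "(x, w) \<notin> insert (w, x) E" "(w, x) \<notin> E" using w x by (auto simp: E)
    ultimately have "card (insert (x, w) (insert (w, x) E)) = Suc (Suc (card E))" by simp
    moreover have "card E = 2 * (card V - 1)" using card_arcs by (simp add: E)
    moreover have "card V > 0" using w fin by (auto simp: card_gt_0_iff)
    ultimately show "card {(u, v). u \<in> insert x V \<and> v \<in> insert x V \<and> d' u v = 1} = 2 * (card (insert x V) - 1)"
      unfolding E'[symmetric] using x fin by simp
  qed
  then show ?case using E' by blast
qed

text \<open>A certificate for distances: \<open>step\<close> lets \<delta> drop by at most one per
  arc, so no walk is shorter than \<delta>, and \<open>next_vertex\<close> builds a walk along which
  it drops by exactly one. It serves for trees and for complements.\<close>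

lemma (in pair_wf_digraph) graph_dist_eqI:
  assumes same: "\<And>v. v \<in> pverts G \<Longrightarrow> \<delta> v v = (0::nat)"
    and step: "\<And>u w v. (u, w) \<in> parcs G \<Longrightarrow> v \<in> pverts G \<Longrightarrow> \<delta> u v \<le> Suc (\<delta> w v)"
    and zero: "\<And>u v. u \<in> pverts G \<Longrightarrow> v \<in> pverts G \<Longrightarrow> \<delta> u v = 0 \<Longrightarrow> u = v"
    and next_vertex: "\<And>u v k. u \<in> pverts G \<Longrightarrow> v \<in> pverts G \<Longrightarrow> \<delta> u v = Suc k \<Longrightarrow>
      \<exists>w. (u, w) \<in> parcs G \<and> \<delta> w v = k"
    and uv: "u \<in> pverts G" "v \<in> pverts G"
  shows "graph_dist G u v = \<delta> u v"
proof -
  have ex: "\<exists>p. awalk u p v \<and> length p = k" if "\<delta> u v = k" "u \<in> pverts G" for u k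
    using that
  proof (induction k arbitrary: u)
    case 0
    then show ?case using zero[of u v] uv by (intro exI[of _ "[]"]) (simp add: awalk_Nil_iff)
  next
    case (Suc k)
    then obtain w where w: "(u, w) \<in> parcs G" "\<delta> w v = k" using next_vertex uv by blast
    then obtain p where "awalk w p v" "length p = k" using Suc.IH in_arcsD2 by blast
    then show ?case using w by (intro exI[of _ "(u, w) # p"]) (simp add: awalk_Cons_iff)
  qed
  have le: "\<delta> u v \<le> length p" if "awalk u p v" for p
    using that
  proof (induction p arbitrary: u)
    case Nil
    then show ?case using same uv by (simp add: awalk_Nil_iff)
  next
    case (Cons e p)
    then have "(u, snd e) \<in> parcs G" "awalk (snd e) p v" by (auto simp: awalk_Cons_iff)
    then show ?case using step[of u "snd e" v] uv Cons.IH by fastforce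
  qed
  show ?thesis
    unfolding graph_dist_def
    using ex[OF refl uv(1)] le by (intro Least_equality) auto
qed

lemma graph_tree_metric:
  assumes "graph_tree G"
  shows "tree_metric (pverts G) (graph_dist G)"
    and "parcs G = {(u, v). u \<in> pverts G \<and> v \<in> pverts G \<and> graph_dist G u v = 1}"
proof -
  obtain d where tm: "tree_metric (pverts G) d" and E: "parcs G = {(u, v). u \<in> pverts G \<and> v \<in> pverts G \<and> d u v = 1}"
    using leaf_tree_imp_tree_metric[OF graph_tree_imp_leaf_tree[OF assms]] by blast
  interpret tree_metric "pverts G" d by (rule tm)
  have "pair_graph G" using assms by (simp add: graph_tree_def)
  then interpret pair_graph G .
  have eq: "graph_dist G u v = d u v" if "u \<in> pverts G" "v \<in> pverts G" for u v
  proof (rule graph_dist_eqI)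
    fix u w v assume "(u, w) \<in> parcs G" "v \<in> pverts G"
    then show "d u v \<le> Suc (d w v)" using tri[of u w v] by (simp add: E)
  next
    fix u v k assume "u \<in> pverts G" "v \<in> pverts G" "d u v = Suc k"
    then show "\<exists>w. (u, w) \<in> parcs G \<and> d w v = k" using geodesic[of u v k] by (auto simp: E)
  qed (use that in \<open>auto simp: dist_zero\<close>)
  have arcs: "{(u, v). u \<in> pverts G \<and> v \<in> pverts G \<and> graph_dist G u v = 1} = {(u, v). u \<in> pverts G \<and> v \<in> pverts G \<and> d u v = 1}"
    using eq by auto
  show "parcs G = {(u, v). u \<in> pverts G \<and> v \<in> pverts G \<and> graph_dist G u v = 1}"
    unfolding arcs by (rule E)
  show "tree_metric (pverts G) (graph_dist G)"
  proof
    fix u v k assume "u \<in> pverts G" "v \<in> pverts G" "graph_dist G u v = Suc k"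
    then show "\<exists>w\<in>pverts G. graph_dist G u w = 1 \<and> graph_dist G w v = k"
      using geodesic[of u v k] eq by metis
  next
    show "card {(u, v). u \<in> pverts G \<and> v \<in> pverts G \<and> graph_dist G u v = 1} = 2 * (card (pverts G) - 1)"
      unfolding arcs by (rule card_arcs)
  next
    fix u v w assume "u \<in> pverts G" "v \<in> pverts G" "w \<in> pverts G"
    then show "graph_dist G u w \<le> graph_dist G u v + graph_dist G v w"
      "even (graph_dist G u v + graph_dist G v w + graph_dist G w u)"
      using tri[of u v w] parity[of u v w] by (simp_all add: eq)
  next
    fix u v a b assume *: "u \<in> pverts G" "v \<in> pverts G" "a \<in> pverts G" "b \<in> pverts G"
    show "graph_dist G u v + graph_dist G a b \<le> max (graph_dist G u a + graph_dist G v b) (graph_dist G u b + graph_dist G v a)"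
      using four_point[OF *] * by (simp add: eq)
  qed (simp_all add: eq fin dist_sym dist_zero)
qed

section \<open>Diameter at least four\<close>

lemma sum_mult_squared_le:
  fixes f g :: "'a \<Rightarrow> real"
  shows "(\<Sum>i\<in>A. f i * g i)\<^sup>2 \<le> (\<Sum>i\<in>A. (f i)\<^sup>2) * (\<Sum>i\<in>A. (g i)\<^sup>2)"
proof (cases "finite A")
  case True
  define X W Z where "X = (\<Sum>i\<in>A. (f i)\<^sup>2)" and "W = (\<Sum>i\<in>A. (g i)\<^sup>2)" and "Z = (\<Sum>i\<in>A. f i * g i)"
  show ?thesis
  proof (cases "W = 0")
    case True
    then have "g i = 0" if "i \<in> A" for i
      using that \<open>finite A\<close> by (simp add: W_def sum_nonneg_eq_0_iff)
    then show ?thesis by simp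
  next
    case False
    then have "W > 0" using sum_nonneg[of A "\<lambda>i. (g i)\<^sup>2"] by (simp add: W_def less_le)
    have "0 \<le> (\<Sum>i\<in>A. (W * f i - Z * g i)\<^sup>2)" by (intro sum_nonneg) simp
    also have "\<dots> = (\<Sum>i\<in>A. W\<^sup>2 * (f i)\<^sup>2 + (- (2 * W * Z) * (f i * g i) + Z\<^sup>2 * (g i)\<^sup>2))"
      by (intro sum.cong refl) (simp add: power2_eq_square algebra_simps)
    also have "\<dots> = W\<^sup>2 * X + (- (2 * W * Z) * Z + Z\<^sup>2 * W)"
      by (simp only: sum.distrib sum_distrib_left[symmetric] X_def[symmetric] W_def[symmetric] Z_def[symmetric])
    also have "\<dots> = W * (X * W - Z\<^sup>2)" by (simp add: power2_eq_square algebra_simps)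
    finally have "0 \<le> X * W - Z\<^sup>2" using \<open>W > 0\<close> by (simp add: zero_le_mult_iff)
    then show ?thesis by (simp add: X_def W_def Z_def)
  qed
qed simp

section \<open>Eccentricities and the diametral path\<close>

locale diametral_tree = tree_metric +
  fixes p q
  assumes pV: "p \<in> V" and qV: "q \<in> V" and diam: "u \<in> V \<Longrightarrow> v \<in> V \<Longrightarrow> d u v \<le> d p q"
begin

lemma dist_self: "u \<in> V \<Longrightarrow> d u u = 0"
  by (simp add: dist_zero)

text \<open>In the four-point condition for \<open>u\<close>, \<open>v\<close>, \<open>p\<close>,
  \<open>q\<close> the distances from \<open>v\<close> to the ends are at most \<open>d p q\<close>;
  cancelling \<open>d p q\<close> shows that no vertex is farther from \<open>u\<close> than the
  farther end.\<close>

lemma ecc_eq: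
  assumes u: "u \<in> V"
  shows "Max (d u ` V) = max (d u p) (d u q)"
proof (rule Max_eqI)
  show "finite (d u ` V)" using fin by simp
  show "max (d u p) (d u q) \<in> d u ` V" using pV qV by (simp add: max_def)
next
  fix y assume "y \<in> d u ` V"
  then obtain v where v: "v \<in> V" "y = d u v" by auto
  have "d u v + d p q \<le> max (d u p + d v q) (d u q + d v p)"
    using four_point[OF u v(1) pV qV] .
  then show "y \<le> max (d u p) (d u q)"
    using diam[OF v(1) qV] diam[OF v(1) pV] v(2) by linarith
qed

lemma ecc_end: "Max (d p ` V) = d p q" "Max (d q ` V) = d p q"
  using ecc_eq[OF pV] ecc_eq[OF qV] dist_self[OF pV] dist_self[OF qV] dist_sym[OF pV qV] by simp_all

lemma sum_dist_ends:
  assumes "v \<in> V"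
  shows "d p q \<le> d v p + d v q" "even (d v p + d v q + d p q)"
  using tri[OF pV assms qV] parity[OF assms pV qV] dist_sym[OF pV assms] dist_sym[OF qV assms]
  by (simp_all add: ac_simps)

lemma on_diametral_path_unique:
  assumes "u \<in> V" "v \<in> V" "d u p = d v p" "d u p + d u q = d p q" "d v p + d v q = d p q"
  shows "u = v"
proof -
  have "d u v = 0" using four_point[OF assms(1,2) pV qV] assms(3-5) by linarith
  then show ?thesis using dist_zero assms by simp
qed

lemma diametral_path_step:
  assumes "v \<in> V" "d v p + d v q = d p q" "d v p < d p q"
  shows "\<exists>w\<in>V. d w p = Suc (d v p) \<and> d w p + d w q = d p q \<and> d v w = 1"
proof -
  obtain k where k: "d v q = Suc k" using assms by (cases "d v q") auto
  then obtain w where w: "w \<in> V" "d v w = 1" "d w q = k" using geodesic[OF assms(1) qV] by blast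
  have "d w p \<le> Suc (d v p)"
    using tri[OF w(1) assms(1) pV] w(2) dist_sym[OF assms(1) w(1)] by simp
  moreover have "d p q \<le> d w p + d w q" using sum_dist_ends(1)[OF w(1)] .
  ultimately show ?thesis using w k assms(2) by (intro bexI[of _ w]) auto
qed

lemma diametral_path:
  obtains a where "\<And>i. i \<le> d p q \<Longrightarrow> a i \<in> V \<and> d (a i) p = i \<and> d (a i) p + d (a i) q = d p q"
    and "\<And>i. i < d p q \<Longrightarrow> d (a i) (a (Suc i)) = 1"
proof -
  have ex: "\<exists>v\<in>V. d v p = i \<and> d v p + d v q = d p q" if "i \<le> d p q" for i
    using that
  proof (induction i)
    case 0
    then show ?case using pV dist_self[OF pV] by (intro bexI[of _ p]) auto
  next
    case (Suc i)
    then show ?case using diametral_path_step by (metis Suc_leD Suc_le_lessD)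
  qed
  then obtain a where a: "\<And>i. i \<le> d p q \<Longrightarrow> a i \<in> V \<and> d (a i) p = i \<and> d (a i) p + d (a i) q = d p q"
    by metis
  moreover have "d (a i) (a (Suc i)) = 1" if i: "i < d p q" for i
  proof -
    have ai: "a i \<in> V" "d (a i) p = i" "d (a i) p + d (a i) q = d p q" using a[of i] i by auto
    have aj: "a (Suc i) \<in> V" "d (a (Suc i)) p = Suc i" "d (a (Suc i)) p + d (a (Suc i)) q = d p q"
      using a[of "Suc i"] i by auto
    obtain w where w: "w \<in> V" "d w p = Suc i" "d w p + d w q = d p q" "d (a i) w = 1"
      using diametral_path_step[OF ai(1,3)] ai(2) i by auto
    then have "w = a (Suc i)" using on_diametral_path_unique[OF w(1) aj(1)] aj by simp
    then show ?thesis using w by simp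
  qed
  ultimately show thesis using that by blast
qed

lemma diameter_less_card: "d p q < card V"
proof -
  obtain a where a: "\<And>i. i \<le> d p q \<Longrightarrow> a i \<in> V \<and> d (a i) p = i \<and> d (a i) p + d (a i) q = d p q"
    using diametral_path by metis
  have "inj_on a {..d p q}" by (rule inj_onI) (metis a atMost_iff)
  then have "card (a ` {..d p q}) = Suc (d p q)" by (simp add: card_image)
  moreover have "a ` {..d p q} \<subseteq> V" using a by auto
  ultimately show ?thesis using card_mono[OF fin, of "a ` {..d p q}"] by simp
qed

text \<open>The entry at \<open>v\<close> of row \<open>p\<close> of the eccentricity matrix. The
  end \<open>p\<close> has maximal eccentricity, so the minimum in the entry is the eccentricity of
  \<open>v\<close>, and \<open>d v p\<close> survives exactly when \<open>p\<close> is a farthest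
  end. On a tie both \<open>far_p\<close> and \<open>far_q\<close> are nonzero.\<close>

definition far_p :: "'a \<Rightarrow> real" where
  "far_p v = (if d v q \<le> d v p then real (d v p) else 0)"

definition far_q :: "'a \<Rightarrow> real" where
  "far_q v = (if d v p \<le> d v q then real (d v q) else 0)"

text \<open>A distance of at least 4 to the farther end suffices. Otherwise both distances are at
  most 3 and their sum exceeds \<open>d p q\<close> by a positive even number, hence is at least 6.
  This forces the tie \<open>(3, 3)\<close>, which contributes 18.\<close>

lemma far_squares:
  assumes "v \<in> V" "v \<noteq> p" "v \<noteq> q" "4 \<le> d p q"
    and off: "\<not> (d v p \<le> 3 \<and> d v p + d v q = d p q)"
  shows "16 \<le> (far_p v)\<^sup>2 + (far_q v)\<^sup>2"
proof -
  define x y where "x = d v p" and "y = d v q"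
  have sq: "16 \<le> (real z)\<^sup>2" if "4 \<le> z" for z :: nat
    using power_mono[of 4 "real z" 2] that by simp
  note s = sum_dist_ends[OF assms(1)]
  have pos: "x > 0" "y > 0" using assms dist_zero[OF assms(1) pV] dist_zero[OF assms(1) qV] by (auto simp: x_def y_def)
  consider "4 \<le> x" "y \<le> x" | "4 \<le> y" "x \<le> y" | "x \<le> 3" "y \<le> 3" by linarith
  then show ?thesis
  proof cases
    case 1
    then show ?thesis using sq[OF 1(1)] by (intro add_increasing2) (simp_all add: far_p_def x_def y_def)
  next
    case 2
    then show ?thesis using sq[OF 2(1)] by (intro add_increasing) (simp_all add: far_q_def x_def y_def)
  next
    case 3
    have "x + y \<noteq> d p q" using off 3 by (simp add: x_def y_def)
    moreover have "d p q \<le> x + y" "even (x + y + d p q)" using s by (simp_all add: x_def y_def)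
    ultimately have "x + y \<ge> d p q + 2" by presburger
    then have "x = 3" "y = 3" using 3 assms(4) by linarith+
    then show ?thesis by (simp add: far_p_def far_q_def x_def y_def)
  qed
qed

lemma far_squares_sum:
  assumes D: "4 \<le> d p q"
  shows "16 * real (card V) - 54 \<le> (\<Sum>v\<in>V - {p, q}. (far_p v)\<^sup>2 + (far_q v)\<^sup>2)"
proof -
  obtain a where a: "\<And>i. i \<le> d p q \<Longrightarrow> a i \<in> V \<and> d (a i) p = i \<and> d (a i) p + d (a i) q = d p q"
    using diametral_path by metis
  define Y where "Y = V - {p, q}"
  let ?f = "\<lambda>v. (far_p v)\<^sup>2 + (far_q v)\<^sup>2"
  have pq: "p \<noteq> q" using D dist_self[OF pV] by auto
  have aY: "a i \<in> Y" if "1 \<le> i" "i \<le> 3" for i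
    using a[of i] that D dist_self[OF pV] dist_self[OF qV] by (auto simp: Y_def)
  have dist: "a 1 \<noteq> a 2" "a 1 \<noteq> a 3" "a 2 \<noteq> a 3"
    using a[of 1] a[of 2] a[of 3] D by auto
  have finY: "finite Y" using fin by (simp add: Y_def)
  have "card {p, q} = 2" "{p, q} \<subseteq> V" using pq pV qV by auto
  then have cY: "card Y + 2 = card V"
    using card_mono[OF fin, of "{p, q}"] by (simp add: Y_def card_Diff_subset del: card_insert_disjoint)
  have sub: "{a 1, a 2, a 3} \<subseteq> Y" using aY[of 1] aY[of 2] aY[of 3] by auto
  have card3: "card {a 1, a 2, a 3} = 3" using dist by simp
  then have c3: "3 \<le> card Y" using card_mono[OF finY sub] by simp
  have rest: "16 \<le> ?f v" if "v \<in> Y - {a 1, a 2, a 3}" for v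
  proof (rule far_squares)
    show "v \<in> V" "v \<noteq> p" "v \<noteq> q" using that by (auto simp: Y_def)
    show "\<not> (d v p \<le> 3 \<and> d v p + d v q = d p q)"
    proof
      assume *: "d v p \<le> 3 \<and> d v p + d v q = d p q"
      have vV: "v \<in> V" "v \<noteq> p" using that by (auto simp: Y_def)
      have "d v p \<noteq> 0" using dist_zero[OF vV(1) pV] vV by simp
      then have i: "d v p = 1 \<or> d v p = 2 \<or> d v p = 3" using * by linarith
      have "v = a (d v p)"
        using on_diametral_path_unique[OF vV(1)] a[of "d v p"] * D by auto
      then show False using i that by auto
    qed
  qed (rule D)
  have sq: "real (m * m) \<le> (real z)\<^sup>2" if "m \<le> z" for m z :: nat
    using mult_mono[OF that that] by (simp add: power2_eq_square flip: of_nat_mult)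
  have f1: "9 \<le> ?f (a 1)"
    using a[of 1] D sq[of 3 "d (a 1) q"] by (intro add_increasing) (auto simp: far_q_def)
  have f2: "8 \<le> ?f (a 2)"
  proof (cases "d p q = 4")
    case True
    then have "d (a 2) p = 2" "d (a 2) q = 2" using a[of 2] by auto
    then show ?thesis by (simp add: far_p_def far_q_def)
  next
    case False
    then show ?thesis using a[of 2] D sq[of 3 "d (a 2) q"] by (intro add_increasing) (auto simp: far_q_def)
  qed
  have f3: "9 \<le> ?f (a 3)"
  proof (cases "d (a 3) q \<le> 3")
    case True
    then show ?thesis using a[of 3] D by (intro add_increasing2) (auto simp: far_p_def)
  next
    case False
    then show ?thesis using a[of 3] D sq[of 3 "d (a 3) q"] by (intro add_increasing) (auto simp: far_q_def)
  qed
  \<comment> \<open>Of the \<open>card V - 2\<close> columns, three are exceptional and contribute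
    at least 9, 8 and 9. The 8 occurs when \<open>d p q = 4\<close>, where \<open>a 2\<close> is the
    midpoint with squares 4 and 4.\<close>
  have "16 * real (card V) - 54 = 16 * real (card (Y - {a 1, a 2, a 3})) + 26"
    using cY card3 c3 sub finY by (simp add: card_Diff_subset of_nat_diff flip: cY)
  also have "16 * real (card (Y - {a 1, a 2, a 3})) \<le> (\<Sum>v\<in>Y - {a 1, a 2, a 3}. ?f v)"
    using sum_mono[of "Y - {a 1, a 2, a 3}" "\<lambda>_. 16" ?f] rest by simp
  also have "26 \<le> (\<Sum>v\<in>{a 1, a 2, a 3}. ?f v)"
    using f1 f2 f3 dist by simp
  also have "(\<Sum>v\<in>Y - {a 1, a 2, a 3}. ?f v) + (\<Sum>v\<in>{a 1, a 2, a 3}. ?f v) = (\<Sum>v\<in>Y. ?f v)"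
    using sum.subset_diff[OF sub finY, of ?f] by simp
  finally show ?thesis by (simp add: Y_def)
qed

text \<open>The neighbours of \<open>p\<close> and \<open>q\<close> on the diametral path contribute the columns \<open>(0, m)\<close> and
  \<open>(m, 0)\<close>, which keep the Gram determinant of the two rows away from \<open>0\<close>.\<close>

lemma far_gram:
  assumes D: "4 \<le> d p q"
  shows "9 * (16 * real (card V) - 63) \<le>
    (\<Sum>v\<in>V - {p, q}. (far_p v)\<^sup>2) * (\<Sum>v\<in>V - {p, q}. (far_q v)\<^sup>2) - (\<Sum>v\<in>V - {p, q}. far_p v * far_q v)\<^sup>2"
proof -
  obtain a where a: "\<And>i. i \<le> d p q \<Longrightarrow> a i \<in> V \<and> d (a i) p = i \<and> d (a i) p + d (a i) q = d p q"
    using diametral_path by metis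
  define Y where "Y = V - {p, q}"
  define b where "b = a 1"
  define c where "c = a (d p q - 1)"
  have b: "b \<in> V" "d b p = 1" "d b q = d p q - 1" using a[of 1] D by (auto simp: b_def)
  have c: "c \<in> V" "d c p = d p q - 1" "d c q = 1" using a[of "d p q - 1"] D by (auto simp: c_def)
  have bc: "b \<noteq> c" using b c D by auto
  have bcY: "b \<in> Y" "c \<in> Y - {b}" using b c D dist_self[OF pV] dist_self[OF qV] bc by (auto simp: Y_def)
  have finY: "finite Y" "finite (Y - {b})" using fin by (simp_all add: Y_def)
  define R where "R = Y - {b} - {c}"
  define m where "m = (real (d p q - 1))\<^sup>2"
  have split: "(\<Sum>v\<in>Y. f v) = f b + f c + (\<Sum>v\<in>R. f v)" for f :: "'a \<Rightarrow> real"
    using sum.remove[OF finY(1) bcY(1), of f] sum.remove[OF finY(2) bcY(2), of f] by (simp add: R_def)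
  have bf: "far_p b = 0" "(far_q b)\<^sup>2 = m" and cf: "(far_p c)\<^sup>2 = m" "far_q c = 0"
    using b c D by (simp_all add: far_p_def far_q_def m_def)
  define X where "X = (\<Sum>v\<in>R. (far_p v)\<^sup>2)"
  define W where "W = (\<Sum>v\<in>R. (far_q v)\<^sup>2)"
  define Z where "Z = (\<Sum>v\<in>R. far_p v * far_q v)"
  have "Z\<^sup>2 \<le> X * W" unfolding X_def W_def Z_def by (rule sum_mult_squared_le)
  have XW: "X \<ge> 0" "W \<ge> 0" by (simp_all add: X_def W_def sum_nonneg)
  have m9: "m \<ge> 9" using power_mono[of 3 "real (d p q - 1)" 2] D by (simp add: m_def)
  have S: "16 * real (card V) - 54 \<le> X + W + 2 * m"
    using far_squares_sum[OF D] unfolding Y_def[symmetric] split sum.distrib X_def[symmetric] W_def[symmetric]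
    by (simp add: bf cf)
  \<comment> \<open>The form \<open>m * (X + W + m)\<close> must be bounded while only
    \<open>X + W + 2 * m\<close> is controlled. For a fixed value of the latter it is smallest at
    the least possible \<open>m = 9\<close>, whence \<open>63 = 54 + 9\<close>.\<close>
  have "9 * (16 * real (card V) - 63) \<le> 9 * (X + W + 2 * m - 9)" using S by simp
  also have "\<dots> \<le> m * (X + W + m)"
  proof -
    have "0 \<le> (m - 9) * (X + W + (m - 9))" using m9 XW by simp
    then show ?thesis by (simp add: algebra_simps)
  qed
  also have "\<dots> = (m + X) * (m + W) - X * W" by (simp add: algebra_simps)
  also have "\<dots> \<le> (m + X) * (m + W) - Z\<^sup>2" using \<open>Z\<^sup>2 \<le> X * W\<close> by simp
  finally show ?thesis
    unfolding Y_def[symmetric] split X_def[symmetric] W_def[symmetric] Z_def[symmetric]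
    by (simp add: bf cf)
qed

end

lemma energy_diameter_ge_4:
  fixes T :: "'a pair_pre_digraph"
  assumes T: "graph_tree T" and dt: "diametral_tree (pverts T) (graph_dist T) p q"
    and D: "4 \<le> graph_dist T p q" and n: "card (pverts T) = n"
  shows "2 * sqrt (16 * real n - 54 + 2 * sqrt (9 * (16 * real n - 63))) \<le> ecc_energy T"
proof -
  interpret diametral_tree "pverts T" "graph_dist T" p q by (rule dt)
  have ecc: "eccentricity T u = max (graph_dist T u p) (graph_dist T u q)" if "u \<in> pverts T" for u
    unfolding eccentricity_def by (rule ecc_eq[OF that])
  have sym: "real (ecc_entry T v w) = real (ecc_entry T w v)" if "v \<in> pverts T" "w \<in> pverts T" for v w
    using dist_sym[OF that] by (simp add: ecc_entry_def min.commute)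
  obtain N l u where eig: "eigen_decomposition (pverts T) (\<lambda>v w. real (ecc_entry T v w)) N l u"
    and en: "ecc_energy T = (\<Sum>k<N. \<bar>l k\<bar>)"
    using ecc_energy_eigen_decomposition[of T, OF fin sym] by blast
  interpret eigen_decomposition "pverts T" "\<lambda>v w. real (ecc_entry T v w)" N l u by (rule eig)
  have ecc_pq: "eccentricity T p = graph_dist T p q" "eccentricity T q = graph_dist T p q"
    using ecc_end by (simp_all add: eccentricity_def)
  have rowp: "real (ecc_entry T p v) = far_p v" and rowq: "real (ecc_entry T q v) = far_q v"
    if "v \<in> pverts T" for v
    using diam[OF that pV] diam[OF that qV] dist_sym[OF that pV] dist_sym[OF that qV]
    by (auto simp: ecc_entry_def ecc[OF that] ecc_pq far_p_def far_q_def min_def max_def)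
  define Y where "Y = pverts T - {p, q}"
  have Xeq: "(\<Sum>y\<in>Y. (real (ecc_entry T p y))\<^sup>2) = (\<Sum>y\<in>Y. (far_p y)\<^sup>2)"
    and Weq: "(\<Sum>y\<in>Y. (real (ecc_entry T q y))\<^sup>2) = (\<Sum>y\<in>Y. (far_q y)\<^sup>2)"
    and Zeq: "(\<Sum>y\<in>Y. real (ecc_entry T p y) * real (ecc_entry T q y)) = (\<Sum>y\<in>Y. far_p y * far_q y)"
    by (intro sum.cong refl; simp add: Y_def rowp rowq)+
  have pq: "p \<noteq> q" using D dist_self[OF pV] by auto
  have "real n \<ge> 5" using diameter_less_card D n by simp
  then have pos: "9 * (16 * real n - 63) > 0" by simp
  note gram = far_gram[OF D, folded Y_def, unfolded n]
  note S = far_squares_sum[OF D, folded Y_def, unfolded n sum.distrib]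
  have "2 * sqrt (16 * real n - 54 + 2 * sqrt (9 * (16 * real n - 63)))
    \<le> 2 * sqrt ((\<Sum>y\<in>Y. (far_p y)\<^sup>2) + (\<Sum>y\<in>Y. (far_q y)\<^sup>2) +
        2 * sqrt ((\<Sum>y\<in>Y. (far_p y)\<^sup>2) * (\<Sum>y\<in>Y. (far_q y)\<^sup>2) - (\<Sum>y\<in>Y. far_p y * far_q y)\<^sup>2))"
    using S gram by (intro mult_left_mono real_sqrt_le_mono add_mono) auto
  also have "\<dots> \<le> (\<Sum>k<N. \<bar>l k\<bar>)"
    using energy_ge_two_rows[OF pV qV pq, of Y] gram pos unfolding Xeq Weq Zeq by (simp add: Y_def)
  finally show ?thesis by (simp add: en)
qed

section \<open>The complement of a tree of diameter at least four\<close>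

lemma graph_compl_simps [simp]:
  "pverts (graph_compl G) = pverts G"
  "(u, v) \<in> parcs (graph_compl G) \<longleftrightarrow> u \<in> pverts G \<and> v \<in> pverts G \<and> u \<noteq> v \<and> (u, v) \<notin> parcs G"
  by (auto simp: graph_compl_def)

lemma pair_wf_digraph_graph_compl: "pair_wf_digraph (graph_compl G)"
  by unfold_locales auto

context diametral_tree
begin

text \<open>
  A closed walk \<open>u z v z'\<close> is sent to the pair of arcs \<open>(u, z)\<close>, \<open>(v, z')\<close>, whose tails have the
  same colour in the bipartition. The disjoint pairs of edges on the diametral path, each counted
  in four ways, are missed.
\<close>

lemma closed_walks_card:
  assumes D: "4 \<le> d p q"
  shows "real (card {(u, z, v, z'). u \<in> V \<and> z \<in> V \<and> v \<in> V \<and> z' \<in> V \<and> d u z = 1 \<and> d z v = 1 \<and> d u z' = 1 \<and> d z' v = 1})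
    \<le> 2 * ((real (card V) - 1)\<^sup>2 - 6)"
proof -
  define C where "C = {(u, z, v, z'). u \<in> V \<and> z \<in> V \<and> v \<in> V \<and> z' \<in> V \<and> d u z = 1 \<and> d z v = 1 \<and> d u z' = 1 \<and> d z' v = 1}"
  define A where "A = {(u, v). u \<in> V \<and> v \<in> V \<and> d u v = 1}"
  define A0 where "A0 = {e \<in> A. even (d (fst e) p)}"
  define A1 where "A1 = {e \<in> A. odd (d (fst e) p)}"
  have finA: "finite A" using finite_subset[of A "V \<times> V"] fin by (auto simp: A_def)
  have par: "even (d u p + d v p + d u v)" if "u \<in> V" "v \<in> V" for u v
    using parity[OF that(1) pV that(2)] dist_sym[OF pV that(2)] dist_sym[OF that] by (simp add: ac_simps)
  have flip: "odd (d u p) \<longleftrightarrow> even (d v p)" if "(u, v) \<in> A" for u v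
    using par[of u v] that by (auto simp: A_def)
  have sw: "(v, u) \<in> A" if "(u, v) \<in> A" for u v
    using that dist_sym by (simp add: A_def)
  have "bij_betw prod.swap A0 A1"
    by (rule bij_betw_byWitness[of _ prod.swap])
      (auto simp: A0_def A1_def sw dest: flip)
  then have c01: "card A0 = card A1" by (rule bij_betw_same_card)
  have A01: "A = A0 \<union> A1" "A0 \<inter> A1 = {}" by (auto simp: A0_def A1_def)
  have fin01: "finite A0" "finite A1" using finA A01(1) by simp_all
  have "card A = card A0 + card A1" unfolding A01(1) by (rule card_Un_disjoint[OF fin01 A01(2)])
  moreover have "card A = 2 * (card V - 1)" using card_arcs by (simp add: A_def)
  ultimately have c0: "card A0 = card V - 1" "card A1 = card V - 1" using c01 by simp_all
  \<comment> \<open>The tails \<open>u\<close> and \<open>v\<close> have a common neighbour, hence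
    the same colour. Reversal exchanges the two colour classes of arcs, so each has
    \<open>card V - 1\<close> elements.\<close>
  define P where "P = A0 \<times> A0 \<union> A1 \<times> A1"
  have finP: "finite P" using fin01 by (simp add: P_def)
  have cP: "card P = 2 * (card V - 1)\<^sup>2"
    unfolding P_def using fin01 A01(2) c0
    by (subst card_Un_disjoint) (auto simp: card_cartesian_product power2_eq_square)
  obtain a where a: "\<And>i. i \<le> d p q \<Longrightarrow> a i \<in> V \<and> d (a i) p = i \<and> d (a i) p + d (a i) q = d p q"
    and step: "\<And>i. i < d p q \<Longrightarrow> d (a i) (a (Suc i)) = 1"
    using diametral_path by metis
  \<comment> \<open>The disjoint pairs among the four edges of the path 0-1-2-3-4 are 01 with 23, 01
    with 34 and 12 with 34. Each gives two orders and two orientations with tails of equal parity,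
    twelve in all. In each, some two vertices that a closed walk would need adjacent are three
    levels apart. Without this deduction the bound would fail to suffice for five vertices.\<close>
  define L :: "((nat \<times> nat) \<times> nat \<times> nat) set" where
    "L = {((0,1),(2,3)), ((2,3),(0,1)), ((1,0),(3,2)), ((3,2),(1,0)),
          ((0,1),(4,3)), ((4,3),(0,1)), ((1,0),(3,4)), ((3,4),(1,0)),
          ((1,2),(3,4)), ((3,4),(1,2)), ((2,1),(4,3)), ((4,3),(2,1))}"
  define X where "X = map_prod (map_prod a a) (map_prod a a) ` L"
  have lev: "a i \<in> V" "d (a i) p = i" if "i \<le> 4" for i using a[of i] that D by auto
  have adj: "(a i, a j) \<in> A" if "j = Suc i \<or> i = Suc j" "i \<le> 4" "j \<le> 4" for i j
    using step[of i] step[of j] that D lev[of i] lev[of j] dist_sym[of "a i" "a j"] by (auto simp: A_def)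
  have nadj: "d (a i) (a j) \<noteq> 1" if "j = i + 3 \<or> i = j + 3" "i \<le> 4" "j \<le> 4" for i j
  proof -
    have i: "a i \<in> V" "d (a i) p = i" and j: "a j \<in> V" "d (a j) p = j" using lev that by auto
    show ?thesis
      using tri[OF i(1) j(1) pV] tri[OF j(1) i(1) pV] dist_sym[OF i(1) j(1)] i j that by auto
  qed
  have inj: "inj_on a {..4}" by (rule inj_onI) (metis lev(2) atMost_iff)
  have cX: "card X = 12"
  proof -
    have "L \<subseteq> ({..4} \<times> {..4}) \<times> ({..4} \<times> {..4})" by (simp add: L_def)
    moreover have "inj_on (map_prod (map_prod a a) (map_prod a a)) (({..4} \<times> {..4}) \<times> ({..4} \<times> {..4}))"
      by (intro map_prod_inj_on inj)
    ultimately have "card X = card L" unfolding X_def by (intro card_image) (rule inj_on_subset)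
    also have "card L = 12" by (simp add: L_def)
    finally show ?thesis .
  qed
  have XP: "X \<subseteq> P"
    by (auto simp: X_def L_def P_def A0_def A1_def adj lev)
  define \<phi> :: "'a \<times> 'a \<times> 'a \<times> 'a \<Rightarrow> ('a \<times> 'a) \<times> ('a \<times> 'a)" where "\<phi> = (\<lambda>(u, z, v, z'). ((u, z), (v, z')))"
  have "inj_on \<phi> C" by (auto simp: inj_on_def \<phi>_def)
  then have "card C = card (\<phi> ` C)" by (simp add: card_image)
  also have "\<phi> ` C \<subseteq> P - X"
  proof
    fix e assume "e \<in> \<phi> ` C"
    then obtain u z v z' where e: "e = ((u, z), (v, z'))" and m: "u \<in> V" "z \<in> V" "v \<in> V" "z' \<in> V"
      and dd: "d u z = 1" "d z v = 1" "d u z' = 1" "d z' v = 1"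
      by (auto simp: C_def \<phi>_def)
    have A: "(u, z) \<in> A" "(z, v) \<in> A" "(v, z') \<in> A"
      using m dd dist_sym[OF m(4,3)] by (auto simp: A_def)
    have "e \<in> P" using A flip[OF A(1)] flip[OF A(2)] by (auto simp: e P_def A0_def A1_def)
    moreover have "e \<notin> X"
    proof
      assume "e \<in> X"
      then obtain i j k h where L: "((i, j), (k, h)) \<in> L" and ue: "u = a i" "z = a j" "v = a k" "z' = a h"
        by (auto simp: X_def e)
      have "(k = j + 3 \<or> j = k + 3) \<and> k \<le> 4 \<and> j \<le> 4 \<or> (h = i + 3 \<or> i = h + 3) \<and> h \<le> 4 \<and> i \<le> 4"
        using L by (auto simp: L_def)
      then show False using nadj dd(2,3) unfolding ue by metis
    qed
    ultimately show "e \<in> P - X" by simp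
  qed
  then have "card (\<phi> ` C) \<le> card (P - X)" using finP by (intro card_mono) auto
  also have "card (P - X) = 2 * (card V - 1)\<^sup>2 - 12"
    using XP finP cX cP finite_subset[OF XP finP] by (simp add: card_Diff_subset)
  finally have "card C \<le> 2 * (card V - 1)\<^sup>2 - 12" .
  moreover have "12 \<le> 2 * (card V - 1)\<^sup>2" using card_mono[OF finP XP] cX cP by simp
  ultimately have "card C + 12 \<le> 2 * (card V - 1)\<^sup>2" by linarith
  then have "real (card C + 12) \<le> real (2 * (card V - 1)\<^sup>2)" by (rule of_nat_mono)
  then have "real (card C) \<le> 2 * (real (card V - 1))\<^sup>2 - 12" by simp
  moreover have "card V \<ge> 1" using pV fin by (auto simp: Suc_le_eq card_gt_0_iff)
  ultimately show ?thesis by (simp add: C_def of_nat_diff)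
qed

end

text \<open>The second moment of twice the adjacency matrix is four times the number of arcs,
  \<open>8 * (n - 1)\<close>. The fourth is 16 times the number of closed walks of length four, at
  most \<open>32 * ((n - 1)^2 - 6)\<close>.\<close>

lemma compl_energy_diameter_ge_4:
  fixes T :: "'a pair_pre_digraph"
  assumes T: "graph_tree T" and dt: "diametral_tree (pverts T) (graph_dist T) p q"
    and D: "4 \<le> graph_dist T p q" and n: "card (pverts T) = n"
  shows "sqrt ((8 * (real n - 1)) ^ 3 / (32 * ((real n - 1)\<^sup>2 - 6))) \<le> ecc_energy (graph_compl T)"
proof -
  let ?V = "pverts T" and ?d = "graph_dist T" and ?G = "graph_compl T"
  interpret diametral_tree ?V ?d p q by (rule dt)
  note arcs = graph_tree_metric(2)[OF T]
  have adj: "(u, v) \<in> parcs T \<longleftrightarrow> u \<in> ?V \<and> v \<in> ?V \<and> ?d u v = 1" for u v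
    unfolding arcs by simp
  interpret C: pair_wf_digraph ?G by (rule pair_wf_digraph_graph_compl)
  define \<delta> where "\<delta> u v = (if u = v then 0 else if ?d u v = 1 then 2 else (1::nat))" for u v
  have dist: "graph_dist ?G u v = \<delta> u v" if "u \<in> ?V" "v \<in> ?V" for u v
  proof (rule C.graph_dist_eqI)
    fix u w v assume "(u, w) \<in> parcs ?G" "v \<in> pverts ?G"
    then show "\<delta> u v \<le> Suc (\<delta> w v)" by (auto simp: \<delta>_def adj)
  next
    fix u v k assume "u \<in> pverts ?G" "v \<in> pverts ?G" and k: "\<delta> u v = Suc k"
    then have uv: "u \<in> ?V" "v \<in> ?V" by simp_all
    show "\<exists>w. (u, w) \<in> parcs ?G \<and> \<delta> w v = k"
    proof (cases "?d u v = 1")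
      case False
      then show ?thesis using uv k by (intro exI[of _ v]) (auto simp: \<delta>_def adj split: if_splits)
    next
      case True
      \<comment> \<open>If both \<open>p\<close> and \<open>q\<close> were within distance one of
        the edge \<open>u v\<close>, their distance would be at most three. An end far from the edge
        is a common neighbour of \<open>u\<close> and \<open>v\<close> in the complement.\<close>
      have "\<exists>w\<in>{p, q}. 2 \<le> ?d u w \<and> 2 \<le> ?d v w"
      proof (rule ccontr)
        assume *: "\<not> ?thesis"
        have "?d p q \<le> ?d p u + ?d u q" "?d p q \<le> ?d p v + ?d v q"
          "?d p u \<le> ?d p v + ?d v u" "?d u q \<le> ?d u v + ?d v q" "?d v q \<le> ?d v u + ?d u q" "?d p v \<le> ?d p u + ?d u v"
          using uv pV qV by (auto intro: tri)
        then show False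
          using * D True dist_sym[OF uv] dist_sym[OF uv(1) pV] dist_sym[OF uv(2) pV] by auto
      qed
      then obtain w where w: "w \<in> ?V" "2 \<le> ?d u w" "2 \<le> ?d v w" using pV qV by blast
      have "u \<noteq> w" "w \<noteq> v" using w dist_self by auto
      then show ?thesis using w uv k True dist_sym[OF w(1) uv(2)]
        by (intro exI[of _ w]) (auto simp: \<delta>_def adj split: if_splits)
    qed
  qed (use that in \<open>auto simp: \<delta>_def split: if_splits\<close>)
  have ecc: "eccentricity ?G u = 2" if u: "u \<in> ?V" for u
  proof -
    have "\<exists>v\<in>?V. v \<noteq> u" using pV qV D dist_self[OF pV] by (metis not_numeral_le_zero)
    then obtain v where v: "v \<in> ?V" "v \<noteq> u" by blast
    then obtain k where "?d u v = Suc k" using dist_zero[OF u v(1)] by (cases "?d u v") auto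
    then obtain w where w: "w \<in> ?V" "?d u w = 1" using geodesic[OF u v(1)] by blast
    then have uw: "u \<noteq> w" using dist_self[OF u] by auto
    show ?thesis unfolding eccentricity_def
    proof (rule Max_eqI)
      show "finite (graph_dist ?G u ` pverts ?G)" using fin by simp
      show "2 \<in> graph_dist ?G u ` pverts ?G"
        using w u uw by (intro image_eqI[of _ _ w]) (auto simp: dist \<delta>_def)
    qed (use u in \<open>auto simp: dist \<delta>_def\<close>)
  qed
  have entry: "real (ecc_entry ?G u v) = 2 * of_bool (?d u v = 1)" if "u \<in> ?V" "v \<in> ?V" for u v
    using that dist_self[OF that(1)] by (auto simp: ecc_entry_def ecc dist \<delta>_def)
  have sym: "real (ecc_entry ?G v w) = real (ecc_entry ?G w v)" if "v \<in> pverts ?G" "w \<in> pverts ?G" for v w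
    using that dist_sym[of v w] by (simp add: entry)
  obtain N l u where eig: "eigen_decomposition (pverts ?G) (\<lambda>v w. real (ecc_entry ?G v w)) N l u"
    and en: "ecc_energy ?G = (\<Sum>k<N. \<bar>l k\<bar>)"
    using ecc_energy_eigen_decomposition[of ?G, OF _ sym] fin by auto
  interpret eigen_decomposition ?V "\<lambda>v w. real (ecc_entry ?G v w)" N l u
    using eig by simp
  have bool_sum: "(\<Sum>x\<in>S. of_bool (P x)) = real (card {x \<in> S. P x})" if "finite S" for S :: "'b set" and P
  proof -
    have "{x \<in> S. P x} = S \<inter> {x. P x}" by auto
    then show ?thesis using that by simp
  qed
  have n5: "real n \<ge> 5" using diameter_less_card D n by simp
  have p2: "(\<Sum>k<N. (l k)\<^sup>2) = 8 * (real n - 1)"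
  proof -
    have "(\<Sum>k<N. (l k)\<^sup>2) = (\<Sum>v\<in>?V. \<Sum>w\<in>?V. 4 * of_bool (?d v w = 1))"
      unfolding sum_eigenvalues_power2 by (intro sum.cong refl) (simp add: entry)
    also have "\<dots> = 4 * (\<Sum>e\<in>?V \<times> ?V. of_bool (?d (fst e) (snd e) = 1))"
      by (simp add: sum.cartesian_product sum_distrib_left case_prod_unfold)
    also have "(\<Sum>e\<in>?V \<times> ?V. of_bool (?d (fst e) (snd e) = 1)) = real (card {e \<in> ?V \<times> ?V. ?d (fst e) (snd e) = 1})"
      by (rule bool_sum) (simp add: fin)
    also have "{e \<in> ?V \<times> ?V. ?d (fst e) (snd e) = 1} = {(u, v). u \<in> ?V \<and> v \<in> ?V \<and> ?d u v = 1}"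
      by auto
    also have "real (card \<dots>) = 2 * (real n - 1)"
      unfolding card_arcs n using n5 by (simp add: of_nat_diff)
    finally show ?thesis by simp
  qed
  have p4: "(\<Sum>k<N. (l k)^4) \<le> 32 * ((real n - 1)\<^sup>2 - 6)"
  proof -
    define C where "C = {(u, z, v, z'). u \<in> ?V \<and> z \<in> ?V \<and> v \<in> ?V \<and> z' \<in> ?V \<and> ?d u z = 1 \<and> ?d z v = 1 \<and> ?d u z' = 1 \<and> ?d z' v = 1}"
    have "(\<Sum>k<N. (l k)^4) = (\<Sum>u\<in>?V. \<Sum>v\<in>?V. (\<Sum>z\<in>?V. 4 * of_bool (?d u z = 1 \<and> ?d z v = 1))\<^sup>2)"
      unfolding sum_eigenvalues_power4
      by (intro sum.cong refl arg_cong[of _ _ "\<lambda>x. x\<^sup>2"]) (simp add: entry)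
    also have "\<dots> = (\<Sum>u\<in>?V. \<Sum>v\<in>?V. \<Sum>z\<in>?V. \<Sum>z'\<in>?V. 16 * of_bool (?d u z = 1 \<and> ?d z v = 1 \<and> ?d u z' = 1 \<and> ?d z' v = 1))"
      unfolding power2_eq_square sum_product by (intro sum.cong refl) auto
    also have "\<dots> = (\<Sum>u\<in>?V. \<Sum>z\<in>?V. \<Sum>v\<in>?V. \<Sum>z'\<in>?V. 16 * of_bool (?d u z = 1 \<and> ?d z v = 1 \<and> ?d u z' = 1 \<and> ?d z' v = 1))"
      by (rule sum.cong[OF refl]) (rule sum.swap)
    also have "\<dots> = 16 * (\<Sum>(u, z, v, z')\<in>?V \<times> ?V \<times> ?V \<times> ?V. of_bool (?d u z = 1 \<and> ?d z v = 1 \<and> ?d u z' = 1 \<and> ?d z' v = 1))"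
      by (simp add: sum.cartesian_product sum_distrib_left case_prod_unfold)
    also have "(\<Sum>(u, z, v, z')\<in>?V \<times> ?V \<times> ?V \<times> ?V. of_bool (?d u z = 1 \<and> ?d z v = 1 \<and> ?d u z' = 1 \<and> ?d z' v = 1))
      = (\<Sum>e\<in>?V \<times> ?V \<times> ?V \<times> ?V. of_bool (e \<in> C))"
      by (intro sum.cong refl) (auto simp: C_def)
    also have "\<dots> = real (card {e \<in> ?V \<times> ?V \<times> ?V \<times> ?V. e \<in> C})"
      by (rule bool_sum) (simp add: fin)
    also have "{e \<in> ?V \<times> ?V \<times> ?V \<times> ?V. e \<in> C} = C" by (auto simp: C_def)
    finally show ?thesis using closed_walks_card[OF D] unfolding C_def n by simp
  qed
  have "(real n - 1)\<^sup>2 \<ge> 16" using power_mono[of 4 "real n - 1" 2] n5 by simp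
  then show ?thesis
    unfolding en using n5 by (intro energy_ge_holder[OF p2 p4]) auto
qed

section \<open>Stars and double stars\<close>

text \<open>Parity excludes triangles, so the diameter is 2 with a midpoint \<open>c\<close>. A
  vertex at distance 2 from \<open>c\<close> would have odd distances to \<open>p\<close> and
  \<open>q\<close>, hence distance 1 to both, and would coincide with \<open>c\<close>.\<close>

lemma (in diametral_tree) diameter_le_2_star:
  assumes D: "d p q \<le> 2" and n: "3 \<le> card V"
  shows "\<exists>c\<in>V. {(u, v). u \<in> V \<and> v \<in> V \<and> d u v = 1} = {c} \<times> (V - {c}) \<union> (V - {c}) \<times> {c}"
proof -
  have le: "d u v \<le> 2" if "u \<in> V" "v \<in> V" for u v using diam[OF that] D by simp
  have "d p q = 2"
  proof (rule ccontr)
    assume "d p q \<noteq> 2"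
    then have one: "d u v = 1" if "u \<in> V" "v \<in> V" "u \<noteq> v" for u v
      using diam[OF that(1,2)] D dist_zero[OF that(1,2)] that(3) by linarith
    obtain X where X: "X \<subseteq> V" "card X = 3" using obtain_subset_with_card_n[OF n] by blast
    then obtain x y z where "X = {x, y, z}" "x \<noteq> y" "y \<noteq> z" "x \<noteq> z" by (auto simp: card_3_iff)
    then show False using X(1) parity[of x y z] one[of x y] one[of y z] one[of z x] by simp
  qed
  obtain c where c: "c \<in> V" "d c p = 1" "d c q = 1"
    using diametral_path_step[OF pV] dist_self[OF pV] \<open>d p q = 2\<close> by auto
  have c1: "d v c = 1" if v: "v \<in> V" "v \<noteq> c" for v
  proof (rule ccontr)
    assume "d v c \<noteq> 1"
    then have vc: "d v c = 2" using le[OF v(1) c(1)] dist_zero[OF v(1) c(1)] v(2) by linarith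
    have "odd (d v p)" "odd (d v q)"
      using parity[OF v(1) c(1) pV] parity[OF v(1) c(1) qV] vc c dist_sym[OF v(1) pV] dist_sym[OF v(1) qV] by simp_all
    then have "d v p = 1" "d v q = 1" using le[OF v(1) pV] le[OF v(1) qV]
      by (auto simp: le_Suc_eq numeral_2_eq_2)
    then have "v = c" using on_diametral_path_unique[OF v(1) c(1)] c \<open>d p q = 2\<close> by simp
    then show False using v by simp
  qed
  have "d u v \<noteq> 1" if "u \<in> V" "v \<in> V" "u \<noteq> c" "v \<noteq> c" for u v
    using parity[OF that(1) c(1) that(2)] c1[of u] c1[of v] that dist_sym[OF that(1,2)] dist_sym[OF c(1) that(2)] by auto
  moreover have "d c v = 1" if "v \<in> V" "v \<noteq> c" for v
    using c1[OF that] dist_sym[OF c(1) that(1)] by simp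
  ultimately have "u \<in> V \<and> v \<in> V \<and> d u v = 1 \<longleftrightarrow> u = c \<and> v \<in> V - {c} \<or> u \<in> V - {c} \<and> v = c" for u v
    using c1 c(1) dist_self[OF c(1)] by (cases "u = c"; cases "v = c") auto
  then show ?thesis by (intro bexI[OF _ c(1)]) auto
qed

section \<open>Classes and distances in a double star\<close>

locale double_star = diametral_tree +
  fixes u0 v0
  assumes D3: "d p q = 3" and u0: "u0 \<in> V" "d u0 p = 1" "d u0 q = 2"
    and v0: "v0 \<in> V" "d v0 p = 2" "d v0 q = 1"
begin

definition "leaves_u = {w \<in> V. d w q = 3}"
definition "leaves_v = {w \<in> V. d w p = 3}"

lemma dist_le_3: "u \<in> V \<Longrightarrow> v \<in> V \<Longrightarrow> d u v \<le> 3"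
  using diam D3 by metis

text \<open>The four classes are numbered along the path \<open>p\<close>, \<open>u0\<close>, \<open>v0\<close>, \<open>q\<close>.\<close>

definition cls :: "'a \<Rightarrow> nat" where
  "cls w = (if w = u0 then 1 else if w = v0 then 2 else if d w p = 3 then 3 else 0)"

lemma uv_dist: "u0 \<noteq> v0" "d u0 v0 = 1"
proof -
  show ne: "u0 \<noteq> v0" using u0 v0 by auto
  have "d u0 v0 + d p q \<le> max (d u0 p + d v0 q) (d u0 q + d v0 p)"
    by (rule four_point[OF u0(1) v0(1) pV qV])
  then show "d u0 v0 = 1" using u0 v0 D3 dist_zero[OF u0(1) v0(1)] ne by linarith
qed

lemma leaf_u:
  assumes x: "x \<in> V" "d x q = 3"
  shows "d x u0 = 1" "d x v0 = 2"
proof -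
  have "even (d x p)" using sum_dist_ends(2)[OF x(1)] x(2) D3 by simp
  then have "d x p \<le> 2" using dist_le_3[OF x(1) pV] by presburger
  moreover have "d x u0 + d p q \<le> max (d x p + d u0 q) (d x q + d u0 p)"
    by (rule four_point[OF x(1) u0(1) pV qV])
  moreover have "x \<noteq> u0" using x u0 by auto
  ultimately show xu: "d x u0 = 1" using x u0 D3 dist_zero[OF x(1) u0(1)] by linarith
  have "d x v0 \<le> 2" using tri[OF x(1) u0(1) v0(1)] xu uv_dist by simp
  moreover have "even (d x v0)"
    using parity[OF x(1) u0(1) v0(1)] xu uv_dist dist_sym[OF x(1) v0(1)] by simp
  moreover have "x \<noteq> v0" using x v0 by auto
  ultimately show "d x v0 = 2" using dist_zero[OF x(1) v0(1)] by presburger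
qed

lemma swapped: "double_star V d q p v0 u0"
  using pV qV diam dist_sym[OF pV qV] D3 u0 v0 tree_metric_axioms
  by (simp add: double_star_def double_star_axioms_def diametral_tree_def diametral_tree_axioms_def)

lemmas leaf_v = double_star.leaf_u[OF swapped]

lemma vertex_cases:
  assumes "w \<in> V"
  obtains "w = u0" "cls w = 1" | "w = v0" "cls w = 2"
    | "d w q = 3" "cls w = 0" | "d w p = 3" "cls w = 3"
proof -
  have s: "d w p \<le> 3" "d w q \<le> 3" "even (d w p + d w q + 3)" "3 \<le> d w p + d w q"
    using dist_le_3[OF assms pV] dist_le_3[OF assms qV] sum_dist_ends[OF assms] D3 by simp_all
  have excl: "\<not> (d w p = 3 \<and> d w q = 3)" using s(3) by auto
  consider "d w p = 3" | "d w q = 3" | "d w p = 1" "d w q = 2" | "d w p = 2" "d w q = 1"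
  proof -
    have "d w p = 3 \<or> d w q = 3 \<or> (d w p \<le> 2 \<and> d w q \<le> 2)" using s by linarith
    moreover have "d w p + d w q \<noteq> 4" using s(3) by presburger
    ultimately show thesis using that s(4) by linarith
  qed
  then show thesis
  proof cases
    case 1
    then have "cls w = 3" using u0 v0 by (auto simp: cls_def)
    then show ?thesis using that(4) 1 by simp
  next
    case 2
    then have "cls w = 0" using u0 v0 excl by (auto simp: cls_def)
    then show ?thesis using that(3) 2 by simp
  next
    case 3
    then have "w = u0" using on_diametral_path_unique[OF assms u0(1)] u0 D3 by simp
    then show ?thesis using that(1) by (simp add: cls_def)
  next
    case 4
    then have "w = v0" using on_diametral_path_unique[OF assms v0(1)] v0 D3 by simp
    then show ?thesis using that(2) uv_dist by (simp add: cls_def)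
  qed
qed

lemma leaf_leaf:
  assumes "x \<in> V" "y \<in> V" "c \<in> V" "d x c = 1" "d y c = 1" "x \<noteq> y"
  shows "d x y = 2"
proof -
  have "d x y \<le> 2" using tri[OF assms(1,3,2)] assms(4,5) dist_sym[OF assms(2,3)] by simp
  moreover have "even (d x y)"
    using parity[OF assms(1,3,2)] assms(4,5) dist_sym[OF assms(2,3)] dist_sym[OF assms(1,2)] by simp
  ultimately show ?thesis using dist_zero[OF assms(1,2)] assms(6) by (auto simp: le_Suc_eq numeral_2_eq_2)
qed

lemma leaf_u_leaf_v:
  assumes x: "x \<in> V" "d x q = 3" and y: "y \<in> V" "d y p = 3"
  shows "d x y = 3"
proof -
  note fx = leaf_u[OF x] and fy = leaf_v[OF y]
  have "d x v0 + d u0 y \<le> max (d x u0 + d v0 y) (d x y + d v0 u0)"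
    by (rule four_point[OF x(1) v0(1) u0(1) y(1)])
  then have "d x y \<ge> 3"
    using fx fy uv_dist dist_sym[OF u0(1) y(1)] dist_sym[OF v0(1) y(1)] dist_sym[OF v0(1) u0(1)] by linarith
  then show ?thesis using dist_le_3[OF x(1) y(1)] by simp
qed

text \<open>With the classes numbered along the path, distances between classes are differences of
  numbers; the two truncated subtractions add up to the absolute difference. Distinct vertices of
  one class are leaves at the same centre.\<close>

lemma dist_cls:
  assumes "w \<in> V" "z \<in> V"
  shows "d w z = (if w = z then 0 else if cls w = cls z then 2 else cls w - cls z + (cls z - cls w))"
proof (cases "w = z")
  case False
  note sym = dist_sym[OF assms]
  from assms(1) show ?thesis
  proof (cases rule: vertex_cases)
    case 1
    from assms(2) show ?thesis
      using False 1 sym uv_dist leaf_u[OF assms(2)] leaf_v[OF assms(2)]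
      by (cases rule: vertex_cases) auto
  next
    case 2
    from assms(2) show ?thesis
      using False 2 sym uv_dist leaf_u[OF assms(2)] leaf_v[OF assms(2)]
      by (cases rule: vertex_cases) auto
  next
    case 3
    from assms(2) show ?thesis
      using False 3 uv_dist leaf_u[OF assms(1)] leaf_u[OF assms(2)] leaf_u_leaf_v[OF assms(1) 3(1) assms(2)]
        leaf_leaf[OF assms u0(1)]
      by (cases rule: vertex_cases) auto
  next
    case 4
    from assms(2) show ?thesis
      using False 4 sym uv_dist leaf_v[OF assms(1)] leaf_v[OF assms(2)] leaf_u_leaf_v[OF assms(2) _ assms(1) 4(1)]
        leaf_leaf[OF assms v0(1)]
      by (cases rule: vertex_cases) auto
  qed
qed (simp add: dist_self assms)

lemma cls_simps [simp]: "cls u0 = 1" "cls v0 = 2" "cls p = 0" "cls q = 3"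
  using uv_dist u0 v0 D3 dist_self[OF pV] dist_self[OF qV] dist_sym[OF pV qV] by (auto simp: cls_def)

lemma cls_center: "w \<in> V \<Longrightarrow> cls w = 1 \<longleftrightarrow> w = u0" "w \<in> V \<Longrightarrow> cls w = 2 \<longleftrightarrow> w = v0"
  using uv_dist by (auto simp: cls_def split: if_splits)

lemma cls_less: "cls w < 4"
  by (simp add: cls_def)

lemma cls_cases: obtains "cls w = 0" | "cls w = 1" | "cls w = 2" | "cls w = 3"
  using cls_less[of w] that by linarith

lemma cls_sets:
  "{w \<in> V. cls w = 0} = leaves_u" "{w \<in> V. cls w = 1} = {u0}"
  "{w \<in> V. cls w = 2} = {v0}" "{w \<in> V. cls w = 3} = leaves_v"
proof -
  have excl: "\<not> (d w p = 3 \<and> d w q = 3)" if "w \<in> V" for w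
    using sum_dist_ends(2)[OF that] D3 by auto
  have "cls w = 0 \<longleftrightarrow> d w q = 3" if "w \<in> V" for w
    using that by (cases rule: vertex_cases) (use excl[OF that] u0(3) v0(3) in auto)
  moreover have "cls w = 3 \<longleftrightarrow> d w p = 3" if "w \<in> V" for w
    using that by (cases rule: vertex_cases) (use excl[OF that] u0(2) v0(2) in auto)
  ultimately show "{w \<in> V. cls w = 0} = leaves_u" "{w \<in> V. cls w = 3} = leaves_v"
    by (auto simp: leaves_u_def leaves_v_def)
  show "{w \<in> V. cls w = 1} = {u0}" "{w \<in> V. cls w = 2} = {v0}"
    using u0(1) v0(1) cls_center by auto
qed

lemma leaves_card: "card leaves_u \<ge> 1" "card leaves_v \<ge> 1" "card leaves_u + card leaves_v + 2 = card V"
proof -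
  have fins: "finite leaves_u" "finite leaves_v" using fin by (simp_all add: leaves_u_def leaves_v_def)
  have "p \<in> leaves_u" "q \<in> leaves_v"
    using pV qV D3 dist_sym[OF pV qV] by (simp_all add: leaves_u_def leaves_v_def)
  then show "card leaves_u \<ge> 1" "card leaves_v \<ge> 1"
    using fins by (auto simp: Suc_le_eq card_gt_0_iff)
  have "card V = (\<Sum>i<4. card {w \<in> V. cls w = i})"
  proof -
    have "cls ` V \<subseteq> {..<4}" using cls_less by auto
    from sum.group[OF fin finite_lessThan this, of "\<lambda>_. 1::nat"] show ?thesis by simp
  qed
  then show "card leaves_u + card leaves_v + 2 = card V"
    using cls_sets by (simp add: eval_nat_numeral)
qed

lemma ecc_cls:
  assumes w: "w \<in> V"
  shows "Max (d w ` V) = (if cls w \<in> {1, 2} then 2 else 3)"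
  using ecc_eq[OF w] dist_le_3[OF w pV] dist_le_3[OF w qV] u0 v0
  by (cases rule: vertex_cases[OF w]) (auto simp: max_def)

lemma center_unique:
  assumes "w \<in> V" "z \<in> V" "w \<noteq> z" "cls w = cls z"
  shows "cls w \<noteq> 1" "cls w \<noteq> 2"
  using assms cls_center by metis+

end

section \<open>Energies of a double star and of its complement\<close>

lemma energy_double_star:
  fixes T :: "'a pair_pre_digraph"
  assumes T: "graph_tree T" and ds: "double_star (pverts T) (graph_dist T) p q u0 v0"
  defines "a \<equiv> real (card (double_star.leaves_u (pverts T) (graph_dist T) q))"
    and "b \<equiv> real (card (double_star.leaves_v (pverts T) (graph_dist T) p))"
  shows "ecc_energy T = 2 * sqrt (9 * (a * b) + 4 * (a + b) + 8 * sqrt (a * b))"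
    and "ecc_energy (graph_compl T) = 2 * sqrt (4 * (a + b) + 9 + 8 * sqrt (a * b))"
proof -
  let ?V = "pverts T" and ?d = "graph_dist T" and ?G = "graph_compl T"
  interpret double_star ?V ?d p q u0 v0 by (rule ds)
  have ab: "a \<ge> 1" "b \<ge> 1" using leaves_card by (simp_all add: a_def b_def)
  have sq: "2 * sqrt (16 * (a * b)) = 8 * sqrt (a * b)" by (simp add: real_sqrt_mult)
  \<comment> \<open>Nonzero entries for the tree: 3 between leaves at different centres, 2 between a
    centre and the leaves at the other centre. The weighted path therefore runs through
    \<open>u0\<close>, \<open>leaves_v\<close>, \<open>leaves_u\<close>, \<open>v0\<close>. For the
    complement the order given by \<open>cls\<close> itself is the right one.\<close>
  define \<pi> :: "nat \<Rightarrow> nat" where "\<pi> i = (if i = 0 then 2 else if i = 1 then 0 else if i = 2 then 3 else 1)" for i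
  have \<pi>: "\<pi> (cls w) < 4" for w by (simp add: \<pi>_def)
  have "\<pi> (cls w) = 0 \<longleftrightarrow> cls w = 1" "\<pi> (cls w) = 1 \<longleftrightarrow> cls w = 3"
    "\<pi> (cls w) = 2 \<longleftrightarrow> cls w = 0" "\<pi> (cls w) = 3 \<longleftrightarrow> cls w = 2" for w
    using cls_less[of w] by (auto simp: \<pi>_def)
  then have \<pi>sets: "{w \<in> ?V. \<pi> (cls w) = 0} = {u0}" "{w \<in> ?V. \<pi> (cls w) = 1} = leaves_v"
    "{w \<in> ?V. \<pi> (cls w) = 2} = leaves_u" "{w \<in> ?V. \<pi> (cls w) = 3} = {v0}"
    using cls_sets by simp_all
  have entry: "real (ecc_entry T w z) = path_weight (\<pi> (cls w)) (\<pi> (cls z))" if "w \<in> ?V" "z \<in> ?V" for w z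
    using center_unique[OF that]
    by (cases rule: cls_cases[of w]; cases rule: cls_cases[of z])
      (auto simp: ecc_entry_def eccentricity_def ecc_cls[OF that(1)] ecc_cls[OF that(2)] dist_cls[OF that] path_weight_def \<pi>_def)
  have sym: "real (ecc_entry T v w) = real (ecc_entry T w v)" if "v \<in> ?V" "w \<in> ?V" for v w
    using dist_sym[OF that] by (simp add: ecc_entry_def min.commute)
  obtain N l u where eig: "eigen_decomposition ?V (\<lambda>v w. real (ecc_entry T v w)) N l u"
    and en: "ecc_energy T = (\<Sum>k<N. \<bar>l k\<bar>)"
    using ecc_energy_eigen_decomposition[of T, OF fin sym] by blast
  have "(\<Sum>k<N. \<bar>l k\<bar>) = 2 * sqrt (4 * 1 * b + 9 * b * a + 4 * a * 1 + 2 * sqrt (16 * 1 * b * a * 1))"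
    using eigen_decomposition.energy_path_blowup[OF eig, of "\<lambda>w. \<pi> (cls w)", OF \<pi> entry] ab
    unfolding \<pi>sets by (simp add: a_def b_def)
  then show "ecc_energy T = 2 * sqrt (9 * (a * b) + 4 * (a + b) + 8 * sqrt (a * b))"
    unfolding en sq[symmetric] by (simp add: algebra_simps)
  note arcs = graph_tree_metric(2)[OF T]
  have adj: "(u, v) \<in> parcs T \<longleftrightarrow> u \<in> ?V \<and> v \<in> ?V \<and> ?d u v = 1" for u v
    unfolding arcs by simp
  interpret C: pair_wf_digraph ?G by (rule pair_wf_digraph_graph_compl)
  \<comment> \<open>In the complement the centres have no common neighbour, since every other vertex
    is adjacent in the tree to one of them. A shortest walk between them passes through a leaf at
    the far centre and then a leaf at the near one.\<close>
  define \<delta> where "\<delta> u v = (if u = v then 0 else if ?d u v = 1 then if {cls u, cls v} = {1, 2} then 3 else 2 else (1::nat))" for u v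
  have dist: "graph_dist ?G u v = \<delta> u v" if "u \<in> ?V" "v \<in> ?V" for u v
  proof (rule C.graph_dist_eqI)
    fix u w v assume *: "(u, w) \<in> parcs ?G" "v \<in> pverts ?G"
    then have V: "u \<in> ?V" "w \<in> ?V" "v \<in> ?V" "u \<noteq> w" "?d u w \<noteq> 1" by (auto simp: adj)
    show "\<delta> u v \<le> Suc (\<delta> w v)"
    proof (cases "?d u v = 1")
      case True
      then have wv: "w \<noteq> v" using V(5) by auto
      then have ge1: "1 \<le> \<delta> w v" by (simp add: \<delta>_def)
      show ?thesis
      proof (cases "{cls u, cls v} = {1, 2}")
        case True
        then have uv: "cls u = 1 \<and> cls v = 2 \<or> cls u = 2 \<and> cls v = 1" by (auto simp: doubleton_eq_iff)
        \<comment> \<open>The neighbours of a centre in the complement are the leaves at the other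
          centre, of class 3 for \<open>u0\<close> and class 0 for \<open>v0\<close>.\<close>
        have "cls w = 3 - (if cls u = 1 then 0 else 3)"
          using uv V(4,5) dist_cls[OF V(1,2)] center_unique[OF V(1,2,4)] cls_less[of w]
          by (cases rule: cls_cases[of w]) auto
        then have "2 \<le> \<delta> w v"
          using uv wv dist_cls[OF V(2,3)] by (auto simp: \<delta>_def doubleton_eq_iff)
        then show ?thesis by (simp add: \<delta>_def)
      next
        case False
        then show ?thesis using ge1 by (simp add: \<delta>_def)
      qed
    qed (simp add: \<delta>_def)
  next
    fix u v k assume "u \<in> pverts ?G" "v \<in> pverts ?G" and k: "\<delta> u v = Suc k"
    then have uv: "u \<in> ?V" "v \<in> ?V" by simp_all
    show "\<exists>w. (u, w) \<in> parcs ?G \<and> \<delta> w v = k"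
    proof (cases "?d u v = 1")
      case False
      then show ?thesis using uv k by (intro exI[of _ v]) (auto simp: \<delta>_def adj split: if_splits)
    next
      case True
      obtain w where w: "w \<in> ?V" "cls w = (if cls u = 1 \<or> cls v = 1 \<and> cls u = 0 then 3 else 0)"
        using pV qV cls_simps(3,4) by metis
      have uv_ne: "u \<noteq> v" using True dist_self[OF uv(1)] by auto
      have six: "cls u = 0 \<and> cls v = 1 \<or> cls u = 1 \<and> cls v = 0 \<or> cls u = 1 \<and> cls v = 2 \<or>
        cls u = 2 \<and> cls v = 1 \<or> cls u = 2 \<and> cls v = 3 \<or> cls u = 3 \<and> cls v = 2"
        using True dist_cls[OF uv] uv_ne
        by (cases rule: cls_cases[of u]; cases rule: cls_cases[of v]) simp_all
      have ne: "u \<noteq> w" "w \<noteq> v" using six w(2) by auto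
      have "?d u w \<noteq> 1" using six w(2) ne(1) dist_cls[OF uv(1) w(1)] by auto
      moreover have "\<delta> w v = (if {cls u, cls v} = {1, 2} then 2 else 1)"
        using six w(2) ne(2) dist_cls[OF w(1) uv(2)] by (auto simp: \<delta>_def doubleton_eq_iff)
      moreover have "k = (if {cls u, cls v} = {1, 2} then 2 else 1)"
      proof -
        have "\<delta> u v = (if {cls u, cls v} = {1, 2} then 3 else 2)" by (simp add: \<delta>_def True uv_ne)
        then show ?thesis using k by (cases "{cls u, cls v} = {1, 2}") simp_all
      qed
      ultimately show ?thesis using uv(1) w(1) ne(1) by (intro exI[of _ w]) (simp add: adj)
    qed
  qed (use that in \<open>auto simp: \<delta>_def split: if_splits\<close>)
  have ecc: "eccentricity ?G w = (if cls w \<in> {1, 2} then 3 else 2)" if w: "w \<in> ?V" for w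
    unfolding eccentricity_def
  proof (rule Max_eqI)
    show "finite (graph_dist ?G w ` pverts ?G)" using fin by simp
    obtain z where z: "z \<in> ?V" "cls z = (if cls w = 0 \<or> cls w = 2 then 1 else 2)"
      using u0(1) v0(1) cls_simps(1,2) by metis
    have "\<delta> w z = (if cls w \<in> {1, 2} then 3 else 2)"
      using z(2) by (cases rule: cls_cases[of w]) (auto simp: \<delta>_def dist_cls[OF w z(1)] doubleton_eq_iff)
    then show "(if cls w \<in> {1, 2} then 3 else 2) \<in> graph_dist ?G w ` pverts ?G"
      using w z(1) by (intro image_eqI[of _ _ z]) (auto simp: dist)
  next
    fix y assume "y \<in> graph_dist ?G w ` pverts ?G"
    then show "y \<le> (if cls w \<in> {1, 2} then 3 else 2)"
      using w by (auto simp: dist \<delta>_def doubleton_eq_iff)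
  qed
  have centry: "real (ecc_entry ?G w z) = path_weight (cls w) (cls z)" if "w \<in> ?V" "z \<in> ?V" for w z
    using center_unique[OF that]
    by (cases rule: cls_cases[of w]; cases rule: cls_cases[of z])
      (auto simp: ecc_entry_def ecc[OF that(1)] ecc[OF that(2)] dist[OF that] \<delta>_def dist_cls[OF that] path_weight_def doubleton_eq_iff)
  have csym: "real (ecc_entry ?G v w) = real (ecc_entry ?G w v)" if "v \<in> pverts ?G" "w \<in> pverts ?G" for v w
    using that by (simp add: centry) (auto simp: path_weight_def)
  obtain N' l' u' where ceig: "eigen_decomposition (pverts ?G) (\<lambda>v w. real (ecc_entry ?G v w)) N' l' u'"
    and cen: "ecc_energy ?G = (\<Sum>k<N'. \<bar>l' k\<bar>)"
    using ecc_energy_eigen_decomposition[of ?G, OF _ csym] fin by auto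
  then have ceig': "eigen_decomposition ?V (\<lambda>v w. real (ecc_entry ?G v w)) N' l' u'" by simp
  have "(\<Sum>k<N'. \<bar>l' k\<bar>) = 2 * sqrt (4 * a * 1 + 9 * 1 * 1 + 4 * 1 * b + 2 * sqrt (16 * a * 1 * 1 * b))"
    using eigen_decomposition.energy_path_blowup[OF ceig', of cls, OF cls_less centry] ab
    unfolding cls_sets by (simp add: a_def b_def)
  then show "ecc_energy ?G = 2 * sqrt (4 * (a + b) + 9 + 8 * sqrt (a * b))"
    unfolding cen sq[symmetric] by (simp add: algebra_simps)
qed

section \<open>Isomorphism with the extremal tree\<close>

text \<open>Isomorphisms of general digraphs carry an arc map and new head and tail functions. Here
  arcs are pairs of vertices, so the arc map is forced to be \<open>map_prod f f\<close> and only
  the vertex map remains.\<close>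

lemma digraph_iso_pair_iff:
  assumes G: "pair_wf_digraph G" and H: "pair_wf_digraph H"
  shows "digraph_iso (with_proj G) (with_proj H) \<longleftrightarrow>
    (\<exists>f. bij_betw f (pverts G) (pverts H) \<and>
      (\<forall>u\<in>pverts G. \<forall>v\<in>pverts G. (u, v) \<in> parcs G \<longleftrightarrow> (f u, f v) \<in> parcs H))"
proof
  interpret G: pair_wf_digraph G by (rule G)
  assume "digraph_iso (with_proj G) (with_proj H)"
  then obtain h where h: "G.digraph_isomorphism h" and Heq: "with_proj H = app_iso h (with_proj G)"
    unfolding digraph_iso_def by blast
  define f where "f = iso_verts h"
  have V: "pverts H = f ` pverts G" and A: "parcs H = iso_arcs h ` parcs G"
    and tl: "fst = iso_tail h" and hd: "snd = iso_head h"
    using arg_cong[OF Heq, of verts] arg_cong[OF Heq, of arcs] arg_cong[OF Heq, of tail] arg_cong[OF Heq, of head]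
    by (simp_all add: f_def)
  have inj: "inj_on f (pverts G)" using h by (simp add: G.digraph_isomorphism_def f_def)
  have arc: "iso_arcs h e = map_prod f f e" if "e \<in> parcs G" for e
  proof (rule prod_eqI)
    show "fst (iso_arcs h e) = fst (map_prod f f e)" "snd (iso_arcs h e) = snd (map_prod f f e)"
      using h that unfolding G.digraph_isomorphism_def tl hd by (simp_all add: f_def flip: tl hd)
  qed
  have A': "parcs H = map_prod f f ` parcs G" unfolding A using arc by (rule image_cong[OF refl])
  have "(u, v) \<in> parcs G \<longleftrightarrow> (f u, f v) \<in> parcs H" if "u \<in> pverts G" "v \<in> pverts G" for u v
  proof
    assume "(f u, f v) \<in> parcs H"
    then obtain a b where ab: "(a, b) \<in> parcs G" "f u = f a" "f v = f b" unfolding A' by auto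
    then have "u = a" "v = b"
      using inj that G.in_arcsD1[OF ab(1)] G.in_arcsD2[OF ab(1)] by (simp_all add: inj_on_def)
    then show "(u, v) \<in> parcs G" using ab by simp
  qed (auto simp: A')
  then show "\<exists>f. bij_betw f (pverts G) (pverts H) \<and>
      (\<forall>u\<in>pverts G. \<forall>v\<in>pverts G. (u, v) \<in> parcs G \<longleftrightarrow> (f u, f v) \<in> parcs H)"
    using V inj by (intro exI[of _ f]) (simp add: bij_betw_def)
next
  interpret G: pair_wf_digraph G by (rule G)
  interpret H: pair_wf_digraph H by (rule H)
  assume "\<exists>f. bij_betw f (pverts G) (pverts H) \<and>
      (\<forall>u\<in>pverts G. \<forall>v\<in>pverts G. (u, v) \<in> parcs G \<longleftrightarrow> (f u, f v) \<in> parcs H)"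
  then obtain f where bij: "bij_betw f (pverts G) (pverts H)"
    and arc: "\<And>u v. u \<in> pverts G \<Longrightarrow> v \<in> pverts G \<Longrightarrow> (u, v) \<in> parcs G \<longleftrightarrow> (f u, f v) \<in> parcs H"
    by blast
  have inj: "inj_on f (pverts G)" and V: "f ` pverts G = pverts H" using bij by (simp_all add: bij_betw_def)
  define h where "h = \<lparr>iso_verts = f, iso_arcs = map_prod f f, iso_head = snd, iso_tail = fst\<rparr>"
  have A: "map_prod f f ` parcs G = parcs H"
  proof
    show "map_prod f f ` parcs G \<subseteq> parcs H"
    proof
      fix e assume "e \<in> map_prod f f ` parcs G"
      then obtain u v where uv: "(u, v) \<in> parcs G" "e = (f u, f v)" by auto
      then show "e \<in> parcs H" using arc[OF G.in_arcsD1[OF uv(1)] G.in_arcsD2[OF uv(1)]] by simp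
    qed
    show "parcs H \<subseteq> map_prod f f ` parcs G"
    proof
      fix e assume e: "e \<in> parcs H"
      obtain x y where xy: "e = (x, y)" by (cases e)
      have "x \<in> f ` pverts G" "y \<in> f ` pverts G"
        using e H.in_arcsD1 H.in_arcsD2 unfolding V xy by blast+
      then obtain u v where uv: "u \<in> pverts G" "v \<in> pverts G" "x = f u" "y = f v" by blast
      then have "(u, v) \<in> parcs G" using arc e xy by simp
      then show "e \<in> map_prod f f ` parcs G" using uv xy by (intro image_eqI[of _ _ "(u, v)"]) simp_all
    qed
  qed
  have "inj_on (map_prod f f) (parcs G)"
  proof (rule inj_on_subset)
    show "inj_on (map_prod f f) (pverts G \<times> pverts G)" by (rule map_prod_inj_on[OF inj inj])
    show "parcs G \<subseteq> pverts G \<times> pverts G" using G.in_arcsD1 G.in_arcsD2 by auto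
  qed
  then have "G.digraph_isomorphism h"
    using inj G.wf_digraph_axioms by (simp add: G.digraph_isomorphism_def h_def)
  moreover have "with_proj H = app_iso h (with_proj G)"
    by (simp add: with_proj_def app_iso_def h_def V A)
  ultimately show "digraph_iso (with_proj G) (with_proj H)"
    unfolding digraph_iso_def by blast
qed

text \<open>The map sending \<open>i\<close> to \<open>min i 3\<close> folds all pendant vertices
  onto the path end 3, and adjacency becomes a difference of one on the path 0-1-2-3. This matches
  the description of a double star by \<open>cls\<close>.\<close>

lemma pendant_path_tree_simps:
  assumes "4 \<le> n"
  shows "pverts (pendant_path_tree n) = {0..<n}"
    and "(i, j) \<in> parcs (pendant_path_tree n) \<longleftrightarrow>
      i < n \<and> j < n \<and> min i 3 - min j 3 + (min j 3 - min i 3) = 1"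
proof -
  show "pverts (pendant_path_tree n) = {0..<n}" by (simp add: pendant_path_tree_def)
  have four: "i = 0 \<or> i = 1 \<or> i = 2 \<or> i = 3 \<or> 4 \<le> i" for i :: nat by linarith
  show "(i, j) \<in> parcs (pendant_path_tree n) \<longleftrightarrow>
      i < n \<and> j < n \<and> min i 3 - min j 3 + (min j 3 - min i 3) = 1"
    using four[of i] four[of j] assms
    by (elim disjE) (simp_all add: pendant_path_tree_def)
qed

lemma pair_wf_digraph_pendant_path_tree:
  assumes "4 \<le> n"
  shows "pair_wf_digraph (pendant_path_tree n)"
proof
  fix e assume e: "e \<in> parcs (pendant_path_tree n)"
  show "fst e \<in> pverts (pendant_path_tree n)" "snd e \<in> pverts (pendant_path_tree n)"
    using e pendant_path_tree_simps[OF assms] by (cases e; auto)+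
qed

text \<open>All vertices are within distance one of the vertex labelled 2, except the one labelled
  0, which is at distance two. So two distinct vertices are at most three apart, which rules out
  equality at larger diameter.\<close>

lemma iso_pendant_path_tree_diameter:
  fixes T :: "'a pair_pre_digraph"
  assumes T: "graph_tree T" and n: "4 \<le> n" and dt: "diametral_tree (pverts T) (graph_dist T) p q"
    and iso: "digraph_iso (with_proj T) (with_proj (pendant_path_tree n))"
  shows "graph_dist T p q \<le> 3"
proof -
  let ?V = "pverts T" and ?d = "graph_dist T"
  interpret diametral_tree ?V ?d p q by (rule dt)
  have wf: "pair_wf_digraph T"
    using T by (simp add: graph_tree_def pair_graph_def pair_digraph_def pair_fin_digraph_def)
  obtain f where bij: "bij_betw f ?V {0..<n}"
    and arc: "\<And>u v. u \<in> ?V \<Longrightarrow> v \<in> ?V \<Longrightarrow> (u, v) \<in> parcs T \<longleftrightarrow> (f u, f v) \<in> parcs (pendant_path_tree n)"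
    using iso unfolding digraph_iso_pair_iff[OF wf pair_wf_digraph_pendant_path_tree[OF n]]
      pendant_path_tree_simps(1)[OF n] by blast
  have fn: "f w < n" if "w \<in> ?V" for w using bij that by (auto simp: bij_betw_def)
  have adj: "?d u v = 1 \<longleftrightarrow> min (f u) 3 - min (f v) 3 + (min (f v) 3 - min (f u) 3) = 1"
    if "u \<in> ?V" "v \<in> ?V" for u v
    using arc[OF that] that fn graph_tree_metric(2)[OF T] pendant_path_tree_simps(2)[OF n, of "f u" "f v"] by auto
  have "1 \<in> f ` ?V" "2 \<in> f ` ?V" using bij n by (auto simp: bij_betw_def)
  then obtain g1 g2 where g: "g1 \<in> ?V" "f g1 = 1" "g2 \<in> ?V" "f g2 = 2" by (metis imageE)
  have g12: "?d g1 g2 = 1" using adj[OF g(1,3)] g by simp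
  have near: "?d w g2 \<le> 1" if w: "w \<in> ?V" "f w \<noteq> 0" for w
  proof (cases "f w = 2")
    case True
    then have "w = g2" using bij w g by (auto simp: bij_betw_def inj_on_def)
    then show ?thesis using dist_self[OF g(3)] by simp
  next
    case False
    have "f w = 1 \<or> 3 \<le> f w" using w False by linarith
    then have "?d w g2 = 1" using adj[OF w(1) g(3)] g(4) by (auto simp: min_def)
    then show ?thesis by simp
  qed
  have far: "?d w g2 \<le> 2" if w: "w \<in> ?V" for w
  proof (cases "f w = 0")
    case True
    then have "?d w g1 = 1" using adj[OF w g(1)] g by simp
    then show ?thesis using tri[OF w g(1,3)] g12 by simp
  qed (use near[OF w] in simp)
  show ?thesis
  proof (cases "p = q")
    case False
    then have "f p \<noteq> f q" using bij pV qV by (auto simp: bij_betw_def inj_on_def)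
    then have "f p \<noteq> 0 \<or> f q \<noteq> 0" by auto
    then have "?d p g2 + ?d q g2 \<le> 3"
      using near[OF pV] near[OF qV] far[OF pV] far[OF qV] by linarith
    then show ?thesis using tri[OF pV g(3) qV] dist_sym[OF qV g(3)] by simp
  qed (simp add: dist_self[OF qV])
qed

lemma double_star_iso_pendant_path_tree:
  fixes T :: "'a pair_pre_digraph"
  assumes T: "graph_tree T" and n: "4 \<le> n" "card (pverts T) = n"
    and ds: "double_star (pverts T) (graph_dist T) p q u0 v0"
    and one: "card (double_star.leaves_u (pverts T) (graph_dist T) q) = 1"
  shows "digraph_iso (with_proj T) (with_proj (pendant_path_tree n))"
proof -
  let ?V = "pverts T" and ?d = "graph_dist T"
  interpret double_star ?V ?d p q u0 v0 by (rule ds)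
  have wf: "pair_wf_digraph T"
    using T by (simp add: graph_tree_def pair_graph_def pair_digraph_def pair_fin_digraph_def)
  have fins: "finite leaves_v" using fin by (simp add: leaves_v_def)
  have "card leaves_v = card {3..<n}" using leaves_card(3) one n by simp
  then obtain h where h: "bij_betw h leaves_v {3..<n}"
    using finite_same_card_bij[OF fins, of "{3..<n}"] by auto
  obtain x where x: "leaves_u = {x}" using one card_1_singletonE by blast
  \<comment> \<open>With a single leaf at \<open>u0\<close>, the classes 0, 1, 2 are singletons and
    supply their own labels; the \<open>n - 3\<close> leaves at \<open>v0\<close> receive the labels
    from 3 on.\<close>
  define f where "f w = (if cls w = 3 then h w else cls w)" for w
  have h3: "3 \<le> h w \<and> h w < n" if "w \<in> ?V" "cls w = 3" for w
  proof -
    have "w \<in> leaves_v" using that cls_sets(4) by blast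
    then show ?thesis using bij_betwE[OF h] by auto
  qed
  have fc: "min (f w) 3 = cls w" if "w \<in> ?V" for w
    using h3[OF that] by (cases rule: cls_cases[of w]) (auto simp: f_def)
  have inj: "inj_on f ?V"
  proof (rule inj_onI)
    fix w z assume wz: "w \<in> ?V" "z \<in> ?V" "f w = f z"
    then have c: "cls w = cls z" using fc by metis
    show "w = z"
    proof (cases rule: cls_cases[of w])
      case 1
      then have "w \<in> leaves_u" "z \<in> leaves_u" using wz c cls_sets(1) by auto
      then show ?thesis using x by simp
    next
      case 4
      then have "w \<in> leaves_v" "z \<in> leaves_v" using wz c cls_sets(4) by auto
      moreover have "h w = h z" using wz(3) 4 c by (simp add: f_def)
      ultimately show ?thesis using h by (auto simp: bij_betw_def inj_on_def)
    qed (use center_unique[OF wz(1,2) _ c] in auto)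
  qed
  have "f ` ?V \<subseteq> {0..<n}"
    using h3 n(1) cls_less by (auto simp: f_def) (metis less_le_trans)
  then have "f ` ?V = {0..<n}"
    using card_image[OF inj] n(2) by (intro card_subset_eq) auto
  then have bij: "bij_betw f ?V {0..<n}" using inj by (simp add: bij_betw_def)
  have "(u, v) \<in> parcs T \<longleftrightarrow> (f u, f v) \<in> parcs (pendant_path_tree n)" if "u \<in> ?V" "v \<in> ?V" for u v
  proof -
    have "f u < n" "f v < n" using bij that by (auto simp: bij_betw_def)
    then have "(f u, f v) \<in> parcs (pendant_path_tree n) \<longleftrightarrow> cls u - cls v + (cls v - cls u) = 1"
      using pendant_path_tree_simps(2)[OF n(1)] fc[OF that(1)] fc[OF that(2)] by simp
    also have "\<dots> \<longleftrightarrow> ?d u v = 1" using dist_cls[OF that] by auto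
    finally show ?thesis using graph_tree_metric(2)[OF T] that by auto
  qed
  then show ?thesis
    unfolding digraph_iso_pair_iff[OF wf pair_wf_digraph_pendant_path_tree[OF n(1)]]
      pendant_path_tree_simps(1)[OF n(1)] using bij by blast
qed

lemma double_star_iso_pendant_path_tree_iff:
  fixes T :: "'a pair_pre_digraph"
  assumes T: "graph_tree T" and n: "4 \<le> n" "card (pverts T) = n"
    and ds: "double_star (pverts T) (graph_dist T) p q u0 v0"
  shows "digraph_iso (with_proj T) (with_proj (pendant_path_tree n)) \<longleftrightarrow>
    card (double_star.leaves_u (pverts T) (graph_dist T) q) = 1 \<or>
    card (double_star.leaves_v (pverts T) (graph_dist T) p) = 1"
proof
  let ?V = "pverts T" and ?d = "graph_dist T"
  interpret double_star ?V ?d p q u0 v0 by (rule ds)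
  assume "card leaves_u = 1 \<or> card leaves_v = 1"
  moreover have "double_star.leaves_u ?V ?d p = leaves_v"
    unfolding double_star.leaves_u_def[OF swapped] leaves_v_def ..
  ultimately show "digraph_iso (with_proj T) (with_proj (pendant_path_tree n))"
    using double_star_iso_pendant_path_tree[OF T n ds] double_star_iso_pendant_path_tree[OF T n swapped] by auto
next
  let ?V = "pverts T" and ?d = "graph_dist T"
  interpret double_star ?V ?d p q u0 v0 by (rule ds)
  assume iso: "digraph_iso (with_proj T) (with_proj (pendant_path_tree n))"
  have wf: "pair_wf_digraph T"
    using T by (simp add: graph_tree_def pair_graph_def pair_digraph_def pair_fin_digraph_def)
  obtain f where bij: "bij_betw f ?V {0..<n}"
    and arc: "\<And>u v. u \<in> ?V \<Longrightarrow> v \<in> ?V \<Longrightarrow> (u, v) \<in> parcs T \<longleftrightarrow> (f u, f v) \<in> parcs (pendant_path_tree n)"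
    using iso unfolding digraph_iso_pair_iff[OF wf pair_wf_digraph_pendant_path_tree[OF n(1)]]
      pendant_path_tree_simps(1)[OF n(1)] by blast
  have fn: "f w < n" if "w \<in> ?V" for w using bij that by (auto simp: bij_betw_def)
  have adj: "?d u v = 1 \<longleftrightarrow> min (f u) 3 - min (f v) 3 + (min (f v) 3 - min (f u) 3) = 1"
    if "u \<in> ?V" "v \<in> ?V" for u v
    using arc[OF that] that fn graph_tree_metric(2)[OF T] pendant_path_tree_simps(2)[OF n(1), of "f u" "f v"] by auto
  have "0 \<in> f ` ?V" "1 \<in> f ` ?V" "2 \<in> f ` ?V" using bij n by (auto simp: bij_betw_def)
  then obtain g0 g1 g2 where g: "g0 \<in> ?V" "f g0 = 0" "g1 \<in> ?V" "f g1 = 1" "g2 \<in> ?V" "f g2 = 2"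
    by (metis imageE)
  have g02: "g0 \<noteq> g2" using g by auto
  have nb: "?d g1 g0 = 1" "?d g1 g2 = 1" using adj g by simp_all
  have nbr: "w \<in> {g0, g2}" if w: "w \<in> ?V" "?d g1 w = 1" for w
  proof -
    have "f w = 0 \<or> f w = 2" using adj[OF g(3) w(1)] w(2) g(4) by (auto simp: min_def split: if_splits)
    then show ?thesis using bij w(1) g by (auto simp: bij_betw_def inj_on_def)
  qed
  \<comment> \<open>The preimage \<open>g1\<close> of vertex 1 has exactly two neighbours. If it is
    a centre, one of them is the other centre, which leaves room for one leaf. It cannot be a leaf,
    as that has only one neighbour.\<close>
  have card_le: "card N = 1" if N: "finite N" "N \<noteq> {}" "c \<notin> N" "insert c N \<subseteq> {w \<in> ?V. ?d g1 w = 1}" for c N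
  proof -
    have "insert c N \<subseteq> {g0, g2}" using N(4) nbr by blast
    then have "card (insert c N) \<le> card {g0, g2}" by (intro card_mono) auto
    then have "card N \<le> 1" using N(1,3) g02 by simp
    moreover have "card N \<noteq> 0" using N(1,2) by simp
    ultimately show ?thesis by linarith
  qed
  have fins: "finite leaves_u" "finite leaves_v" using fin by (simp_all add: leaves_u_def leaves_v_def)
  have ne: "leaves_u \<noteq> {}" "leaves_v \<noteq> {}" using leaves_card(1,2) by auto
  show "card leaves_u = 1 \<or> card leaves_v = 1"
  proof (cases rule: vertex_cases[OF g(3)])
    case 1
    have "insert v0 leaves_u \<subseteq> {w \<in> ?V. ?d g1 w = 1}"
      using leaf_u(1) dist_sym u0(1) v0(1) uv_dist(2) unfolding 1(1) leaves_u_def by auto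
    moreover have "v0 \<notin> leaves_u" using v0 by (simp add: leaves_u_def)
    ultimately show ?thesis using card_le[OF fins(1) ne(1)] by blast
  next
    case 2
    have "insert u0 leaves_v \<subseteq> {w \<in> ?V. ?d g1 w = 1}"
      using leaf_v(1) dist_sym u0(1) v0(1) uv_dist(2) unfolding 2(1) leaves_v_def by auto
    moreover have "u0 \<notin> leaves_v" using u0 by (simp add: leaves_v_def)
    ultimately show ?thesis using card_le[OF fins(2) ne(2)] by blast
  next
    case 3
    have "cls w = 1" if "w \<in> ?V" "?d g1 w = 1" for w
      using that dist_cls[OF g(3) that(1)] 3(2) by (auto split: if_splits)
    then have "g0 = u0" "g2 = u0" using g nb cls_center(1) by blast+
    then show ?thesis using g02 by simp
  next
    case 4
    have "cls w = 2" if "w \<in> ?V" "?d g1 w = 1" for w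
      using that dist_cls[OF g(3) that(1)] 4(2) cls_less[of w] by (auto split: if_splits)
    then have "g0 = v0" "g2 = v0" using g nb cls_center(2) by blast+
    then show ?thesis using g02 by simp
  qed
qed

section \<open>Comparison of the bounds\<close>

text \<open>Reduces nested square roots to polynomial inequalities: \<open>s\<close>,
  \<open>a\<close>, \<open>b\<close> lie above the roots on the left, \<open>r\<close> and
  \<open>x\<close> below those on the right, and \<open>2 * y\<close> below the last root. Each is
  checked by squaring.\<close>

lemma energy_bound_from_estimates:
  fixes n s a b r x y :: real
  assumes n: "n \<ge> 5" and nonneg: "s \<ge> 0" "a \<ge> 0" "b \<ge> 0"
    and s: "n - 3 \<le> s\<^sup>2" and a: "13 * n - 35 + 8 * s \<le> a\<^sup>2" and b: "4 * n + 1 + 8 * s \<le> b\<^sup>2"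
    and r: "r\<^sup>2 \<le> 9 * (16 * n - 63)" and x: "x\<^sup>2 \<le> 16 * n - 54 + 2 * r"
    and y: "y\<^sup>2 * ((n - 1)\<^sup>2 - 6) \<le> 4 * (n - 1) ^ 3" and less: "a + b < x + y"
  shows "sqrt (13 * n - 35 + 8 * sqrt (n - 3)) + sqrt (4 * n + 1 + 8 * sqrt (n - 3)) <
    sqrt (16 * n - 54 + 2 * sqrt (9 * (16 * n - 63))) + sqrt ((8 * (n - 1)) ^ 3 / (32 * ((n - 1)\<^sup>2 - 6))) / 2"
proof -
  have s': "sqrt (n - 3) \<le> s" using nonneg(1) s by (rule real_le_lsqrt)
  have "sqrt (13 * n - 35 + 8 * sqrt (n - 3)) \<le> a"
    using nonneg a s' by (intro real_le_lsqrt) auto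
  moreover have "sqrt (4 * n + 1 + 8 * sqrt (n - 3)) \<le> b"
    using nonneg b s' by (intro real_le_lsqrt) auto
  moreover have "r \<le> sqrt (9 * (16 * n - 63))" using r by (rule real_le_rsqrt)
  then have "x \<le> sqrt (16 * n - 54 + 2 * sqrt (9 * (16 * n - 63)))"
    using x by (intro real_le_rsqrt) auto
  moreover have "2 * y \<le> sqrt ((8 * (n - 1)) ^ 3 / (32 * ((n - 1)\<^sup>2 - 6)))"
  proof (rule real_le_rsqrt)
    have "(n - 1)\<^sup>2 \<ge> 16" using power_mono[of 4 "n - 1" 2] n by simp
    then have q: "(n - 1)\<^sup>2 - 6 > 0" by simp
    have "(2 * y)\<^sup>2 * (32 * ((n - 1)\<^sup>2 - 6)) = 128 * (y\<^sup>2 * ((n - 1)\<^sup>2 - 6))"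
      by (simp add: power_mult_distrib algebra_simps)
    also have "\<dots> \<le> (8 * (n - 1)) ^ 3"
      using y unfolding power_mult_distrib by simp
    finally show "(2 * y)\<^sup>2 \<le> (8 * (n - 1)) ^ 3 / (32 * ((n - 1)\<^sup>2 - 6))"
      using q by (simp add: pos_le_divide_eq)
  qed
  ultimately show ?thesis using less by simp
qed

lemma energy_bound_large:
  fixes n :: real
  assumes n: "n \<ge> 12"
  shows "sqrt (13 * n - 35 + 8 * sqrt (n - 3)) + sqrt (4 * n + 1 + 8 * sqrt (n - 3)) <
    sqrt (16 * n - 54 + 2 * sqrt (9 * (16 * n - 63))) + sqrt ((8 * (n - 1)) ^ 3 / (32 * ((n - 1)\<^sup>2 - 6))) / 2"
proof -
  define s where "s = sqrt (n - 3)"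
  have s3: "s \<ge> 3" unfolding s_def using n by (intro real_le_rsqrt) auto
  define q where "q = s\<^sup>2"
  have ns: "n = q + 3" using n by (simp add: s_def q_def)
  have ss: "q \<ge> 3 * s" using s3 by (simp add: q_def power2_eq_square)
  have y: "y\<^sup>2 * ((n - 1)\<^sup>2 - 6) \<le> 4 * (n - 1) ^ 3" if "y\<^sup>2 \<le> 4 * (n - 1)" for y
  proof -
    have "y\<^sup>2 * ((n - 1)\<^sup>2 - 6) \<le> y\<^sup>2 * (n - 1)\<^sup>2" by (intro mult_left_mono) auto
    also have "\<dots> \<le> 4 * (n - 1) * (n - 1)\<^sup>2" using that by (intro mult_right_mono) auto
    also have "\<dots> = 4 * (n - 1) ^ 3" by (simp add: power2_eq_square power3_eq_cube)
    finally show ?thesis .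
  qed
  have expand: "(c * s + e)\<^sup>2 = c * c * q + 2 * c * e * s + e * e" for c e
    by (simp add: q_def power2_eq_square algebra_simps)
  \<comment> \<open>All estimates are linear in \<open>s\<close>. The gap grows because the leading
    coefficients satisfy \<open>sqrt 13 < 361 / 100 < 4\<close>. The constant \<open>19 / 5\<close>
    is \<open>5 / 4 + 51 / 20\<close>, and \<open>e\<close> is the improvement of \<open>y\<close>
    over \<open>2 * s\<close>, possible only for moderate \<open>s\<close>.\<close>
  have main: ?thesis if "(2 * s + e)\<^sup>2 \<le> 4 * (n - 1)" "19 / 5 < 39 / 100 * s + 23 / 10 + e" for e
  proof (rule energy_bound_from_estimates)
    show "n - 3 \<le> s\<^sup>2" by (simp add: ns q_def)
    show "13 * n - 35 + 8 * s \<le> (361 / 100 * s + 5 / 4)\<^sup>2"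
      using s3 ss unfolding ns expand by simp
    show "4 * n + 1 + 8 * s \<le> (2 * s + 51 / 20)\<^sup>2"
      using s3 unfolding ns expand by simp
    \<comment> \<open>The linear form for \<open>r\<close> is chosen so that twice it completes
      \<open>16 * n - 54\<close> to the square of \<open>4 * s + 23 / 10\<close>, up to
      \<open>1 / 100\<close>.\<close>
    show "(46 / 5 * s + 113 / 20)\<^sup>2 \<le> 9 * (16 * n - 63)"
      using s3 ss unfolding ns expand by simp
    show "(4 * s + 23 / 10)\<^sup>2 \<le> 16 * n - 54 + 2 * (46 / 5 * s + 113 / 20)"
      using s3 unfolding ns expand by simp
    show "(2 * s + e)\<^sup>2 * ((n - 1)\<^sup>2 - 6) \<le> 4 * (n - 1) ^ 3" by (rule y) (rule that(1))
    show "361 / 100 * s + 5 / 4 + (2 * s + 51 / 20) < 4 * s + 23 / 10 + (2 * s + e)" using that(2) by simp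
  qed (use n s3 in auto)
  show ?thesis
  \<comment> \<open>For \<open>s\<close> near 3 the slack \<open>39 / 100 * s\<close> is too small
    with \<open>e = 0\<close>, so \<open>e = 9 / 20\<close> is used, admissible up to 4. Beyond 4
    the slack alone suffices.\<close>
  proof (cases "s \<le> 4")
    case True
    then show ?thesis
      using s3 unfolding ns expand by (intro main[unfolded ns expand, of "9 / 20"]) simp_all
  next
    case False
    then show ?thesis by (intro main[of 0]) (simp_all add: ns q_def power_mult_distrib)
  qed
qed

lemma energy_bound:
  assumes n: "n \<ge> (5::nat)"
  shows "sqrt (13 * real n - 35 + 8 * sqrt (real n - 3)) + sqrt (4 * real n + 1 + 8 * sqrt (real n - 3)) <
    sqrt (16 * real n - 54 + 2 * sqrt (9 * (16 * real n - 63))) +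
    sqrt ((8 * (real n - 1)) ^ 3 / (32 * ((real n - 1)\<^sup>2 - 6))) / 2"
proof -
  consider "n = 5" | "n = 6" | "n = 7" | "n = 8" | "n = 9" | "n = 10" | "n = 11" | "n \<ge> 12"
    using n by linarith
  then show ?thesis
  proof cases
    case 1
    show ?thesis
      \<comment> \<open>In the small cases \<open>s\<close>, \<open>a\<close>, \<open>b\<close> are
        decimal upper bounds and \<open>r\<close>, \<open>x\<close>, \<open>y\<close> decimal lower
        bounds.\<close>
      by (rule energy_bound_from_estimates[where s = "1.415" and a = "6.429" and b = "5.686" and r = "12.369"
            and x = "7.123" and y = "5.059"]) (simp_all add: 1 power2_eq_square power3_eq_cube)
  next
    case 2
    show ?thesis
      by (rule energy_bound_from_estimates[where s = "1.733" and a = "7.541" and b = "6.235" and r = "17.233"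
            and x = "8.744" and y = "5.129"]) (simp_all add: 2 power2_eq_square power3_eq_cube)
  next
    case 3
    show ?thesis
      by (rule energy_bound_from_estimates[where s = "2" and a = "8.486" and b = "6.709" and r = "21"
            and x = "10" and y = "5.366"]) (simp_all add: 3 power2_eq_square power3_eq_cube)
  next
    case 4
    show ?thesis
      by (rule energy_bound_from_estimates[where s = "2.237" and a = "9.322" and b = "7.135" and r = "24.186"
            and x = "11.062" and y = "5.648"]) (simp_all add: 4 power2_eq_square power3_eq_cube)
  next
    case 5
    show ?thesis
      by (rule energy_bound_from_estimates[where s = "2.45" and a = "10.08" and b = "7.524" and r = "27"
            and x = "12" and y = "5.942"]) (simp_all add: 5 power2_eq_square power3_eq_cube)
  next
    case 6
    show ?thesis
      by (rule energy_bound_from_estimates[where s = "2.646" and a = "10.779" and b = "7.885" and r = "29.546"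
            and x = "12.848" and y = "6.235"]) (simp_all add: 6 power2_eq_square power3_eq_cube)
  next
    case 7
    show ?thesis
      by (rule energy_bound_from_estimates[where s = "2.829" and a = "11.43" and b = "8.224" and r = "31.89"
            and x = "13.63" and y = "6.523"]) (simp_all add: 7 power2_eq_square power3_eq_cube)
  next
    case 8
    then show ?thesis by (intro energy_bound_large) simp
  qed
qed

section \<open>Conclusion by cases on the diameter\<close>

lemma tree_diametral_pair:
  assumes "tree_metric V d" "V \<noteq> {}"
  obtains p q where "diametral_tree V d p q"
proof -
  interpret tree_metric V d by (rule assms(1))
  define S where "S = (\<lambda>(u, v). d u v) ` (V \<times> V)"
  have S: "finite S" "S \<noteq> {}" using fin assms(2) by (simp_all add: S_def)
  have "Max S \<in> (\<lambda>(u, v). d u v) ` (V \<times> V)" using Max_in[OF S] by (simp only: S_def)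
  then obtain p q where pq: "p \<in> V" "q \<in> V" "d p q = Max S" by auto
  have "d u v \<le> d p q" if "u \<in> V" "v \<in> V" for u v
    unfolding pq(3) using that S(1) by (intro Max_ge) (auto simp: S_def)
  then show thesis
    using that[of p q] pq assms(1) by (simp add: diametral_tree_def diametral_tree_axioms_def)
qed

theorem theorem5p7:
  fixes T :: "'a pair_pre_digraph" and n :: nat
  assumes "graph_tree T"
    and "card (pverts T) = n"
    and "n \<ge> 4"
    and "\<not> complete_bipartite_digraph 1 (n - 1) (with_proj T)"
  shows "ecc_energy T + ecc_energy (graph_compl T)
           \<ge> 2 * (sqrt (13 * real n - 35 + 8 * sqrt (real n - 3))
                  + sqrt (4 * real n + 1 + 8 * sqrt (real n - 3)))
       \<and> (ecc_energy T + ecc_energy (graph_compl T)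
            = 2 * (sqrt (13 * real n - 35 + 8 * sqrt (real n - 3))
                   + sqrt (4 * real n + 1 + 8 * sqrt (real n - 3)))
          \<longleftrightarrow> digraph_iso (with_proj T) (with_proj (pendant_path_tree n)))"
proof -
  let ?V = "pverts T" and ?d = "graph_dist T"
  note T = assms(1) and card = assms(2) and n4 = assms(3)
  have "?V \<noteq> {}" using card n4 by auto
  then obtain p q where dt: "diametral_tree ?V ?d p q"
    using tree_diametral_pair[OF graph_tree_metric(1)[OF T]] by blast
  interpret diametral_tree ?V ?d p q by (rule dt)
  consider "?d p q \<le> 2" | "?d p q = 3" | "?d p q \<ge> 4" by linarith
  then show ?thesis
  proof cases
    case 1
    have "3 \<le> card ?V" using card n4 by simp
    from diameter_le_2_star[OF 1 this] obtain c where c: "c \<in> ?V"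
      "{(u, v). u \<in> ?V \<and> v \<in> ?V \<and> ?d u v = 1} = {c} \<times> (?V - {c}) \<union> (?V - {c}) \<times> {c}"
      by blast
    note star = trans[OF graph_tree_metric(2)[OF T] c(2)]
    have "card (?V - {c}) = n - 1" using c(1) card by simp
    moreover have "?V = {c} \<union> (?V - {c})" using c(1) by blast
    ultimately have "complete_bipartite_digraph 1 (n - 1) (with_proj T)"
      unfolding complete_bipartite_digraph_pair_def
      using fin star by (intro conjI exI[of _ "{c}"] exI[of _ "?V - {c}"]) simp_all
    then show ?thesis using assms(4) by simp
  next
    case 2
    obtain a where a: "\<And>i. i \<le> ?d p q \<Longrightarrow> a i \<in> ?V \<and> ?d (a i) p = i \<and> ?d (a i) p + ?d (a i) q = ?d p q"
      using diametral_path by metis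
    have ds: "double_star ?V ?d p q (a 1) (a 2)"
      using dt 2 a[of 1] a[of 2] by (simp add: double_star_def double_star_axioms_def)
    interpret double_star ?V ?d p q "a 1" "a 2" by (rule ds)
    define k where "k = card leaves_u"
    define m where "m = card leaves_v"
    have km: "1 \<le> k" "1 \<le> m" "k + m + 2 = n"
      using leaves_card card by (simp_all add: k_def m_def)
    define x where "x = real k * real m"
    \<comment> \<open>Since \<open>k + m = n - 2\<close> is fixed, the energy sum depends on the
      leaf numbers only through their product.\<close>
    define F where "F z = 2 * sqrt (9 * z + 4 * (real n - 2) + 8 * sqrt z) + 2 * sqrt (4 * real n + 1 + 8 * sqrt z)" for z
    have sum: "real k + real m = real n - 2" using km(3) by linarith
    have energy: "ecc_energy T + ecc_energy (graph_compl T) = F x"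
      using energy_double_star[OF T ds] unfolding k_def[symmetric] m_def[symmetric] sum
      by (simp add: F_def x_def algebra_simps)
    have F3: "2 * (sqrt (13 * real n - 35 + 8 * sqrt (real n - 3))
                  + sqrt (4 * real n + 1 + 8 * sqrt (real n - 3))) = F (real n - 3)"
      by (simp add: F_def algebra_simps)
    have F_less: "F z < F z'" if "0 \<le> z" "z < z'" for z z'
    proof -
      have "sqrt z < sqrt z'" using that by simp
      then have "sqrt (9 * z + 4 * (real n - 2) + 8 * sqrt z) < sqrt (9 * z' + 4 * (real n - 2) + 8 * sqrt z')"
        "sqrt (4 * real n + 1 + 8 * sqrt z) < sqrt (4 * real n + 1 + 8 * sqrt z')"
        using that by (intro real_sqrt_less_mono; linarith)+
      then show ?thesis unfolding F_def by linarith
    qed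
    \<comment> \<open>As \<open>n - 3 = k + m - 1\<close>, the excess of \<open>k * m\<close>
      factors; this gives the minimum and the equality case at once.\<close>
    have xn: "x - (real n - 3) = (real k - 1) * (real m - 1)"
      using sum by (simp add: x_def algebra_simps)
    have x_ge: "x \<ge> real n - 3" proof -
      have "0 \<le> (real k - 1) * (real m - 1)" using km(1,2) by simp
      then show ?thesis using xn by linarith
    qed
    have x_eq: "x = real n - 3 \<longleftrightarrow> k = 1 \<or> m = 1" using xn by auto
    have iso: "digraph_iso (with_proj T) (with_proj (pendant_path_tree n)) \<longleftrightarrow> x = real n - 3"
      using double_star_iso_pendant_path_tree_iff[OF T n4 card ds] x_eq by (simp add: k_def m_def)
    show ?thesis
    proof (cases "x = real n - 3")
      case False
      then have "F (real n - 3) < F x" using x_ge n4 by (intro F_less) auto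
      then show ?thesis using iso False unfolding F3 energy by simp
    next
      case True
      then show ?thesis using iso unfolding F3 energy by simp
    qed
  next
    case 3
    have n5: "n \<ge> 5"
      using diameter_less_card 3 card by simp
    have "2 * (sqrt (13 * real n - 35 + 8 * sqrt (real n - 3)) + sqrt (4 * real n + 1 + 8 * sqrt (real n - 3)))
      < ecc_energy T + ecc_energy (graph_compl T)"
    proof -
      have "2 * a < e + f" if "a < b + c / 2" "2 * b \<le> e" "c \<le> f" for a b c e f :: real
        using that by linarith
      then show ?thesis
        using energy_bound[OF n5] energy_diameter_ge_4[OF T dt 3 card] compl_energy_diameter_ge_4[OF T dt 3 card]
        by blast
    qed
    moreover have "\<not> digraph_iso (with_proj T) (with_proj (pendant_path_tree n))"
      using iso_pendant_path_tree_diameter[OF T n4 dt] 3 by auto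
    ultimately show ?thesis by simp
  qed
qed

end
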